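(* Let $n\ge1$ be an integer and $\mathbf{u}\in(L^2(\mathbb{R}^n))^n$. Let $M_\omega$ and $L_\omega$ be the Fourier multiplier operators on $(L^2(\mathbb{R}^n))^n$ attached to the tensorial Shannon wavelet decomposition, defined in the context. Define $$\mathbf{v}_0=\mathbf{u},\qquad \mathbf{v}_{p+1}=\mathbf{v}_p-M_\omega\mathbf{v}_p-L_\omega\mathbf{v}_p\quad(p\ge0).$$ Then $\mathbf{v}_p\to0$ in $L^2$ norm as $p\to\infty$, and the iteration separates the divergence-free part of $\mathbf{u}$ from its gradient part: $$\mathbf{u}_{\mathrm{div}}=\sum_{p\in\mathbb{N}}M_\omega\mathbf{v}_p,\qquad \mathbf{u}_{\mathrm{curl}}=\sum_{p\in\mathbb{N}}L_\omega\mathbf{v}_p ,$$ where $\mathbf{u}=\mathbf{u}_{\mathrm{div}}+\mathbf{u}_{\mathrm{curl}}$ is the Helmholtz decomposition of $\mathbf{u}$.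
   Context: Helmholtz decomposition: $(L^2(\mathbb{R}^n))^n=\mathbf{H}_{\mathrm{div}\,0}(\mathbb{R}^n)\oplus^{\perp}\mathbf{H}_{\mathrm{curl}\,0}(\mathbb{R}^n)$, where $\mathbf{H}_{\mathrm{div}\,0}$ is the space of divergence-free $L^2$ vector fields and $\mathbf{H}_{\mathrm{curl}\,0}$ is the space of $L^2$ gradient fields $\nabla q$; $\mathbf{u}_{\mathrm{div}}$ and $\mathbf{u}_{\mathrm{curl}}$ are the corresponding orthogonal projections of $\mathbf{u}$ ($\mathbf{u}_{\mathrm{div}}=\mathbb{P}\mathbf{u}$, with $\mathbb{P}$ the Leray projector, of symbol $\mathrm{Id}-|\xi|^{-2}\xi\xi^T$). Tensorial Shannon decomposition: for $\mathbf{j}\in\mathbb{Z}^n$, the level-$\mathbf{j}$ component of a field is its restriction in frequency to $\{\xi\in\mathbb{R}^n:|\xi_i|\in[2^{j_i}\pi,2^{j_i+1}\pi],\ i=1,\dots,n\}$; these sets cover almost every $\xi\in\mathbb{R}^n$ and overlap only on null sets. For $\xi$ in the box of index $\mathbf{j}$ put $\omega_i=2^{j_i}$, $|\omega|^2=\sum_{i=1}^n\omega_i^2$, and regard $\xi=(\xi_1,\dots,\xi_n)^T$ and $w=\left(\frac{\omega_1^2}{\xi_1},\dots,\frac{\omega_n^2}{\xi_n}\right)^T$ as column vectors. The operators $L_\omega$ and $M_\omega$ are defined by $\widehat{L_\omega\mathbf{v}}(\xi)=L_\omega(\xi)\widehat{\mathbf{v}}(\xi)$ and $\widehat{M_\omega\mathbf{v}}(\xi)=M_\omega(\xi)\widehat{\mathbf{v}}(\xi)$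 for almost every $\xi$, with $$L_\omega(\xi)=\frac{1}{|\omega|^2}\,\xi\,w^T,\qquad M_\omega(\xi)=\left(\mathrm{Id}-\frac{1}{|\omega|^2}\,w\,\xi^T\right)\left(\mathrm{Id}-\frac{1}{|\omega|^2}\,\xi\,w^T\right).$$ *)

theory Defs
  imports "HOL-Analysis.Analysis"
begin

text \<open>
  Elements of \<open>L\<^sup>2\<close> are represented by Lebesgue measurable functions; equality in \<open>L\<^sup>2\<close> is
  equality almost everywhere, and every notion below is invariant under it.
  Vector fields on \<open>\<real>\<^sup>n\<close> are complex valued, \<open>n\<close> being the cardinality of the index type.
\<close>

definition L2 :: "('a::euclidean_space \<Rightarrow> 'b::euclidean_space) set" where
  "L2 = {f. f \<in> borel_measurable lebesgue \<and> integrable lebesgue (\<lambda>x. (norm (f x))\<^sup>2)}"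

definition L2_norm :: "('a::euclidean_space \<Rightarrow> 'b::euclidean_space) \<Rightarrow> real" where
  "L2_norm f = sqrt (LINT x|lebesgue. (norm (f x))\<^sup>2)"

definition L2_inner :: "(real^'n \<Rightarrow> complex^'n) \<Rightarrow> (real^'n \<Rightarrow> complex^'n) \<Rightarrow> complex" where
  "L2_inner f g = (LINT x|lebesgue. (\<Sum>i\<in>UNIV. f x $ i * cnj (g x $ i)))"

definition L2_tendsto ::
  "('k \<Rightarrow> 'a::euclidean_space \<Rightarrow> 'b::euclidean_space) \<Rightarrow> ('a \<Rightarrow> 'b) \<Rightarrow> 'k filter \<Rightarrow> bool" where
  "L2_tendsto F f X \<longleftrightarrow>
     (\<forall>k. F k \<in> L2) \<and> f \<in> L2 \<and> ((\<lambda>k. L2_norm (\<lambda>x. F k x - f x)) \<longlongrightarrow> 0) X"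

definition L2_sums ::
  "(nat \<Rightarrow> 'a::euclidean_space \<Rightarrow> 'b::euclidean_space) \<Rightarrow> ('a \<Rightarrow> 'b) \<Rightarrow> bool" where
  "L2_sums F s \<longleftrightarrow> L2_tendsto (\<lambda>N x. \<Sum>p<N. F p x) s sequentially"

definition partial :: "'n \<Rightarrow> (real^'n \<Rightarrow> complex) \<Rightarrow> real^'n \<Rightarrow> complex" where
  "partial i f = (\<lambda>x. frechet_derivative f (at x) (axis i 1))"

text \<open>
  \<open>C\<^sub>c\<^sup>\<infinity>\<close>: every iterated partial derivative is differentiable everywhere (hence continuous).
\<close>

definition test_function :: "(real^'n \<Rightarrow> complex) \<Rightarrow> bool" where
  "test_function \<phi> \<longleftrightarrow>
     (\<forall>js. foldr partial js \<phi> differentiable_on UNIV) \<and> compact (closure {x. \<phi> x \<noteq> 0})"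

text \<open>Divergence and gradient are taken in the sense of distributions.\<close>

definition H_div0 :: "(real^'n \<Rightarrow> complex^'n) set" where
  "H_div0 = {v \<in> L2. \<forall>\<phi>. test_function \<phi> \<longrightarrow>
     (LINT x|lebesgue. (\<Sum>i\<in>UNIV. v x $ i * partial i \<phi> x)) = 0}"

definition locally_integrable :: "(real^'n \<Rightarrow> complex) \<Rightarrow> bool" where
  "locally_integrable q \<longleftrightarrow> (\<forall>K. compact K \<longrightarrow> set_integrable lebesgue K q)"

definition is_weak_gradient :: "(real^'n \<Rightarrow> complex) \<Rightarrow> (real^'n \<Rightarrow> complex^'n) \<Rightarrow> bool" where
  "is_weak_gradient q v \<longleftrightarrow> (\<forall>\<phi> i. test_function \<phi> \<longrightarrow>
     (LINT x|lebesgue. q x * partial i \<phi> x) = - (LINT x|lebesgue. v x $ i * \<phi> x))"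

definition H_curl0 :: "(real^'n \<Rightarrow> complex^'n) set" where
  "H_curl0 = {v \<in> L2. \<exists>q. locally_integrable q \<and> is_weak_gradient q v}"

text \<open>For a closed subspace \<open>H\<close> the choice is unique up to null sets.\<close>

definition orth_proj ::
  "(real^'n \<Rightarrow> complex^'n) set \<Rightarrow> (real^'n \<Rightarrow> complex^'n) \<Rightarrow> real^'n \<Rightarrow> complex^'n" where
  "orth_proj H u = (SOME d. d \<in> H \<and> (\<forall>h\<in>H. L2_inner (\<lambda>x. u x - d x) h = 0))"

definition div_part :: "(real^'n \<Rightarrow> complex^'n) \<Rightarrow> real^'n \<Rightarrow> complex^'n" where
  "div_part u = orth_proj H_div0 u"

definition curl_part :: "(real^'n \<Rightarrow> complex^'n) \<Rightarrow> real^'n \<Rightarrow> complex^'n" where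
  "curl_part u = orth_proj H_curl0 u"

text \<open>
  The Fourier transform on \<open>L\<^sup>2\<close>, as the \<open>L\<^sup>2\<close> limit for \<open>R \<rightarrow> \<infinity>\<close> of the truncated integrals of
  \<open>exp (- i x \<bullet> \<xi>) f(x)\<close> over the balls of radius \<open>R\<close> (componentwise, no normalising constant).
\<close>

definition fourier_trunc ::
  "real \<Rightarrow> (real^'n \<Rightarrow> complex^'n) \<Rightarrow> real^'n \<Rightarrow> complex^'n" where
  "fourier_trunc R f \<xi> = (LINT x:cball 0 R|lebesgue. cis (- (x \<bullet> \<xi>)) *s f x)"

definition fourier :: "(real^'n \<Rightarrow> complex^'n) \<Rightarrow> real^'n \<Rightarrow> complex^'n" where
  "fourier f = (SOME g. L2_tendsto (\<lambda>R. fourier_trunc R f) g at_top)"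

definition scale :: "int^'n \<Rightarrow> real^'n" where
  "scale j = (\<chi> i. 2 powi (j $ i))"

definition shannon_box :: "int^'n \<Rightarrow> (real^'n) set" where
  "shannon_box j =
     {\<xi>. \<forall>i. \<bar>\<xi> $ i\<bar> \<in> {2 powi (j $ i) * pi .. 2 powi (j $ i + 1) * pi}}"

text \<open>
  The operator whose symbol at almost every \<open>\<xi>\<close> in the box of index \<open>j\<close> is \<open>m (scale j) \<xi>\<close>.
\<close>

definition shannon_multiplier ::
  "(real^'n \<Rightarrow> real^'n \<Rightarrow> real^'n^'n) \<Rightarrow> (real^'n \<Rightarrow> complex^'n) \<Rightarrow> real^'n \<Rightarrow> complex^'n" where
  "shannon_multiplier m f = (SOME g. g \<in> L2 \<and>
     (\<forall>j. AE \<xi> in lebesgue. \<xi> \<in> shannon_box j \<longrightarrow>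
        fourier g \<xi> = map_matrix complex_of_real (m (scale j) \<xi>) *v fourier f \<xi>))"

definition outer :: "real^'n \<Rightarrow> real^'n \<Rightarrow> real^'n^'n" where
  "outer a b = (\<chi> i j. a $ i * b $ j)"

definition w_vec :: "real^'n \<Rightarrow> real^'n \<Rightarrow> real^'n" where
  "w_vec \<omega> \<xi> = (\<chi> i. (\<omega> $ i)\<^sup>2 / \<xi> $ i)"

definition L_symbol :: "real^'n \<Rightarrow> real^'n \<Rightarrow> real^'n^'n" where
  "L_symbol \<omega> \<xi> = (1 / (norm \<omega>)\<^sup>2) *\<^sub>R outer \<xi> (w_vec \<omega> \<xi>)"

definition M_symbol :: "real^'n \<Rightarrow> real^'n \<Rightarrow> real^'n^'n" where
  "M_symbol \<omega> \<xi> =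
     (mat 1 - (1 / (norm \<omega>)\<^sup>2) *\<^sub>R outer (w_vec \<omega> \<xi>) \<xi>) **
     (mat 1 - (1 / (norm \<omega>)\<^sup>2) *\<^sub>R outer \<xi> (w_vec \<omega> \<xi>))"

definition L_op :: "(real^'n \<Rightarrow> complex^'n) \<Rightarrow> real^'n \<Rightarrow> complex^'n" where
  "L_op = shannon_multiplier L_symbol"

definition M_op :: "(real^'n \<Rightarrow> complex^'n) \<Rightarrow> real^'n \<Rightarrow> complex^'n" where
  "M_op = shannon_multiplier M_symbol"

end

theory Submission
  imports Defs "HOL-Probability.Characteristic_Functions"
begin

text \<open>
  At a frequency \<open>\<xi>\<close> of a box put \<open>b = w / |\<omega>|\<^sup>2\<close>, so that \<open>\<xi> \<bullet> b = 1\<close>. Then \<open>Id - L = Id - \<xi> b\<^sup>T\<close> is a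
  projection \<open>P\<close> that kills \<open>\<xi>\<close>, \<open>M = P\<^sup>T P\<close>, and \<open>Id - M - L = (Id - P\<^sup>T) P\<close> has rank one with range
  spanned by \<open>b\<close>, on which it acts as the scalar \<open>1 - |\<xi>|\<^sup>2 |b|\<^sup>2\<close>. As \<open>|\<xi>\<^sub>i| / \<omega>\<^sub>i\<close> ranges over \<open>[\<pi>, 2 \<pi>]\<close>,
  Kantorovich's inequality gives \<open>1 \<le> |\<xi>|\<^sup>2 |b|\<^sup>2 \<le> 25 / 16\<close>, so the iteration contracts by \<open>9 / 16\<close> from the
  second step on. Summing the recursion, \<open>u\<close> is the sum of a field with transform orthogonal to \<open>\<xi>\<close>,
  one with transform parallel to \<open>\<xi>\<close>, and \<open>v\<^sub>N\<close>; hence the first two are within \<open>2 |v\<^sub>N|\<close> of the Helmholtz components.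

  Plancherel's theorem is derived from Gaussian regularisation. A Fubini argument gives the Bessel
  inequality and, tested against indicators of boxes, the inversion formula; both transforms are
  then bounded operators inverse to each other up to \<open>(2 \<pi>)\<^sup>n\<close>.
\<close>


text \<open>\<open>fourier\<close>, \<open>orth_proj\<close> and \<open>shannon_multiplier\<close>
  are choices by \<open>SOME\<close>: nothing is known about them until a witness is exhibited, and
  afterwards they are known only up to null sets. The witnesses come from completeness of the space
  of square integrable functions and from surjectivity of the transform. The other obstacle is that
  \<open>H_div0\<close> and \<open>H_curl0\<close> are defined through distributions, while the
  iteration is understood in frequency. One direction requires that a function orthogonal to the
  transforms of all test functions vanishes, even if it is not square integrable, as may happen for
  the product of \<xi> with a transform; explicit bumps and their translates settle this. The other
  direction requires an actual locally integrable potential for every field whose transform is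
  parallel to \<xi>, although division by |\<xi>| may destroy square integrability near the
  origin.\<close>

interpretation lebesgue: sigma_finite_measure "lebesgue :: 'a::euclidean_space measure"
proof
  obtain A :: "'a set set" where "countable A" "A \<subseteq> sets lborel" "\<Union>A = space lborel"
    "\<forall>a\<in>A. emeasure lborel a \<noteq> \<infinity>"
    using lborel.sigma_finite_countable by blast
  then show "\<exists>A::'a set set. countable A \<and> A \<subseteq> sets lebesgue \<and> \<Union>A = space lebesgue
      \<and> (\<forall>a\<in>A. emeasure lebesgue a \<noteq> \<infinity>)"
    by (intro exI[of _ A]) (auto simp: subset_eq)
qed

text \<open>Fubini and Tonelli are applied on the product of two completed measures, which is not
  itself complete; joint measurability is therefore assembled from the coordinates each
  time.\<close>

interpretation lebesgue_pair: pair_sigma_finite "lebesgue :: 'a::euclidean_space measure"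
  "lebesgue :: 'b::euclidean_space measure"
  by unfold_locales

section \<open>Square integrable functions\<close>

text \<open>The squared norm is additive over components and is multiplied by an exact constant
  under the Fourier transform. For limits the crude bound \<open>2 * sqn f + 2 * sqn g\<close> on
  sums replaces Minkowski's inequality.\<close>

definition sqn :: "('a::euclidean_space \<Rightarrow> 'b::euclidean_space) \<Rightarrow> real" where
  "sqn f = (LINT x|lebesgue. (norm (f x))\<^sup>2)"

lemma L2_norm_sqn: "L2_norm f = sqrt (sqn f)"
  by (simp add: L2_norm_def sqn_def)

lemma sqn_nonneg [simp]: "0 \<le> sqn f"
  by (simp add: sqn_def)

lemma L2_measurable: "f \<in> L2 \<Longrightarrow> f \<in> borel_measurable lebesgue"
  and L2_integrable: "f \<in> L2 \<Longrightarrow> integrable lebesgue (\<lambda>x. (norm (f x))\<^sup>2)"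
  by (auto simp: L2_def)

lemma L2_bound:
  assumes "f \<in> borel_measurable lebesgue" "integrable lebesgue g"
    and "AE x in lebesgue. (norm (f x))\<^sup>2 \<le> g x"
  shows "f \<in> L2"
  unfolding L2_def using assms
  by (auto intro!: Bochner_Integration.integrable_bound[OF assms(2)])

lemma L2_mono:
  assumes "f \<in> borel_measurable lebesgue" "g \<in> L2"
    and "AE x in lebesgue. norm (f x) \<le> C * norm (g x)"
  shows "f \<in> L2" "sqn f \<le> C\<^sup>2 * sqn g"
proof -
  have i: "integrable lebesgue (\<lambda>x. C\<^sup>2 * (norm (g x))\<^sup>2)"
    using L2_integrable[OF assms(2)] by simp
  have b: "AE x in lebesgue. (norm (f x))\<^sup>2 \<le> C\<^sup>2 * (norm (g x))\<^sup>2"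
    using assms(3) by eventually_elim (metis norm_ge_zero power_mono power_mult_distrib)
  show "f \<in> L2" by (rule L2_bound[OF assms(1) i b])
  then show "sqn f \<le> C\<^sup>2 * sqn g"
    unfolding sqn_def using b i
    by (subst integral_mult_right_zero[symmetric]) (rule integral_mono_AE, auto simp: L2_integrable)
qed

lemma L2_cong_AE:
  assumes "f \<in> L2" "AE x in lebesgue. f x = g x"
  shows "g \<in> L2"
proof (rule L2_bound)
  show "g \<in> borel_measurable lebesgue"
    using assms borel_measurable_AE L2_measurable by blast
  show "integrable lebesgue (\<lambda>x. (norm (f x))\<^sup>2)" using assms L2_integrable by blast
  show "AE x in lebesgue. (norm (g x))\<^sup>2 \<le> (norm (f x))\<^sup>2"
    using assms(2) by eventually_elim simp
qed

lemma sqn_cong_AE: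
  assumes "f \<in> L2" "AE x in lebesgue. f x = g x"
  shows "sqn f = sqn g"
  unfolding sqn_def
  using L2_measurable[OF assms(1)] L2_measurable[OF L2_cong_AE[OF assms]] assms(2)
  by (intro integral_cong_AE) (auto elim: eventually_mono)

lemma L2_zero [simp]: "(\<lambda>x. 0) \<in> L2" and sqn_zero [simp]: "sqn (\<lambda>x. 0) = 0"
  by (simp_all add: L2_def sqn_def)

lemma norm_add_sq_le: "(norm (a + b :: 'a::real_normed_vector))\<^sup>2 \<le> 2 * (norm a)\<^sup>2 + 2 * (norm b)\<^sup>2"
proof -
  have "(norm (a + b))\<^sup>2 \<le> (norm a + norm b)\<^sup>2"
    by (simp add: norm_triangle_ineq power_mono)
  also have "\<dots> \<le> 2 * (norm a)\<^sup>2 + 2 * (norm b)\<^sup>2"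
    using sum_squares_bound[of "norm a" "norm b"] by (simp add: power2_sum)
  finally show ?thesis .
qed

lemma L2_add:
  assumes "f \<in> L2" "g \<in> L2"
  shows "(\<lambda>x. f x + g x) \<in> L2" "sqn (\<lambda>x. f x + g x) \<le> 2 * sqn f + 2 * sqn g"
proof -
  have i: "integrable lebesgue (\<lambda>x. 2 * (norm (f x))\<^sup>2 + 2 * (norm (g x))\<^sup>2)"
    using assms[THEN L2_integrable] by simp
  show s: "(\<lambda>x. f x + g x) \<in> L2"
    using assms[THEN L2_measurable] by (intro L2_bound[OF _ i]) (auto simp: norm_add_sq_le)
  have "sqn (\<lambda>x. f x + g x) \<le> (LINT x|lebesgue. 2 * (norm (f x))\<^sup>2 + 2 * (norm (g x))\<^sup>2)"
    unfolding sqn_def using i L2_integrable[OF s] by (intro integral_mono) (auto simp: norm_add_sq_le)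
  then show "sqn (\<lambda>x. f x + g x) \<le> 2 * sqn f + 2 * sqn g"
    using assms[THEN L2_integrable] by (simp add: sqn_def)
qed

lemma L2_cmult:
  fixes f :: "'a::euclidean_space \<Rightarrow> complex"
  assumes "f \<in> L2"
  shows "(\<lambda>x. c * f x) \<in> L2" "sqn (\<lambda>x. c * f x) = (cmod c)\<^sup>2 * sqn f"
  using assms by (auto simp: L2_def sqn_def norm_mult power_mult_distrib)

lemma L2_uminus: "f \<in> L2 \<Longrightarrow> (\<lambda>x. - f x) \<in> L2" and sqn_uminus: "sqn (\<lambda>x. - f x) = sqn f"
  by (auto simp: L2_def sqn_def)

lemma L2_diff:
  assumes "f \<in> L2" "g \<in> L2"
  shows "(\<lambda>x. f x - g x) \<in> L2" "sqn (\<lambda>x. f x - g x) \<le> 2 * sqn f + 2 * sqn g"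
  using L2_add[OF assms(1) L2_uminus[OF assms(2)]] by (auto simp: sqn_uminus)

lemma L2_sum: "(\<And>i. i \<in> I \<Longrightarrow> f i \<in> L2) \<Longrightarrow> (\<lambda>x. \<Sum>i\<in>I. f i x) \<in> L2"
  by (induction I rule: infinite_finite_induct) (auto intro: L2_add)

lemma sqn_minus_commute: "sqn (\<lambda>x. f x - g x) = sqn (\<lambda>x. g x - f x)"
  by (simp add: sqn_def norm_minus_commute)

lemma sqn_eq_0_iff: "f \<in> L2 \<Longrightarrow> sqn f = 0 \<longleftrightarrow> (AE x in lebesgue. f x = 0)"
  unfolding sqn_def by (subst integral_nonneg_eq_0_iff_AE) (auto simp: L2_integrable)

lemma L2_tendsto_sqn:
  "L2_tendsto F f X \<longleftrightarrow> (\<forall>k. F k \<in> L2) \<and> f \<in> L2 \<and> ((\<lambda>k. sqn (\<lambda>x. F k x - f x)) \<longlongrightarrow> 0) X"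
proof -
  have "((\<lambda>k. sqrt (sqn (\<lambda>x. F k x - f x))) \<longlongrightarrow> 0) X \<longleftrightarrow> ((\<lambda>k. sqn (\<lambda>x. F k x - f x)) \<longlongrightarrow> 0) X"
  proof
    assume "((\<lambda>k. sqrt (sqn (\<lambda>x. F k x - f x))) \<longlongrightarrow> 0) X"
    from tendsto_power[OF this, of 2] show "((\<lambda>k. sqn (\<lambda>x. F k x - f x)) \<longlongrightarrow> 0) X" by simp
  next
    assume "((\<lambda>k. sqn (\<lambda>x. F k x - f x)) \<longlongrightarrow> 0) X"
    from tendsto_real_sqrt[OF this] show "((\<lambda>k. sqrt (sqn (\<lambda>x. F k x - f x))) \<longlongrightarrow> 0) X" by simp
  qed
  then show ?thesis by (simp add: L2_tendsto_def L2_norm_sqn)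
qed

lemma L2_tendsto_unique:
  assumes "L2_tendsto F f X" "L2_tendsto F g X" "X \<noteq> bot"
  shows "AE x in lebesgue. f x = g x"
proof -
  have L: "f \<in> L2" "g \<in> L2" "\<And>k. F k \<in> L2" using assms by (auto simp: L2_tendsto_def)
  have "((\<lambda>k. 2 * sqn (\<lambda>x. F k x - g x) + 2 * sqn (\<lambda>x. F k x - f x)) \<longlongrightarrow> 2 * 0 + 2 * 0) X"
    using assms by (intro tendsto_intros) (auto simp: L2_tendsto_sqn)
  moreover have "sqn (\<lambda>x. f x - g x) \<le> 2 * sqn (\<lambda>x. F k x - g x) + 2 * sqn (\<lambda>x. F k x - f x)" for k
    using L2_diff(2)[OF L2_diff(1)[OF L(3) L(2)] L2_diff(1)[OF L(3) L(1)], of k k] by simp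
  ultimately have "sqn (\<lambda>x. f x - g x) \<le> 0"
    using assms(3) by (intro tendsto_lowerbound) auto
  then have "sqn (\<lambda>x. f x - g x) = 0" by (meson antisym sqn_nonneg)
  then show ?thesis using sqn_eq_0_iff[OF L2_diff(1)[OF L(1,2)]] by simp
qed

lemma L2_tendsto_cong_AE:
  assumes "L2_tendsto F f X" "AE x in lebesgue. f x = g x"
  shows "L2_tendsto F g X"
proof -
  have "sqn (\<lambda>x. F k x - f x) = sqn (\<lambda>x. F k x - g x)" for k
    using assms by (intro sqn_cong_AE L2_diff) (auto simp: L2_tendsto_def elim: eventually_mono)
  then show ?thesis using assms L2_cong_AE[OF _ assms(2)] by (simp add: L2_tendsto_sqn)
qed

lemma L2_tendsto_add:
  assumes "L2_tendsto F f X" "L2_tendsto G g X"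
  shows "L2_tendsto (\<lambda>k x. F k x + G k x) (\<lambda>x. f x + g x) X"
  unfolding L2_tendsto_sqn
proof (intro conjI allI)
  show "(\<lambda>x. F k x + G k x) \<in> L2" for k using assms by (auto simp: L2_tendsto_def intro: L2_add)
  show "(\<lambda>x. f x + g x) \<in> L2" using assms by (auto simp: L2_tendsto_def intro: L2_add)
  have l: "((\<lambda>k. 2 * sqn (\<lambda>x. F k x - f x) + 2 * sqn (\<lambda>x. G k x - g x)) \<longlongrightarrow> 2 * 0 + 2 * 0) X"
    using assms by (intro tendsto_intros) (auto simp: L2_tendsto_sqn)
  have b: "sqn (\<lambda>x. F k x + G k x - (f x + g x)) \<le> 2 * sqn (\<lambda>x. F k x - f x) + 2 * sqn (\<lambda>x. G k x - g x)" for k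
    using L2_add(2)[OF L2_diff(1) L2_diff(1), of "F k" f "G k" g] assms
    by (auto simp: L2_tendsto_def algebra_simps)
  show "((\<lambda>k. sqn (\<lambda>x. F k x + G k x - (f x + g x))) \<longlongrightarrow> 0) X"
    by (rule tendsto_sandwich[OF _ _ tendsto_const l[simplified]]) (use b in auto)
qed

lemma L2_tendsto_cmult:
  fixes f :: "'a::euclidean_space \<Rightarrow> complex"
  assumes "L2_tendsto F f X"
  shows "L2_tendsto (\<lambda>k x. c * F k x) (\<lambda>x. c * f x) X"
proof -
  have "sqn (\<lambda>x. c * F k x - c * f x) = (cmod c)\<^sup>2 * sqn (\<lambda>x. F k x - f x)" for k
    using assms L2_cmult(2)[OF L2_diff(1), of "F k" f c] by (simp add: L2_tendsto_def right_diff_distrib)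
  then show ?thesis using assms
    by (auto simp: L2_tendsto_sqn L2_cmult intro!: tendsto_mult_right_zero)
qed

section \<open>Conjugates, the bilinear pairing and completeness\<close>

lemma borel_measurable_cnj [measurable (raw)]:
  "f \<in> borel_measurable M \<Longrightarrow> (\<lambda>x. cnj (f x)) \<in> borel_measurable M"
  by (rule measurable_compose[OF _ borel_measurable_continuous_onI]) (auto intro: continuous_intros)

lemma L2_cnj: "f \<in> L2 \<Longrightarrow> (\<lambda>x. cnj (f x)) \<in> L2" and sqn_cnj: "sqn (\<lambda>x. cnj (f x)) = sqn f"
  by (auto simp: L2_def sqn_def)

lemma L2_tendsto_cnj:
  assumes "L2_tendsto F f X"
  shows "L2_tendsto (\<lambda>k x. cnj (F k x)) (\<lambda>x. cnj (f x)) X"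
  using assms unfolding L2_tendsto_sqn
  by (simp add: L2_cnj sqn_cnj complex_cnj_diff[symmetric] del: complex_cnj_diff)

text \<open>Cauchy-Schwarz for nonnegative integrals, applied to the moduli. The pairing carries no
  conjugate because the multiplication formula for the transform is bilinear.\<close>

lemma L2_mult_integrable:
  fixes f g :: "'a::euclidean_space \<Rightarrow> complex"
  assumes "f \<in> L2" "g \<in> L2"
  shows "integrable lebesgue (\<lambda>x. f x * g x)"
    and "cmod (LINT x|lebesgue. f x * g x) \<le> sqrt (sqn f) * sqrt (sqn g)"
proof -
  have m [measurable]: "f \<in> borel_measurable lebesgue" "g \<in> borel_measurable lebesgue"
    using assms L2_measurable by auto
  have i: "integrable lebesgue (\<lambda>x. (norm (f x))\<^sup>2 + (norm (g x))\<^sup>2)"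
    using assms[THEN L2_integrable] by (rule Bochner_Integration.integrable_add)
  have le: "norm (a * b) \<le> (norm a)\<^sup>2 + (norm b)\<^sup>2" for a b :: complex
    using sum_squares_bound[of "norm a" "norm b"] mult_nonneg_nonneg[OF norm_ge_zero norm_ge_zero, of a b]
    unfolding norm_mult by linarith
  show int: "integrable lebesgue (\<lambda>x. f x * g x)"
    by (rule Bochner_Integration.integrable_bound[OF i]) (use le in \<open>auto intro!: AE_I2\<close>)
  have "(ennreal (LINT x|lebesgue. cmod (f x * g x)))\<^sup>2 = (\<integral>\<^sup>+x. ennreal (cmod (f x)) * ennreal (cmod (g x)) \<partial>lebesgue)\<^sup>2"
    using integrable_norm[OF int] by (subst nn_integral_eq_integral[symmetric]) (auto simp: norm_mult ennreal_mult)
  also have "\<dots> \<le> (\<integral>\<^sup>+x. (ennreal (cmod (f x)))\<^sup>2 \<partial>lebesgue) * (\<integral>\<^sup>+x. (ennreal (cmod (g x)))\<^sup>2 \<partial>lebesgue)"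
    by (rule Cauchy_Schwarz_nn_integral) measurable
  also have "\<dots> = ennreal (sqn f) * ennreal (sqn g)"
    unfolding sqn_def using assms[THEN L2_integrable]
    by (subst (1 2) nn_integral_eq_integral[symmetric]) (auto simp: ennreal_power)
  finally have "(LINT x|lebesgue. cmod (f x * g x))\<^sup>2 \<le> sqn f * sqn g"
    by (subst (asm) ennreal_power) (auto simp: ennreal_mult[symmetric] ennreal_le_iff)
  then have "(LINT x|lebesgue. cmod (f x * g x)) \<le> sqrt (sqn f * sqn g)"
    by (rule real_le_rsqrt)
  then show "cmod (LINT x|lebesgue. f x * g x) \<le> sqrt (sqn f) * sqrt (sqn g)"
    using integral_norm_bound[of lebesgue "\<lambda>x. f x * g x"] unfolding real_sqrt_mult by linarith
qed

lemma L2_tendsto_integral_mult: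
  fixes f g :: "'a::euclidean_space \<Rightarrow> complex"
  assumes "L2_tendsto F f X" "L2_tendsto G g X"
  shows "((\<lambda>k. LINT x|lebesgue. F k x * G k x) \<longlongrightarrow> (LINT x|lebesgue. f x * g x)) X"
proof -
  have L [simp]: "\<And>k. F k \<in> L2" "\<And>k. G k \<in> L2" "f \<in> L2" "g \<in> L2"
    using assms by (auto simp: L2_tendsto_def)
  define a where "a k = sqrt (sqn (\<lambda>x. F k x - f x))" for k
  define b where "b k = sqrt (sqn (\<lambda>x. G k x - g x))" for k
  have "(a \<longlongrightarrow> 0) X" "(b \<longlongrightarrow> 0) X"
    using assms by (auto simp: L2_tendsto_def L2_norm_sqn a_def[abs_def] b_def[abs_def])
  then have l: "((\<lambda>k. a k * b k + a k * sqrt (sqn g) + sqrt (sqn f) * b k) \<longlongrightarrow> 0 * 0 + 0 * sqrt (sqn g) + sqrt (sqn f) * 0) X"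
    by (intro tendsto_intros)
  have b: "cmod ((LINT x|lebesgue. F k x * G k x) - (LINT x|lebesgue. f x * g x))
      \<le> a k * b k + a k * sqrt (sqn g) + sqrt (sqn f) * b k" for k
  proof -
    \<comment> \<open>The difference of the products is the product of the errors plus two mixed
      terms, each controlled by Cauchy-Schwarz.\<close>
    let ?A = "\<lambda>x. (F k x - f x) * (G k x - g x)" and ?B = "\<lambda>x. (F k x - f x) * g x"
      and ?C = "\<lambda>x. f x * (G k x - g x)"
    have i: "integrable lebesgue ?A" "integrable lebesgue ?B" "integrable lebesgue ?C"
      by (intro L2_mult_integrable L2_diff L)+
    have n: "cmod (LINT x|lebesgue. ?A x) \<le> a k * b k" "cmod (LINT x|lebesgue. ?B x) \<le> a k * sqrt (sqn g)"
      "cmod (LINT x|lebesgue. ?C x) \<le> sqrt (sqn f) * b k"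
      unfolding a_def b_def by (intro L2_mult_integrable L2_diff L)+
    have "(LINT x|lebesgue. F k x * G k x) - (LINT x|lebesgue. f x * g x) = (LINT x|lebesgue. F k x * G k x - f x * g x)"
      by (subst Bochner_Integration.integral_diff) (auto intro!: L2_mult_integrable)
    also have "\<dots> = (LINT x|lebesgue. ?A x + ?B x + ?C x)"
      by (simp add: algebra_simps)
    also have "\<dots> = (LINT x|lebesgue. ?A x) + (LINT x|lebesgue. ?B x) + (LINT x|lebesgue. ?C x)"
      using i by simp
    finally have eq: "(LINT x|lebesgue. F k x * G k x) - (LINT x|lebesgue. f x * g x) = \<dots>" .
    show ?thesis
      unfolding eq using n norm_triangle_ineq[of "(LINT x|lebesgue. ?A x) + (LINT x|lebesgue. ?B x)" "LINT x|lebesgue. ?C x"]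
        norm_triangle_ineq[of "LINT x|lebesgue. ?A x" "LINT x|lebesgue. ?B x"] by linarith
  qed
  show ?thesis
    by (rule LIM_zero_cancel, rule Lim_null_comparison[OF always_eventually l[simplified]]) (use b in auto)
qed

text \<open>Riesz-Fischer with a rate: \<open>e k\<close> bounds the distance from
  \<open>G k\<close> to every later member, and Fatou's lemma hands the same bound to the
  limit.\<close>

lemma L2_complete:
  assumes L: "\<And>k. G k \<in> L2" and C: "\<And>k l. k \<le> l \<Longrightarrow> sqn (\<lambda>x. G l x - G k x) \<le> e k"
    and e: "e \<longlonglongrightarrow> 0"
  obtains g where "g \<in> L2" "\<And>k. sqn (\<lambda>x. g x - G k x) \<le> e k"
proof -
  have [measurable]: "\<And>k. G k \<in> borel_measurable lebesgue" using L L2_measurable by auto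
  have "\<exists>K. \<forall>k\<ge>K. e k < (1/8)^n" for n :: nat
    using order_tendstoD(2)[OF e, of "(1/8)^n"] by (auto simp: eventually_sequentially)
  then obtain K where K: "\<And>n k. K n \<le> k \<Longrightarrow> e k < (1/8)^n" by metis
  \<comment> \<open>The partial sums of \<open>K\<close> make \<open>r\<close> monotone and at least
    \<open>K\<close>; the summand \<open>n\<close> makes it at least the identity.\<close>
  define r where "r n = n + (\<Sum>i\<le>n. K i)" for n
  have r: "n \<le> r n" "e (r n) < (1/8)^n" "r n \<le> r (Suc n)" for n
    using member_le_sum[of n "{..n}" K] by (auto simp: r_def intro!: K)
  define H where "H n = G (r n)" for n
  have [measurable]: "\<And>k. H k \<in> borel_measurable lebesgue" by (auto simp: H_def)
  have HL: "H n \<in> L2" for n using L by (simp add: H_def)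
  define g where "g x = lim (\<lambda>n. H n x)" for x
  have [measurable]: "g \<in> borel_measurable lebesgue"
    unfolding g_def by (rule borel_measurable_lim_metric) simp
  have sq: "(\<integral>\<^sup>+x. ennreal ((norm (f x))\<^sup>2) \<partial>lebesgue) = ennreal (sqn f)" if "f \<in> L2" for f :: "'a \<Rightarrow> 'b"
    unfolding sqn_def using L2_integrable[OF that] by (rule nn_integral_eq_integral) simp
  \<comment> \<open>The increments have squared norm at most \<open>(1/8)^n\<close>, which leaves
    room for the weight \<open>2^n\<close>. Finiteness of the weighted sum at a point forces the
    increments there to decay geometrically with ratio \<open>sqrt (1/2)\<close>.\<close>
  have "(\<integral>\<^sup>+x. (\<Sum>n. ennreal (2^n * (norm (H (Suc n) x - H n x))\<^sup>2)) \<partial>lebesgue)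
      = (\<Sum>n. \<integral>\<^sup>+x. ennreal (2^n * (norm (H (Suc n) x - H n x))\<^sup>2) \<partial>lebesgue)"
    by (rule nn_integral_suminf) measurable
  also have "\<dots> = (\<Sum>n. ennreal (2^n * sqn (\<lambda>x. H (Suc n) x - H n x)))"
    using sq[OF L2_diff(1)[OF HL HL]] by (simp add: ennreal_mult nn_integral_cmult)
  also have "\<dots> \<le> (\<Sum>n. ennreal ((1/4)^n))"
  proof (intro suminf_le ennreal_leI)
    fix n
    have "sqn (\<lambda>x. H (Suc n) x - H n x) \<le> (1/8)^n"
      using C[OF r(3)[of n]] r(2)[of n] by (simp add: H_def)
    then have "2^n * sqn (\<lambda>x. H (Suc n) x - H n x) \<le> 2^n * (1/8)^n" by simp
    also have "\<dots> = (1/4)^n" by (simp add: power_mult_distrib[symmetric])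
    finally show "2^n * sqn (\<lambda>x. H (Suc n) x - H n x) \<le> (1/4)^n" .
  qed auto
  also have "\<dots> < \<infinity>"
    by (subst suminf_ennreal2) (auto intro: summable_geometric)
  finally have "AE x in lebesgue. (\<Sum>n. ennreal (2^n * (norm (H (Suc n) x - H n x))\<^sup>2)) \<noteq> \<infinity>"
    by (intro nn_integral_PInf_AE) auto
  then have lim: "AE x in lebesgue. (\<lambda>n. H n x) \<longlonglongrightarrow> g x"
  proof eventually_elim
    case (elim x)
    define S where "S = (\<Sum>n. 2^n * (norm (H (Suc n) x - H n x))\<^sup>2)"
    have sm: "summable (\<lambda>n. 2^n * (norm (H (Suc n) x - H n x))\<^sup>2)"
      using elim by (intro summable_suminf_not_top) auto
    have b: "norm (H (Suc n) x - H n x) \<le> sqrt S * (sqrt (1/2))^n" for n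
    proof -
      have "2^n * (norm (H (Suc n) x - H n x))\<^sup>2 \<le> S"
        unfolding S_def using sum_le_suminf[OF sm, of "{n}"] by simp
      then have "(norm (H (Suc n) x - H n x))\<^sup>2 \<le> S * (1/2)^n"
        by (simp add: field_simps power_divide)
      then have "norm (H (Suc n) x - H n x) \<le> sqrt (S * (1/2)^n)"
        by (rule real_le_rsqrt)
      then show ?thesis by (simp add: real_sqrt_mult real_sqrt_power)
    qed
    have "summable (\<lambda>n. sqrt S * (sqrt (1/2))^n)"
      by (intro summable_mult summable_geometric) (simp add: real_sqrt_divide)
    then have "summable (\<lambda>n. H (Suc n) x - H n x)"
      by (rule summable_comparison_test'[where N=0]) (use b in auto)
    then have "convergent (\<lambda>n. (\<Sum>i<n. H (Suc i) x - H i x) + H 0 x)"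
      using summable_iff_convergent convergent_add convergent_const by blast
    then show ?case
      using sum_lessThan_telescope[of "\<lambda>n. H n x"] by (simp add: g_def convergent_LIMSEQ_iff)
  qed
  \<comment> \<open>For fixed \<open>k\<close> and \<open>n \<ge> k\<close> the function
    \<open>H n\<close> is a member of the sequence not before \<open>G k\<close>, hence within
    \<open>e k\<close> of it.\<close>
  have fatou: "(\<integral>\<^sup>+x. ennreal ((norm (g x - G k x))\<^sup>2) \<partial>lebesgue) \<le> ennreal (e k)" for k
  proof -
    have "(\<integral>\<^sup>+x. ennreal ((norm (g x - G k x))\<^sup>2) \<partial>lebesgue)
        = (\<integral>\<^sup>+x. liminf (\<lambda>n. ennreal ((norm (H n x - G k x))\<^sup>2)) \<partial>lebesgue)"
    proof (rule nn_integral_cong_AE, use lim in eventually_elim)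
      case (elim x)
      have "(\<lambda>n. ennreal ((norm (H n x - G k x))\<^sup>2)) \<longlonglongrightarrow> ennreal ((norm (g x - G k x))\<^sup>2)"
        by (intro tendsto_intros elim)
      then show ?case by (intro lim_imp_Liminf[symmetric]) auto
    qed
    also have "\<dots> \<le> liminf (\<lambda>n. \<integral>\<^sup>+x. ennreal ((norm (H n x - G k x))\<^sup>2) \<partial>lebesgue)"
      by (rule nn_integral_liminf) measurable
    also have "\<dots> = liminf (\<lambda>n. ennreal (sqn (\<lambda>x. H n x - G k x)))"
      by (simp add: sq[OF L2_diff(1)[OF HL L]])
    also have "\<dots> \<le> liminf (\<lambda>n. ennreal (e k))"
    proof (rule Liminf_mono, rule eventually_sequentiallyI[of k], rule ennreal_leI)
      fix n assume "k \<le> n"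
      then show "sqn (\<lambda>x. H n x - G k x) \<le> e k"
        unfolding H_def using r(1)[of n] by (intro C) simp
    qed
    also have "\<dots> = ennreal (e k)" by (simp add: Liminf_const)
    finally show ?thesis .
  qed
  have e0: "0 \<le> e k" for k using order_trans[OF sqn_nonneg C[of k k]] by simp
  have d: "(\<lambda>x. g x - G k x) \<in> L2" for k
    unfolding L2_def using fatou[of k] by (auto intro!: integrableI_bounded simp: le_less_trans)
  show thesis
  proof
    show "g \<in> L2" using L2_add(1)[OF d[of 0] L[of 0]] by simp
    show "sqn (\<lambda>x. g x - G k x) \<le> e k" for k
      using fatou[of k] by (simp add: sq[OF d] e0)
  qed
qed

section \<open>Functions determined by their integrals over boxes\<close>

lemma symmetric_boxes_exhaust:
  fixes x :: "'a::euclidean_space"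
  obtains k0 where "\<And>k. k0 \<le> k \<Longrightarrow> x \<in> box (- (real k *\<^sub>R One)) (real k *\<^sub>R One)"
proof -
  obtain k0 :: nat where k0: "norm x < k0" using reals_Archimedean2 by blast
  have "x \<in> box (- (real k *\<^sub>R One)) (real k *\<^sub>R One)" if "k0 \<le> k" for k
  proof -
    have "\<bar>x \<bullet> i\<bar> < k" if "i \<in> Basis" for i
      using Basis_le_norm[OF that, of x] k0 \<open>k0 \<le> k\<close> by linarith
    then show ?thesis by (auto simp: mem_box abs_less_iff) (metis minus_less_iff)
  qed
  then show thesis by (rule that)
qed

text \<open>Open boxes are stable under intersection and generate the Borel sets, so a pi-lambda
  argument carries the vanishing from boxes to Borel sets; a Lebesgue set differs from a Borel set
  by a null set.\<close>

lemma AE_eq_0_if_box_integrals_0: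
  fixes f :: "'a::euclidean_space \<Rightarrow> complex"
  assumes f: "integrable lebesgue f" and 0: "\<And>a b. (LINT x|lebesgue. indicator (box a b) x * f x) = 0"
  shows "AE x in lebesgue. f x = 0"
proof (rule lebesgue.density_zero[OF f])
  have [measurable]: "f \<in> borel_measurable lebesgue" using f by simp
  have int: "integrable lebesgue (\<lambda>x. indicator A x * f x)" if [measurable]: "A \<in> sets lebesgue" for A
    by (rule Bochner_Integration.integrable_bound[OF f]) (auto split: split_indicator)
  \<comment> \<open>Closure under complements needs the integral over the whole space, which is a
    limit over growing boxes.\<close>
  have I: "(LINT x|lebesgue. f x) = 0"
  proof -
    define B where "B k = box (- (real k *\<^sub>R One)) (real k *\<^sub>R One :: 'a)" for k :: nat
    have [measurable]: "B k \<in> sets lebesgue" for k by (simp add: B_def)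
    have "(\<lambda>k. LINT x|lebesgue. indicator (B k) x * f x) \<longlonglongrightarrow> (LINT x|lebesgue. f x)"
    proof (rule integral_dominated_convergence[where w="\<lambda>x. norm (f x)"])
      have "(\<lambda>k. indicator (B k) x * f x) \<longlonglongrightarrow> f x" for x
      proof (rule tendsto_eventually)
        obtain k0 where k0: "\<And>k. k0 \<le> k \<Longrightarrow> x \<in> B k"
          unfolding B_def using symmetric_boxes_exhaust[of x] by blast
        show "\<forall>\<^sub>F k in sequentially. indicator (B k) x * f x = f x"
          by (rule eventually_sequentiallyI[of k0]) (simp add: k0)
      qed
      then show "AE x in lebesgue. (\<lambda>k. indicator (B k) x * f x) \<longlonglongrightarrow> f x" by simp
      show "AE x in lebesgue. norm (indicator (B k) x * f x) \<le> norm (f x)" for k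
        by (auto split: split_indicator)
    qed (use f in auto)
    then show ?thesis using LIMSEQ_unique[OF _ tendsto_const] by (fastforce simp: B_def 0)
  qed
  have borel: "(LINT x|lebesgue. indicator A x * f x) = 0" if "A \<in> sets borel" for A :: "'a set"
  proof (rule sigma_sets_induct_disjoint[where G="range (\<lambda>(a, b). box a b)" and \<Omega>=UNIV])
    have "sets (borel :: 'a measure) = sigma_sets UNIV (range (\<lambda>(a, b). box a b))"
      by (subst borel_eq_box) (auto intro!: sets_measure_of)
    then show "A \<in> sigma_sets UNIV (range (\<lambda>(a, b). box a b))" using that by simp
    have S: "B \<in> sets borel" if "B \<in> sigma_sets UNIV (range (\<lambda>(a, b). box a b))" for B :: "'a set"
      using that \<open>sets borel = _\<close> by simp
    have S': "B \<in> sets lebesgue" if "B \<in> sigma_sets UNIV (range (\<lambda>(a, b). box a b))" for B :: "'a set"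
      using S[OF that] by auto
    show "Int_stable (range (\<lambda>(a, b). box a b :: 'a set))"
      unfolding Int_stable_def
    proof safe
      fix a b c d :: 'a
      show "box a b \<inter> box c d \<in> range (\<lambda>(a, b). box a b)"
        by (subst box_Int_box, rule image_eqI[OF _ UNIV_I, where x="(_, _)"]) simp
    qed
    show "(LINT x|lebesgue. indicator A x * f x) = 0" if "A \<in> range (\<lambda>(a, b). box a b)" for A
      using that 0 by auto
    show "(LINT x|lebesgue. indicator (UNIV - A) x * f x) = 0"
      if A: "A \<in> sigma_sets UNIV (range (\<lambda>(a, b). box a b))" "(LINT x|lebesgue. indicator A x * f x) = 0" for A
    proof -
      have "(LINT x|lebesgue. indicator (UNIV - A) x * f x) = (LINT x|lebesgue. f x - indicator A x * f x)"
        by (intro Bochner_Integration.integral_cong) (auto split: split_indicator)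
      also have "\<dots> = 0" using A I int[OF S'[OF A(1)]] f by simp
      finally show ?thesis .
    qed
    show "(LINT x|lebesgue. indicator (\<Union>(range A)) x * f x) = 0"
      if A: "disjoint_family A" "range A \<subseteq> sigma_sets UNIV (range (\<lambda>(a, b). box a b))"
        "\<And>i. (LINT x|lebesgue. indicator (A i) x * f x) = 0" for A :: "nat \<Rightarrow> 'a set"
    proof -
      have m: "A i \<in> sets lebesgue" for i using A(2) S' by auto
      have "(LINT x:(\<Union>i. A i)|lebesgue. f x) = (\<Sum>i. LINT x:A i|lebesgue. f x)"
      proof (rule lebesgue_integral_countable_add)
        show "A i \<inter> A j = {}" if "i \<noteq> j" for i j
          using A(1) that by (auto simp: disjoint_family_on_def)
        have "indicat_real (\<Union>(range A)) x *\<^sub>R f x = indicator (\<Union>(range A)) x * f x" for x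
          by (auto split: split_indicator)
        then show "set_integrable lebesgue (\<Union>(range A)) f"
          unfolding set_integrable_def using int m by (simp add: sets.countable_UN)
      qed (use m in auto)
      then show ?thesis
        using A(3) by (simp add: set_lebesgue_integral_def scaleR_conv_of_real of_real_indicator)
    qed
  qed auto
  show "set_lebesgue_integral lebesgue A f = 0" if A: "A \<in> sets lebesgue" for A
  proof -
    obtain B N N' where B: "N \<subseteq> N'" "N' \<in> null_sets lborel" "B \<in> sets lborel" "A = B \<union> N"
      using A by (rule sets_completionE)
    then have BN: "A = B \<union> N" "B \<in> sets borel" "N \<in> null_sets lebesgue"
      using null_sets_completion_subset[OF B(1) null_sets_completionI[OF B(2)]] by auto
    have "AE x in lebesgue. x \<notin> N" using BN(3) by (rule AE_not_in)
    then have eq: "AE x in lebesgue. indicator A x *\<^sub>R f x = indicator B x * f x"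
      by eventually_elim (auto simp: BN(1) split: split_indicator)
    have "set_lebesgue_integral lebesgue A f = (LINT x|lebesgue. indicator B x * f x)"
      unfolding set_lebesgue_integral_def
    proof (rule integral_cong_AE)
      have [measurable]: "B \<in> sets lebesgue" using BN(2) by auto
      note A [measurable]
      show "(\<lambda>x. indicator A x *\<^sub>R f x) \<in> borel_measurable lebesgue"
        "(\<lambda>x. indicator B x * f x) \<in> borel_measurable lebesgue"
        by measurable
    qed (rule eq)
    then show ?thesis using borel[OF BN(2)] by simp
  qed
qed

section \<open>The Fourier transform of a Gaussian\<close>

lemma borel_measurable_cis [measurable (raw)]:
  "f \<in> borel_measurable M \<Longrightarrow> (\<lambda>x. cis (f x)) \<in> borel_measurable M"
  by (rule measurable_compose[OF _ borel_measurable_continuous_onI]) (auto intro!: continuous_intros simp: cis_conv_exp)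

text \<open>The characteristic function of the standard normal law is the case \<open>a = 1\<close>;
  the rest is the substitution of \<open>a * x\<close>.\<close>

lemma integral_gaussian_cis_real:
  fixes a t :: real
  assumes a: "0 < a"
  shows "integrable lborel (\<lambda>x. complex_of_real (exp (- (a * x)\<^sup>2 / 2)) * cis (x * t))"
    and "(LINT x|lborel. complex_of_real (exp (- (a * x)\<^sup>2 / 2)) * cis (x * t)) = complex_of_real (sqrt (2 * pi) / a * exp (- (t / a)\<^sup>2 / 2))"
proof -
  have i: "integrable lborel std_normal_density" by (rule integrable_normal_density) simp
  have i1: "integrable lborel (\<lambda>x. complex_of_real (exp (- x\<^sup>2 / 2)) * cis (x * s))" for s
  proof (rule Bochner_Integration.integrable_bound)
    show "integrable lborel (\<lambda>x. sqrt (2 * pi) * std_normal_density x)" using i by simp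
  qed (auto simp: std_normal_density_def norm_mult)
  have e1: "(LINT x|lborel. complex_of_real (exp (- x\<^sup>2 / 2)) * cis (x * s)) = complex_of_real (sqrt (2 * pi) * exp (- s\<^sup>2 / 2))" for s
  proof -
    have "complex_of_real (exp (- s\<^sup>2 / 2)) = (LINT x|std_normal_distribution. iexp (s * x))"
      using fun_cong[OF char_std_normal_distribution, of s] by (simp add: char_def)
    also have "\<dots> = (LINT x|lborel. std_normal_density x *\<^sub>R iexp (s * x))"
      by (subst integral_density) auto
    also have "\<dots> = (LINT x|lborel. complex_of_real (1 / sqrt (2 * pi)) * (complex_of_real (exp (- x\<^sup>2 / 2)) * cis (x * s)))"
      by (intro Bochner_Integration.integral_cong)
        (simp_all add: std_normal_density_def scaleR_conv_of_real cis_conv_exp mult_ac)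
    also have "\<dots> = complex_of_real (1 / sqrt (2 * pi)) * (LINT x|lborel. complex_of_real (exp (- x\<^sup>2 / 2)) * cis (x * s))"
      by (rule integral_mult_right_zero)
    finally show ?thesis by (simp add: field_simps)
  qed
  \<comment> \<open>The summand \<open>0\<close> reproduces the pattern \<open>t + c * x\<close> of
    the affine substitution rules.\<close>
  have eq: "complex_of_real (exp (- (0 + a * x)\<^sup>2 / 2)) * cis ((0 + a * x) * (t / a))
      = complex_of_real (exp (- (a * x)\<^sup>2 / 2)) * cis (x * t)" for x
    using a by simp
  show "integrable lborel (\<lambda>x. complex_of_real (exp (- (a * x)\<^sup>2 / 2)) * cis (x * t))"
    using lborel_integrable_real_affine[OF i1[of "t / a"], of a 0] a unfolding eq by simp
  show "(LINT x|lborel. complex_of_real (exp (- (a * x)\<^sup>2 / 2)) * cis (x * t)) = complex_of_real (sqrt (2 * pi) / a * exp (- (t / a)\<^sup>2 / 2))"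
    using lborel_integral_real_affine[of a "\<lambda>x. complex_of_real (exp (- x\<^sup>2 / 2)) * cis (x * (t / a))" 0] a
    unfolding eq e1 by (simp add: scaleR_conv_of_real field_simps)
qed

text \<open>\<open>lborel\<close> is the image of a product of one-dimensional measures under the
  coordinate map. The factor may vary with \<open>b\<close>, as it does when a character is split
  into coordinates.\<close>

lemma integral_lborel_prod:
  fixes f :: "'a::euclidean_space \<Rightarrow> real \<Rightarrow> complex"
  assumes f: "\<And>b. b \<in> Basis \<Longrightarrow> integrable lborel (f b)"
  shows "integrable (lborel :: 'a measure) (\<lambda>x. \<Prod>b\<in>Basis. f b (x \<bullet> b))"
    and "(LINT x|(lborel :: 'a measure). (\<Prod>b\<in>Basis. f b (x \<bullet> b))) = (\<Prod>b\<in>Basis. LINT t|lborel. f b t)"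
proof -
  interpret P: product_sigma_finite "\<lambda>_::'a. lborel :: real measure" by standard
  have [measurable]: "\<And>b. b \<in> Basis \<Longrightarrow> f b \<in> borel_measurable borel"
    using f by (simp add: borel_measurable_integrable)
  have m: "(\<lambda>x. \<Prod>b\<in>Basis. f b (x \<bullet> b)) \<in> borel_measurable (borel :: 'a measure)"
    by measurable
  have m2: "(\<lambda>f. \<Sum>b\<in>Basis. f b *\<^sub>R b) \<in> (\<Pi>\<^sub>M b\<in>(Basis::'a set). lborel) \<rightarrow>\<^sub>M borel"
    by measurable
  have eq: "(\<Prod>b\<in>Basis. f b ((\<Sum>b\<in>Basis. x b *\<^sub>R b) \<bullet> b)) = (\<Prod>b\<in>Basis. f b (x b))" for x :: "'a \<Rightarrow> real"
    by (intro prod.cong) (auto simp: inner_sum_left inner_Basis if_distrib if_distribR cong: if_cong)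
  show "integrable (lborel :: 'a measure) (\<lambda>x. \<Prod>b\<in>Basis. f b (x \<bullet> b))"
    by (subst lborel_eq) (simp add: integrable_distr_eq[OF m2 m] eq P.product_integrable_prod f)
  show "(LINT x|(lborel :: 'a measure). (\<Prod>b\<in>Basis. f b (x \<bullet> b))) = (\<Prod>b\<in>Basis. LINT t|lborel. f b t)"
    by (subst lborel_eq) (simp add: integral_distr[OF m2 m] eq P.product_integral_prod f)
qed

text \<open>The parameter is an inverse width: as \<epsilon> tends to 0 the function rises to the
  constant 1, which makes it a convergence factor.\<close>

definition gauss :: "real \<Rightarrow> 'a::euclidean_space \<Rightarrow> real" where
  "gauss \<epsilon> x = exp (- (\<epsilon> * norm x)\<^sup>2 / 2)"

text \<open>The Fourier transform of \<open>gauss \<epsilon>\<close>: a peak of width \<epsilon> and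
  total mass \<open>(2 * pi) ^ DIM('a)\<close>.\<close>

definition gauss_kernel :: "real \<Rightarrow> 'a::euclidean_space \<Rightarrow> real" where
  "gauss_kernel \<epsilon> x = (sqrt (2 * pi) / \<epsilon>) ^ DIM('a) * gauss (1 / \<epsilon>) x"

lemma gauss_measurable [measurable]: "gauss \<epsilon> \<in> borel_measurable borel"
  and gauss_kernel_measurable [measurable]: "gauss_kernel \<epsilon> \<in> borel_measurable borel"
  unfolding gauss_def[abs_def] gauss_kernel_def[abs_def] by measurable

lemma gauss_pos: "0 < gauss \<epsilon> x" and gauss_le_1: "gauss \<epsilon> x \<le> 1"
  and gauss_kernel_nonneg: "0 \<le> \<epsilon> \<Longrightarrow> 0 \<le> gauss_kernel \<epsilon> x"
  and gauss_kernel_minus: "gauss_kernel \<epsilon> (- x) = gauss_kernel \<epsilon> x"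
  by (auto simp: gauss_def gauss_kernel_def)

lemma gauss_fourier:
  fixes y :: "'a::euclidean_space"
  assumes "0 < \<epsilon>"
  shows "integrable lebesgue (\<lambda>x. gauss \<epsilon> x * cis (x \<bullet> y))"
    and "(LINT x|lebesgue. gauss \<epsilon> x * cis (x \<bullet> y)) = complex_of_real (gauss_kernel \<epsilon> y)"
proof -
  let ?f = "\<lambda>b t. complex_of_real (exp (- (\<epsilon> * t)\<^sup>2 / 2)) * cis (t * (y \<bullet> b))"
  have n: "(norm x)\<^sup>2 = (\<Sum>b\<in>Basis. (x \<bullet> b)\<^sup>2)" for x :: 'a
    unfolding power2_norm_eq_inner by (subst euclidean_inner) (simp add: power2_eq_square)
  have g: "gauss c x = (\<Prod>b\<in>Basis. exp (- (c * (x \<bullet> b))\<^sup>2 / 2))" for c and x :: 'a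
    by (simp add: gauss_def power_mult_distrib n sum_distrib_left sum_negf sum_divide_distrib exp_sum[symmetric])
  have c: "cis (x \<bullet> y) = (\<Prod>b\<in>Basis. cis ((x \<bullet> b) * (y \<bullet> b)))" for x
    by (subst euclidean_inner) (simp add: cis_conv_exp exp_sum[symmetric] sum_distrib_left)
  have eq: "gauss \<epsilon> x * cis (x \<bullet> y) = (\<Prod>b\<in>Basis. ?f b (x \<bullet> b))" for x
    by (simp add: g c prod.distrib)
  note i = integral_gaussian_cis_real[OF assms]
  have m: "(\<lambda>x. gauss \<epsilon> x * cis (x \<bullet> y)) \<in> borel_measurable lborel"
    by (simp add: cis_conv_exp)
  show "integrable lebesgue (\<lambda>x. gauss \<epsilon> x * cis (x \<bullet> y))"
    unfolding integrable_completion[OF m] unfolding eq by (rule integral_lborel_prod) (rule i)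
  show "(LINT x|lebesgue. gauss \<epsilon> x * cis (x \<bullet> y)) = complex_of_real (gauss_kernel \<epsilon> y)"
    unfolding integral_completion[OF m] unfolding eq integral_lborel_prod(2)[OF i(1)] i(2)
    by (simp add: gauss_kernel_def g prod.distrib prod_dividef power_divide field_simps)
qed

lemma gauss_integral:
  assumes "0 < \<epsilon>"
  shows "integrable lebesgue (gauss \<epsilon> :: 'a::euclidean_space \<Rightarrow> real)"
    and "(LINT x|lebesgue. gauss \<epsilon> (x::'a)) = (sqrt (2 * pi) / \<epsilon>) ^ DIM('a)"
proof -
  have "integrable lebesgue (\<lambda>x::'a. complex_of_real (gauss \<epsilon> x))"
    using gauss_fourier(1)[OF assms, of 0] by simp
  then show "integrable lebesgue (gauss \<epsilon> :: 'a \<Rightarrow> real)" by (simp add: complex_of_real_integrable_eq)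
  have "complex_of_real (LINT x|lebesgue. gauss \<epsilon> (x::'a)) = complex_of_real (gauss_kernel \<epsilon> (0::'a))"
    using gauss_fourier(2)[OF assms, of 0] by simp
  then show "(LINT x|lebesgue. gauss \<epsilon> (x::'a)) = (sqrt (2 * pi) / \<epsilon>) ^ DIM('a)"
    by (simp only: of_real_eq_iff) (simp add: gauss_kernel_def gauss_def)
qed

section \<open>The Gaussian kernel as an approximate identity\<close>

lemma lborel_integral_affine:
  fixes f :: "'a::euclidean_space \<Rightarrow> 'b::{banach,second_countable_topology}"
  assumes f[measurable]: "f \<in> borel_measurable borel" and c: "0 < c"
  shows "integrable lborel (\<lambda>x. f (t + c *\<^sub>R x)) \<Longrightarrow> integrable lborel f"
    and "(LINT x|lborel. f x) = c ^ DIM('a) *\<^sub>R (LINT x|lborel. f (t + c *\<^sub>R x))"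
proof -
  have a: "lborel = density (distr lborel borel (\<lambda>x::'a. t + c *\<^sub>R x)) (\<lambda>x. ennreal (c ^ DIM('a)))"
    using lborel_affine[of c t] c by simp
  show "integrable lborel f" if "integrable lborel (\<lambda>x. f (t + c *\<^sub>R x))"
    using c that by (subst a) (simp add: integrable_density integrable_distr_eq)
  show "(LINT x|lborel. f x) = c ^ DIM('a) *\<^sub>R (LINT x|lborel. f (t + c *\<^sub>R x))"
    using c by (subst a) (simp add: integral_density integral_distr)
qed

lemma gauss_kernel_scale:
  assumes "0 < \<epsilon>"
  shows "\<epsilon> ^ DIM('a) * gauss_kernel \<epsilon> (- (\<epsilon> *\<^sub>R z) :: 'a::euclidean_space) = gauss_kernel 1 z"
  using assms by (simp add: gauss_kernel_def gauss_def power_divide)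

text \<open>Rescaling reduces the mass to \<epsilon> = 1, where the prefactor and the Gaussian
  integral each contribute \<open>sqrt (2 * pi)\<close> per dimension.\<close>

lemma gauss_kernel_integral:
  assumes e: "0 < \<epsilon>"
  shows "integrable lebesgue (\<lambda>x. gauss_kernel \<epsilon> (y - x :: 'a::euclidean_space))"
    and "(LINT x|lebesgue. gauss_kernel \<epsilon> (y - x :: 'a)) = (2 * pi) ^ DIM('a)"
proof -
  have m: "(\<lambda>x. gauss_kernel \<epsilon> (y - x :: 'a)) \<in> borel_measurable lborel" by simp
  have k1: "gauss_kernel 1 z = sqrt (2 * pi) ^ DIM('a) * gauss 1 z" for z :: 'a
    by (simp add: gauss_kernel_def)
  have m1: "gauss 1 \<in> borel_measurable (lborel :: 'a measure)" by simp
  have g1: "integrable lborel (gauss 1 :: 'a \<Rightarrow> real)"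
      "(LINT x|lborel. gauss 1 (x::'a)) = sqrt (2 * pi) ^ DIM('a)"
    using gauss_integral[of 1, where 'a='a] by (simp_all add: integrable_completion[OF m1] integral_completion[OF m1])
  have i: "integrable lborel (\<lambda>z. gauss_kernel \<epsilon> (- (\<epsilon> *\<^sub>R z) :: 'a))"
  proof -
    have "gauss_kernel \<epsilon> (- (\<epsilon> *\<^sub>R z) :: 'a) = gauss_kernel 1 z / \<epsilon> ^ DIM('a)" for z
      using gauss_kernel_scale[OF e, of z] e by (simp add: field_simps)
    then show ?thesis using g1 by (simp add: k1)
  qed
  show "integrable lebesgue (\<lambda>x. gauss_kernel \<epsilon> (y - x :: 'a))"
    unfolding integrable_completion[OF m] using e i
    by (subst lborel_integral_affine(1)[where t=y and c=\<epsilon>]) auto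
  have "(LINT x|lborel. gauss_kernel \<epsilon> (y - x :: 'a)) = \<epsilon> ^ DIM('a) * (LINT z|lborel. gauss_kernel \<epsilon> (- (\<epsilon> *\<^sub>R z) :: 'a))"
    using e by (subst lborel_integral_affine(2)[where t=y and c=\<epsilon>]) auto
  also have "\<dots> = (LINT z|lborel. gauss_kernel 1 (z::'a))"
    by (subst integral_mult_right_zero[symmetric]) (simp only: gauss_kernel_scale[OF e])
  also have "\<dots> = sqrt (2 * pi) ^ DIM('a) * sqrt (2 * pi) ^ DIM('a)"
    unfolding k1 integral_mult_right_zero g1 ..
  also have "\<dots> = (2 * pi) ^ DIM('a)"
    unfolding power_mult_distrib[symmetric] by simp
  finally show "(LINT x|lebesgue. gauss_kernel \<epsilon> (y - x :: 'a)) = (2 * pi) ^ DIM('a)"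
    by (simp add: integral_completion[OF m])
qed

text \<open>A convolution with the kernel that is not divided by the mass, so that inside
  \<open>B\<close> its limit is \<open>(2 * pi) ^ DIM('a)\<close> rather than 1.\<close>

definition gauss_average :: "real \<Rightarrow> 'a::euclidean_space set \<Rightarrow> 'a \<Rightarrow> real" where
  "gauss_average \<epsilon> B y = (LINT x|lebesgue. indicator B x * gauss_kernel \<epsilon> (y - x))"

lemma gauss_average_bound:
  assumes e: "0 < \<epsilon>" and [measurable]: "B \<in> sets lebesgue"
  shows "integrable lebesgue (\<lambda>x. indicator B x * gauss_kernel \<epsilon> (y - x :: 'a::euclidean_space))"
    and "\<bar>gauss_average \<epsilon> B y\<bar> \<le> (2 * pi) ^ DIM('a)"
proof -
  have [measurable]: "(\<lambda>x. gauss_kernel \<epsilon> (y - x)) \<in> borel_measurable lebesgue"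
    by (rule measurable_completion) simp
  show i: "integrable lebesgue (\<lambda>x. indicator B x * gauss_kernel \<epsilon> (y - x))"
    by (rule Bochner_Integration.integrable_bound[OF gauss_kernel_integral(1)[OF e, of y]])
      (use e in \<open>auto simp: gauss_kernel_nonneg split: split_indicator\<close>)
  have "0 \<le> gauss_average \<epsilon> B y"
    unfolding gauss_average_def using e by (intro integral_nonneg_AE) (auto simp: gauss_kernel_nonneg)
  moreover have "gauss_average \<epsilon> B y \<le> (2 * pi) ^ DIM('a)"
    unfolding gauss_average_def gauss_kernel_integral(2)[OF e, of y, symmetric]
    using e by (intro integral_mono[OF i gauss_kernel_integral(1)[OF e]])
      (auto simp: gauss_kernel_nonneg split: split_indicator)
  ultimately show "\<bar>gauss_average \<epsilon> B y\<bar> \<le> (2 * pi) ^ DIM('a)" by simp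
qed

text \<open>Away from the frontier the indicator is constant near \<open>y\<close>. The width runs
  through \<open>1 / Suc k\<close> because dominated convergence is applied to sequences.\<close>

lemma gauss_average_tendsto:
  fixes B :: "'a::euclidean_space set"
  assumes B[measurable]: "B \<in> sets borel" and y: "y \<notin> frontier B"
  shows "(\<lambda>k. gauss_average (1 / Suc k) B y) \<longlonglongrightarrow> (2 * pi) ^ DIM('a) * indicator B y"
proof -
  let ?g = "\<lambda>k z. indicator B (y + (1 / Suc k) *\<^sub>R z) * gauss_kernel 1 (z::'a)"
  \<comment> \<open>The substitution moves \<epsilon> from the kernel into the argument of the
    indicator, so that \<open>gauss_kernel 1\<close> dominates for every \<epsilon>.\<close>
  have eq: "gauss_average \<epsilon> B y = (LINT z|lborel. indicator B (y + \<epsilon> *\<^sub>R z) * gauss_kernel 1 z)" if "0 < \<epsilon>" for \<epsilon>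
  proof -
    have "gauss_average \<epsilon> B y = (LINT x|lborel. indicator B x * gauss_kernel \<epsilon> (y - x))"
      unfolding gauss_average_def by (rule integral_completion) simp
    also have "\<dots> = \<epsilon> ^ DIM('a) * (LINT z|lborel. indicator B (y + \<epsilon> *\<^sub>R z) * gauss_kernel \<epsilon> (- (\<epsilon> *\<^sub>R z)))"
      using that by (subst lborel_integral_affine(2)[where t=y and c=\<epsilon>]) auto
    also have "\<dots> = (LINT z|lborel. indicator B (y + \<epsilon> *\<^sub>R z) * (\<epsilon> ^ DIM('a) * gauss_kernel \<epsilon> (- (\<epsilon> *\<^sub>R z))))"
      by (subst integral_mult_right_zero[symmetric]) (simp add: mult_ac)
    finally show ?thesis by (simp only: gauss_kernel_scale[OF that])
  qed
  have m1: "(\<lambda>x. gauss_kernel 1 (x::'a)) \<in> borel_measurable lborel" by simp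
  have K: "integrable lborel (\<lambda>x. gauss_kernel 1 (x::'a))" "(LINT x|lborel. gauss_kernel 1 (x::'a)) = (2 * pi) ^ DIM('a)"
    using gauss_kernel_integral[of 1 "0::'a"]
    by (simp_all add: gauss_kernel_minus integrable_completion[OF m1] integral_completion[OF m1])
  have "(\<lambda>k. LINT z|lborel. ?g k z) \<longlonglongrightarrow> (LINT z|lborel. indicator B y * gauss_kernel 1 (z::'a))"
  proof (rule integral_dominated_convergence[where w="gauss_kernel 1"])
    have lim: "(\<lambda>k. y + (1 / Suc k) *\<^sub>R z) \<longlonglongrightarrow> y" for z
    proof -
      have "(\<lambda>k. y + (1 / Suc k) *\<^sub>R z) \<longlonglongrightarrow> y + 0 *\<^sub>R z"
        by (intro tendsto_intros) (use LIMSEQ_inverse_real_of_nat in \<open>simp add: inverse_eq_divide\<close>)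
      then show ?thesis by simp
    qed
    have ev: "\<forall>\<^sub>F k in sequentially. indicator B (y + (1 / Suc k) *\<^sub>R z) = (indicator B y :: real)" for z
    proof (cases "y \<in> B")
      case True
      then have "y \<in> interior B" using y by (auto simp: frontier_def closure_def)
      then have "\<forall>\<^sub>F k in sequentially. y + (1 / Suc k) *\<^sub>R z \<in> interior B"
        using lim by (intro topological_tendstoD) auto
      then show ?thesis
      proof eventually_elim
        case (elim k)
        then have "y + (1 / Suc k) *\<^sub>R z \<in> B" using interior_subset[of B] by blast
        then show ?case using True by simp
      qed
    next
      case False
      then have "y \<in> - closure B" using y interior_subset by (auto simp: frontier_def)
      then have "\<forall>\<^sub>F k in sequentially. y + (1 / Suc k) *\<^sub>R z \<in> - closure B"
        using lim by (intro topological_tendstoD) auto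
      then show ?thesis
      proof eventually_elim
        case (elim k)
        then have "y + (1 / Suc k) *\<^sub>R z \<notin> B" using closure_subset[of B] by blast
        then show ?case using False by simp
      qed
    qed
    show "AE z in lborel. (\<lambda>k. ?g k z) \<longlonglongrightarrow> indicator B y * gauss_kernel 1 z"
      using ev by (intro AE_I2 tendsto_intros tendsto_eventually) simp
  qed (use K in \<open>auto simp: gauss_kernel_nonneg split: split_indicator\<close>)
  then show ?thesis by (simp add: eq K mult.commute)
qed

section \<open>The Fourier integral\<close>

lemma ident_borel_measurable_lebesgue [measurable]: "(\<lambda>x::'a::euclidean_space. x) \<in> borel_measurable lebesgue"
  by (rule measurable_completion) simp

lemma lebesgue_pair_projections_borel [measurable]:
  "fst \<in> borel_measurable (lebesgue \<Otimes>\<^sub>M (lebesgue :: 'b::euclidean_space measure))"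
  "snd \<in> borel_measurable ((lebesgue :: 'a::euclidean_space measure) \<Otimes>\<^sub>M lebesgue)"
  using measurable_compose[OF measurable_fst ident_borel_measurable_lebesgue]
    measurable_compose[OF measurable_snd ident_borel_measurable_lebesgue] by blast+

text \<open>The sign \<open>s\<close> treats the transform and its inverse together;
  \<open>s\<^sup>2 = 1\<close> will restrict it to 1 and -1, and \<open>s = - 1\<close> is the sign
  of \<open>fourier\<close>.\<close>

definition fint :: "real \<Rightarrow> ('a::euclidean_space \<Rightarrow> complex) \<Rightarrow> 'a \<Rightarrow> complex" where
  "fint s f \<xi> = (LINT x|lebesgue. f x * cis (s * (x \<bullet> \<xi>)))"

lemma integrable_mult_bounded:
  fixes f g :: "'a \<Rightarrow> complex"
  assumes f: "integrable M f" and g[measurable]: "g \<in> borel_measurable M" and b: "\<And>x. cmod (g x) \<le> C"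
  shows "integrable M (\<lambda>x. f x * g x)"
proof (rule Bochner_Integration.integrable_bound)
  show "integrable M (\<lambda>x. C * norm (f x))" using f by simp
  have [measurable]: "f \<in> borel_measurable M" using f by simp
  show "(\<lambda>x. f x * g x) \<in> borel_measurable M" by measurable
  have "cmod (g x) * cmod (f x) \<le> \<bar>C\<bar> * cmod (f x)" for x
    using b[of x] by (intro mult_right_mono) auto
  then show "AE x in M. norm (f x * g x) \<le> norm (C * norm (f x))"
    by (auto simp: norm_mult abs_mult mult.commute)
qed

lemma fint_integrand: "integrable lebesgue f \<Longrightarrow> integrable lebesgue (\<lambda>x. f x * cis (s * (x \<bullet> \<xi>)))"
  by (rule integrable_mult_bounded[where C=1]) auto

lemma fint_bound: "integrable lebesgue f \<Longrightarrow> cmod (fint s f \<xi>) \<le> (LINT x|lebesgue. cmod (f x))"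
  unfolding fint_def using integral_norm_bound[of lebesgue "\<lambda>x. f x * cis (s * (x \<bullet> \<xi>))"]
  by (simp add: norm_mult)

lemma fint_measurable [measurable]:
  assumes [measurable]: "f \<in> borel_measurable lebesgue"
  shows "fint s f \<in> borel_measurable lebesgue"
  unfolding fint_def[abs_def]
proof (rule lebesgue.borel_measurable_lebesgue_integral)
  show "(\<lambda>(\<xi>, x). f x * cis (s * (x \<bullet> \<xi>))) \<in> borel_measurable (lebesgue \<Otimes>\<^sub>M lebesgue)"
    unfolding split_beta by measurable
qed

lemma fint_add: "integrable lebesgue f \<Longrightarrow> integrable lebesgue g \<Longrightarrow>
    fint s (\<lambda>x. f x + g x) \<xi> = fint s f \<xi> + fint s g \<xi>"
  by (simp add: fint_def distrib_right fint_integrand)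

lemma fint_diff: "integrable lebesgue f \<Longrightarrow> integrable lebesgue g \<Longrightarrow>
    fint s (\<lambda>x. f x - g x) \<xi> = fint s f \<xi> - fint s g \<xi>"
  by (simp add: fint_def left_diff_distrib fint_integrand)

lemma fint_cmult: "fint s (\<lambda>x. c * f x) \<xi> = c * fint s f \<xi>"
  by (simp add: fint_def mult.assoc)

lemma cnj_fint: "cnj (fint s f \<xi>) = fint (- s) (\<lambda>x. cnj (f x)) \<xi>"
  unfolding fint_def Bochner_Integration.integral_cnj[symmetric] by (simp add: cis_cnj)

text \<open>Fubini for an integrand whose modulus is the product of the moduli of two integrable
  functions. It lets the transform change sides in a pairing.\<close>

lemma fint_mult_formula:
  assumes f: "integrable lebesgue f" and g: "integrable lebesgue g"
  shows "(LINT \<xi>|lebesgue. fint s f \<xi> * g \<xi>) = (LINT x|lebesgue. f x * fint s g x)"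
proof -
  have [measurable]: "f \<in> borel_measurable lebesgue" "g \<in> borel_measurable lebesgue"
    using f g by auto
  have i: "integrable (lebesgue \<Otimes>\<^sub>M lebesgue) (\<lambda>(x, \<xi>). f x * g \<xi> * cis (s * (x \<bullet> \<xi>)))"
  proof (rule lebesgue_pair.Fubini_integrable)
    show "(\<lambda>(x, \<xi>). f x * g \<xi> * cis (s * (x \<bullet> \<xi>))) \<in> borel_measurable (lebesgue \<Otimes>\<^sub>M lebesgue)"
      unfolding split_beta by measurable
    show "integrable lebesgue (\<lambda>x. LINT \<xi>|lebesgue. norm (case (x, \<xi>) of (x, \<xi>) \<Rightarrow> f x * g \<xi> * cis (s * (x \<bullet> \<xi>))))"
      using f by (simp add: norm_mult)
    have "integrable lebesgue (\<lambda>\<xi>. f x * (g \<xi> * cis (s * (\<xi> \<bullet> x))))" for x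
      by (intro integrable_mult_right fint_integrand g)
    then show "AE x in lebesgue. integrable lebesgue (\<lambda>\<xi>. case (x, \<xi>) of (x, \<xi>) \<Rightarrow> f x * g \<xi> * cis (s * (x \<bullet> \<xi>)))"
      by (simp add: mult.assoc inner_commute)
  qed
  have "(LINT \<xi>|lebesgue. fint s f \<xi> * g \<xi>) = (LINT \<xi>|lebesgue. LINT x|lebesgue. f x * g \<xi> * cis (s * (x \<bullet> \<xi>)))"
    unfolding fint_def by (subst integral_mult_left_zero[symmetric]) (simp add: mult_ac)
  also have "\<dots> = (LINT x|lebesgue. LINT \<xi>|lebesgue. f x * g \<xi> * cis (s * (x \<bullet> \<xi>)))"
    by (rule lebesgue_pair.Fubini_integral[OF i])
  also have "\<dots> = (LINT x|lebesgue. f x * fint s g x)"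
    unfolding fint_def by (subst integral_mult_right_zero[symmetric]) (simp add: mult_ac inner_commute)
  finally show ?thesis .
qed

lemma gauss_measurable_lebesgue [measurable]: "gauss \<epsilon> \<in> borel_measurable lebesgue"
  by (rule measurable_completion) simp

lemma integrable_fint_gauss:
  assumes g: "integrable lebesgue g" and e: "0 < \<epsilon>"
  shows "integrable lebesgue (\<lambda>\<xi>. fint s g \<xi> * gauss \<epsilon> \<xi>)"
proof -
  have "integrable lebesgue (\<lambda>\<xi>. complex_of_real (gauss \<epsilon> \<xi>) * fint s g \<xi>)"
    using gauss_integral(1)[OF e] g
    by (intro integrable_mult_bounded[OF _ _ fint_bound[OF g]]) (auto simp: complex_of_real_integrable_eq)
  then show ?thesis by (simp add: mult.commute)
qed

text \<open>Damping a transform by a Gaussian before transforming back amounts to convolution with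
  the kernel. The multiplication formula reduces this to the transform of the modulated Gaussian
  \<open>?h\<close>; as the kernel is even, both signs give the same result.\<close>

lemma fint_fint_gauss:
  fixes g :: "'a::euclidean_space \<Rightarrow> complex"
  assumes g: "integrable lebesgue g" and s: "s\<^sup>2 = 1" and e: "0 < \<epsilon>"
  shows "fint s (\<lambda>\<xi>. fint (- s) g \<xi> * gauss \<epsilon> \<xi>) y = (LINT x|lebesgue. g x * gauss_kernel \<epsilon> (y - x))"
proof -
  let ?h = "\<lambda>\<xi>. complex_of_real (gauss \<epsilon> \<xi>) * cis (s * (\<xi> \<bullet> y))"
  have K: "fint (- s) ?h x = gauss_kernel \<epsilon> (y - x)" for x
  proof -
    have "fint (- s) ?h x = (LINT \<xi>|lebesgue. gauss \<epsilon> \<xi> * cis (\<xi> \<bullet> (s *\<^sub>R (y - x))))"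
      unfolding fint_def
      by (intro Bochner_Integration.integral_cong)
        (simp_all add: mult.assoc cis_mult inner_diff_right right_diff_distrib)
    also have "\<dots> = gauss_kernel \<epsilon> (s *\<^sub>R (y - x))" by (rule gauss_fourier(2)[OF e])
    also have "\<dots> = gauss_kernel \<epsilon> (y - x)"
      using s gauss_kernel_minus[of \<epsilon> "y - x"] by (auto simp: power2_eq_1_iff)
    finally show ?thesis .
  qed
  have h: "integrable lebesgue ?h"
    using gauss_fourier(1)[OF e, of "s *\<^sub>R y"] by simp
  have "fint s (\<lambda>\<xi>. fint (- s) g \<xi> * gauss \<epsilon> \<xi>) y = (LINT \<xi>|lebesgue. fint (- s) g \<xi> * ?h \<xi>)"
    unfolding fint_def[of s] by (simp add: mult.assoc)
  also have "\<dots> = (LINT x|lebesgue. g x * gauss_kernel \<epsilon> (y - x))"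
    by (simp add: fint_mult_formula[OF g h] K)
  finally show ?thesis .
qed

text \<open>A regularised Parseval identity: the multiplication formula applied to \<open>f\<close>
  and the damped transform of \<open>g\<close>, which the Gaussian makes integrable.\<close>

lemma fint_gauss_pairing:
  fixes f g :: "'a::euclidean_space \<Rightarrow> complex"
  assumes f: "integrable lebesgue f" and g: "integrable lebesgue g" and s: "s\<^sup>2 = 1" and e: "0 < \<epsilon>"
  shows "(LINT \<xi>|lebesgue. fint s f \<xi> * (fint (- s) g \<xi> * gauss \<epsilon> \<xi>))
    = (LINT y|lebesgue. f y * (LINT x|lebesgue. g x * gauss_kernel \<epsilon> (y - x)))"
    and "integrable lebesgue (\<lambda>y. f y * (LINT x|lebesgue. g x * gauss_kernel \<epsilon> (y - x)))"
proof -
  note i = integrable_fint_gauss[OF g e, of "- s"]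
  show "(LINT \<xi>|lebesgue. fint s f \<xi> * (fint (- s) g \<xi> * gauss \<epsilon> \<xi>))
    = (LINT y|lebesgue. f y * (LINT x|lebesgue. g x * gauss_kernel \<epsilon> (y - x)))"
    using fint_mult_formula[OF f i] by (simp add: fint_fint_gauss[OF g s e])
  have "integrable lebesgue (\<lambda>y. f y * fint s (\<lambda>\<xi>. fint (- s) g \<xi> * gauss \<epsilon> \<xi>) y)"
    using i by (intro integrable_mult_bounded[OF f _ fint_bound[OF i]]) (auto intro!: fint_measurable)
  then show "integrable lebesgue (\<lambda>y. f y * (LINT x|lebesgue. g x * gauss_kernel \<epsilon> (y - x)))"
    by (simp add: fint_fint_gauss[OF g s e])
qed

text \<open>With the conjugate of \<open>f\<close> as second function, the regularised pairing is
  the integral of the damped squared modulus of the transform, and it is at most the mass of the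
  kernel times \<open>sqn f\<close>. Fatou removes the damping at the price of having only an
  inequality, which inversion later sharpens to an equality.\<close>

lemma fint_L2:
  fixes f :: "'a::euclidean_space \<Rightarrow> complex"
  assumes f: "integrable lebesgue f" "f \<in> L2" and s: "s\<^sup>2 = 1"
  shows "fint s f \<in> L2" and "sqn (fint s f) \<le> (2 * pi) ^ DIM('a) * sqn f"
proof -
  let ?c = "(2 * pi) ^ DIM('a)"
  have [measurable]: "f \<in> borel_measurable lebesgue" using f by simp
  have g: "integrable lebesgue (\<lambda>x. cnj (f x))" using f by simp
  have sq: "(\<integral>\<^sup>+x. ennreal ((cmod (f x))\<^sup>2) \<partial>lebesgue) = ennreal (sqn f)"
    unfolding sqn_def using L2_integrable[OF f(2)] by (rule nn_integral_eq_integral) simp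
  have *: "(\<integral>\<^sup>+\<xi>. ennreal ((cmod (fint s f \<xi>))\<^sup>2 * gauss \<epsilon> \<xi>) \<partial>lebesgue) \<le> ennreal (?c * sqn f)"
    if e: "0 < \<epsilon>" for \<epsilon>
  proof -
    have [measurable]: "(\<lambda>(y, x). gauss_kernel \<epsilon> (y - x :: 'a)) \<in> borel_measurable (lebesgue \<Otimes>\<^sub>M lebesgue)"
      unfolding split_beta by (rule measurable_compose[where g="gauss_kernel \<epsilon>"]) measurable
    let ?P = "\<lambda>y. f y * (LINT x|lebesgue. cnj (f x) * gauss_kernel \<epsilon> (y - x))"
    have nK: "(\<integral>\<^sup>+x. ennreal (gauss_kernel \<epsilon> (y - x)) \<partial>lebesgue) = ?c" for y :: 'a
      using gauss_kernel_integral[OF e, of y] e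
      by (subst nn_integral_eq_integral) (auto simp: gauss_kernel_nonneg)
    have nK': "(\<integral>\<^sup>+y. ennreal (gauss_kernel \<epsilon> (y - x)) \<partial>lebesgue) = ?c" for x :: 'a
      using nK[of x] gauss_kernel_minus[of \<epsilon> "x - _"] by simp
    have i: "integrable lebesgue (\<lambda>\<xi>. fint s f \<xi> * (fint (- s) (\<lambda>x. cnj (f x)) \<xi> * gauss \<epsilon> \<xi>))"
      using integrable_mult_bounded[OF integrable_fint_gauss[OF g e] _ fint_bound[OF f(1)]]
      by (simp add: mult.commute)
    have eq: "fint s f \<xi> * (fint (- s) (\<lambda>x. cnj (f x)) \<xi> * gauss \<epsilon> \<xi>) = complex_of_real ((cmod (fint s f \<xi>))\<^sup>2 * gauss \<epsilon> \<xi>)" for \<xi>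
      by (simp add: cnj_fint[symmetric] complex_norm_square mult.assoc[symmetric] del: of_real_power)
    have "(\<integral>\<^sup>+\<xi>. ennreal ((cmod (fint s f \<xi>))\<^sup>2 * gauss \<epsilon> \<xi>) \<partial>lebesgue)
        = ennreal (LINT \<xi>|lebesgue. (cmod (fint s f \<xi>))\<^sup>2 * gauss \<epsilon> \<xi>)"
      using i unfolding eq complex_of_real_integrable_eq
      by (rule nn_integral_eq_integral) (auto simp: gauss_pos less_imp_le)
    also have "\<dots> = ennreal (Re (LINT y|lebesgue. ?P y))"
      using fint_gauss_pairing(1)[OF f(1) g s e] unfolding eq integral_complex_of_real by (metis Re_complex_of_real)
    also have "\<dots> \<le> ennreal (norm (LINT y|lebesgue. ?P y))"
      by (intro ennreal_leI complex_Re_le_cmod)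
    also have "\<dots> \<le> (\<integral>\<^sup>+y. ennreal (norm (?P y)) \<partial>lebesgue)"
      by (rule integral_norm_bound_ennreal[OF fint_gauss_pairing(2)[OF f(1) g s e]])
    \<comment> \<open>The bound \<open>a * b \<le> a\<^sup>2 / 2 + b\<^sup>2 / 2\<close> separates
      the two copies of \<open>f\<close>; each half is then integrated against the kernel in the
      other variable, which yields the full mass.\<close>
    also have "\<dots> \<le> (\<integral>\<^sup>+y. \<integral>\<^sup>+x. ennreal ((cmod (f y))\<^sup>2 / 2) * ennreal (gauss_kernel \<epsilon> (y - x))
        + ennreal ((cmod (f x))\<^sup>2 / 2) * ennreal (gauss_kernel \<epsilon> (y - x)) \<partial>lebesgue \<partial>lebesgue)"
    proof (rule nn_integral_mono)
      fix y
      \<comment> \<open>The case split covers the default value 0 of the Bochner integral, so the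
        bound is available for every \<open>y\<close>.\<close>
      have "ennreal (norm (LINT x|lebesgue. cnj (f x) * gauss_kernel \<epsilon> (y - x)))
          \<le> (\<integral>\<^sup>+x. ennreal (norm (cnj (f x) * gauss_kernel \<epsilon> (y - x))) \<partial>lebesgue)"
        using integral_norm_bound_ennreal not_integrable_integral_eq
        by (cases "integrable lebesgue (\<lambda>x. cnj (f x) * gauss_kernel \<epsilon> (y - x))") 
          (auto simp: not_integrable_integral_eq intro: integral_norm_bound_ennreal)
      then have "ennreal (norm (?P y)) \<le> ennreal (cmod (f y)) * (\<integral>\<^sup>+x. ennreal (norm (cnj (f x) * gauss_kernel \<epsilon> (y - x))) \<partial>lebesgue)"
        by (simp add: norm_mult ennreal_mult mult_left_mono)
      also have "\<dots> = (\<integral>\<^sup>+x. ennreal (cmod (f y)) * ennreal (norm (cnj (f x) * gauss_kernel \<epsilon> (y - x))) \<partial>lebesgue)"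
        by (rule nn_integral_cmult[symmetric]) (intro measurable_compose[OF _ measurable_ennreal] borel_measurable_norm borel_measurable_times, auto)
      also have "\<dots> \<le> (\<integral>\<^sup>+x. ennreal ((cmod (f y))\<^sup>2 / 2) * ennreal (gauss_kernel \<epsilon> (y - x))
        + ennreal ((cmod (f x))\<^sup>2 / 2) * ennreal (gauss_kernel \<epsilon> (y - x)) \<partial>lebesgue)"
      proof (rule nn_integral_mono)
        fix x
        have K: "0 \<le> gauss_kernel \<epsilon> (y - x)" using e by (simp add: gauss_kernel_nonneg)
        have "cmod (f y) * cmod (f x) \<le> (cmod (f y))\<^sup>2 / 2 + (cmod (f x))\<^sup>2 / 2"
          using sum_squares_bound[of "cmod (f y)" "cmod (f x)"] by simp
        then have "cmod (f y) * cmod (f x) * gauss_kernel \<epsilon> (y - x)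
            \<le> ((cmod (f y))\<^sup>2 / 2 + (cmod (f x))\<^sup>2 / 2) * gauss_kernel \<epsilon> (y - x)"
          using K by (rule mult_right_mono)
        then show "ennreal (cmod (f y)) * ennreal (norm (cnj (f x) * gauss_kernel \<epsilon> (y - x)))
          \<le> ennreal ((cmod (f y))\<^sup>2 / 2) * ennreal (gauss_kernel \<epsilon> (y - x))
            + ennreal ((cmod (f x))\<^sup>2 / 2) * ennreal (gauss_kernel \<epsilon> (y - x))"
          using K by (simp add: norm_mult ennreal_mult[symmetric] ennreal_plus[symmetric] distrib_right mult.assoc del: ennreal_plus)
      qed
      finally show "ennreal (norm (?P y)) \<le> (\<integral>\<^sup>+x. ennreal ((cmod (f y))\<^sup>2 / 2) * ennreal (gauss_kernel \<epsilon> (y - x))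
        + ennreal ((cmod (f x))\<^sup>2 / 2) * ennreal (gauss_kernel \<epsilon> (y - x)) \<partial>lebesgue)" .
    qed
    also have "\<dots> = (\<integral>\<^sup>+y. \<integral>\<^sup>+x. ennreal ((cmod (f y))\<^sup>2 / 2) * ennreal (gauss_kernel \<epsilon> (y - x)) \<partial>lebesgue \<partial>lebesgue)
        + (\<integral>\<^sup>+y. \<integral>\<^sup>+x. ennreal ((cmod (f x))\<^sup>2 / 2) * ennreal (gauss_kernel \<epsilon> (y - x)) \<partial>lebesgue \<partial>lebesgue)"
      by (subst nn_integral_add[symmetric], measurable, subst nn_integral_add[symmetric], measurable)
    also have "(\<integral>\<^sup>+y. \<integral>\<^sup>+x. ennreal ((cmod (f x))\<^sup>2 / 2) * ennreal (gauss_kernel \<epsilon> (y - x)) \<partial>lebesgue \<partial>lebesgue)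
        = (\<integral>\<^sup>+x. \<integral>\<^sup>+y. ennreal ((cmod (f x))\<^sup>2 / 2) * ennreal (gauss_kernel \<epsilon> (y - x)) \<partial>lebesgue \<partial>lebesgue)"
      by (rule lebesgue_pair.Fubini') measurable
    also have "\<dots> = (\<integral>\<^sup>+x. ennreal ((cmod (f x))\<^sup>2 / 2) * ?c \<partial>lebesgue)"
      by (subst nn_integral_cmult) (simp_all add: nK')
    also have "(\<integral>\<^sup>+y. \<integral>\<^sup>+x. ennreal ((cmod (f y))\<^sup>2 / 2) * ennreal (gauss_kernel \<epsilon> (y - x)) \<partial>lebesgue \<partial>lebesgue)
        = (\<integral>\<^sup>+x. ennreal ((cmod (f x))\<^sup>2 / 2) * ?c \<partial>lebesgue)"
      by (subst nn_integral_cmult) (simp_all add: nK)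
    also have "(\<integral>\<^sup>+x. ennreal ((cmod (f x))\<^sup>2 / 2) * ?c \<partial>lebesgue) + (\<integral>\<^sup>+x. ennreal ((cmod (f x))\<^sup>2 / 2) * ?c \<partial>lebesgue)
       = (\<integral>\<^sup>+x. ennreal ((cmod (f x))\<^sup>2) * ?c \<partial>lebesgue)"
      by (subst nn_integral_add[symmetric]) (auto simp: ennreal_plus[symmetric] distrib_right[symmetric] simp del: ennreal_plus)
    also have "\<dots> = ennreal (?c * sqn f)"
      by (simp add: nn_integral_multc sq ennreal_mult mult.commute)
    finally show ?thesis .
  qed
  have "(\<integral>\<^sup>+\<xi>. ennreal ((cmod (fint s f \<xi>))\<^sup>2) \<partial>lebesgue)
      = (\<integral>\<^sup>+\<xi>. liminf (\<lambda>k. ennreal ((cmod (fint s f \<xi>))\<^sup>2 * gauss (1 / Suc k) \<xi>)) \<partial>lebesgue)"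
  proof (rule nn_integral_cong)
    fix \<xi> :: 'a
    have "(\<lambda>k. gauss (1 / Suc k) \<xi>) \<longlonglongrightarrow> exp (- (0 * norm \<xi>)\<^sup>2 / 2)"
      unfolding gauss_def by (intro tendsto_intros) (use LIMSEQ_inverse_real_of_nat in \<open>simp_all add: inverse_eq_divide\<close>)
    then have "(\<lambda>k. ennreal ((cmod (fint s f \<xi>))\<^sup>2 * gauss (1 / Suc k) \<xi>)) \<longlonglongrightarrow> ennreal ((cmod (fint s f \<xi>))\<^sup>2 * 1)"
      by (intro tendsto_intros) simp
    then show "ennreal ((cmod (fint s f \<xi>))\<^sup>2) = liminf (\<lambda>k. ennreal ((cmod (fint s f \<xi>))\<^sup>2 * gauss (1 / Suc k) \<xi>))"
      by (intro lim_imp_Liminf[symmetric]) auto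
  qed
  also have "\<dots> \<le> liminf (\<lambda>k. \<integral>\<^sup>+\<xi>. ennreal ((cmod (fint s f \<xi>))\<^sup>2 * gauss (1 / Suc k) \<xi>) \<partial>lebesgue)"
    by (rule nn_integral_liminf) measurable
  also have "\<dots> \<le> liminf (\<lambda>k. ennreal (?c * sqn f))"
    by (intro Liminf_mono always_eventually allI *) simp
  also have "\<dots> = ennreal (?c * sqn f)" by (simp add: Liminf_const)
  finally have b: "(\<integral>\<^sup>+\<xi>. ennreal ((cmod (fint s f \<xi>))\<^sup>2) \<partial>lebesgue) \<le> ennreal (?c * sqn f)" .
  show L: "fint s f \<in> L2"
    unfolding L2_def using b by (auto intro!: integrableI_bounded simp: le_less_trans)
  have "(\<integral>\<^sup>+\<xi>. ennreal ((cmod (fint s f \<xi>))\<^sup>2) \<partial>lebesgue) = ennreal (sqn (fint s f))"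
    unfolding sqn_def using L2_integrable[OF L] by (rule nn_integral_eq_integral) simp
  then show "sqn (fint s f) \<le> ?c * sqn f" using b by simp
qed

section \<open>Inversion tested against boxes\<close>

lemma indicator_L2:
  assumes "A \<in> lmeasurable"
  shows "integrable lebesgue (indicator A :: 'a::euclidean_space \<Rightarrow> complex)"
    and "(indicator A :: 'a \<Rightarrow> complex) \<in> L2"
proof -
  have [measurable]: "A \<in> sets lebesgue" using assms by blast
  have i: "integrable lebesgue (indicat_real A)" using assms by (simp add: lmeasurable_iff_integrable)
  show "integrable lebesgue (indicator A :: 'a \<Rightarrow> complex)"
    by (rule Bochner_Integration.integrable_bound[OF i]) (auto split: split_indicator)
  have "integrable lebesgue (\<lambda>x::'a. (cmod (indicator A x))\<^sup>2)"
    by (rule Bochner_Integration.integrable_bound[OF i]) (auto split: split_indicator)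
  then show "(indicator A :: 'a \<Rightarrow> complex) \<in> L2" by (simp add: L2_def)
qed

lemmas box_indicator_L2 = indicator_L2[OF lmeasurable_box]

text \<open>The damped pairing equals the integral of \<open>f\<close> against the Gaussian average
  of the indicator, which is bounded by the mass and converges off the frontier, a null set.
  Integrability of \<open>f\<close> provides the dominating function, so the statement also serves
  the uniqueness theorem for integrable functions.\<close>

lemma fint_box_tendsto:
  fixes f :: "'a::euclidean_space \<Rightarrow> complex"
  assumes f: "integrable lebesgue f" and s: "s\<^sup>2 = 1"
  shows "(\<lambda>k. LINT \<xi>|lebesgue. fint s f \<xi> * (fint (- s) (indicator (box a b)) \<xi> * gauss (1 / Suc k) \<xi>))
    \<longlonglongrightarrow> (2 * pi) ^ DIM('a) * (LINT x|lebesgue. indicator (box a b) x * f x)"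
proof -
  let ?c = "(2 * pi) ^ DIM('a)" and ?B = "box a b"
  have [measurable]: "f \<in> borel_measurable lebesgue" using f by simp
  have avg: "(LINT x|lebesgue. indicator ?B x * complex_of_real (gauss_kernel \<epsilon> (y - x))) = complex_of_real (gauss_average \<epsilon> ?B y)" for \<epsilon> y
  proof -
    have "indicator ?B x * complex_of_real (gauss_kernel \<epsilon> (y - x)) = complex_of_real (indicator ?B x * gauss_kernel \<epsilon> (y - x))" for x
      by (auto split: split_indicator)
    then show ?thesis unfolding gauss_average_def by (simp only: integral_complex_of_real)
  qed
  have p: "(LINT \<xi>|lebesgue. fint s f \<xi> * (fint (- s) (indicator ?B) \<xi> * gauss (1 / Suc k) \<xi>))
      = (LINT y|lebesgue. f y * complex_of_real (gauss_average (1 / Suc k) ?B y))"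
    and m: "(\<lambda>y. f y * complex_of_real (gauss_average (1 / Suc k) ?B y)) \<in> borel_measurable lebesgue" for k
    using fint_gauss_pairing[OF f box_indicator_L2(1) s, of "1 / Suc k" a b] by (simp_all add: avg)
  have "(\<lambda>k. LINT y|lebesgue. f y * complex_of_real (gauss_average (1 / Suc k) ?B y))
      \<longlonglongrightarrow> (LINT y|lebesgue. f y * complex_of_real (?c * indicator ?B y))"
  proof (rule integral_dominated_convergence[where w="\<lambda>y. ?c * cmod (f y)"])
    have "AE y in lebesgue. y \<notin> frontier ?B"
      using negligible_convex_frontier[OF convex_box(2), of a b] 
      by (intro AE_not_in) (simp add: negligible_iff_null_sets)
    then show "AE y in lebesgue. (\<lambda>k. f y * complex_of_real (gauss_average (1 / Suc k) ?B y))
        \<longlonglongrightarrow> f y * complex_of_real (?c * indicator ?B y)"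
      by eventually_elim (intro tendsto_intros gauss_average_tendsto, auto)
    show "AE y in lebesgue. norm (f y * complex_of_real (gauss_average (1 / Suc k) ?B y)) \<le> ?c * cmod (f y)" for k
    proof (rule AE_I2)
      fix y :: 'a
      have "cmod (f y) * \<bar>gauss_average (1 / Suc k) ?B y\<bar> \<le> cmod (f y) * ?c"
        by (intro mult_left_mono gauss_average_bound(2)) auto
      then show "norm (f y * complex_of_real (gauss_average (1 / Suc k) ?B y)) \<le> ?c * cmod (f y)"
        by (simp add: norm_mult mult.commute)
    qed
  qed (use f m in auto)
  moreover have "(LINT y|lebesgue. f y * complex_of_real (?c * indicator ?B y)) = ?c * (LINT x|lebesgue. indicator ?B x * f x)"
    unfolding integral_mult_right_zero[symmetric]
    by (intro Bochner_Integration.integral_cong) (auto split: split_indicator)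
  ultimately show ?thesis unfolding p by simp
qed

lemma fint_box_pairing:
  fixes f :: "'a::euclidean_space \<Rightarrow> complex"
  assumes f: "integrable lebesgue f" "f \<in> L2" and s: "s\<^sup>2 = 1"
  shows "(LINT \<xi>|lebesgue. fint s f \<xi> * fint (- s) (indicator (box a b)) \<xi>)
    = (2 * pi) ^ DIM('a) * (LINT x|lebesgue. indicator (box a b) x * f x)"
proof -
  let ?g = "fint (- s) (indicator (box a b))"
  have L: "fint s f \<in> L2" "?g \<in> L2"
    using fint_L2(1)[OF f s] fint_L2(1)[OF box_indicator_L2, of "- s"] s by auto
  note [measurable] = L[THEN L2_measurable]
  have i: "integrable lebesgue (\<lambda>\<xi>. fint s f \<xi> * ?g \<xi>)" by (rule L2_mult_integrable[OF L])
  have "(\<lambda>k. LINT \<xi>|lebesgue. fint s f \<xi> * (?g \<xi> * gauss (1 / Suc k) \<xi>))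
      \<longlonglongrightarrow> (LINT \<xi>|lebesgue. fint s f \<xi> * ?g \<xi>)"
  proof (rule integral_dominated_convergence[where w="\<lambda>\<xi>. cmod (fint s f \<xi> * ?g \<xi>)"])
    have "(\<lambda>k. fint s f \<xi> * (?g \<xi> * complex_of_real (gauss (1 / Suc k) \<xi>)))
        \<longlonglongrightarrow> fint s f \<xi> * (?g \<xi> * complex_of_real (exp (- (0 * norm \<xi>)\<^sup>2 / 2)))" for \<xi>
      unfolding gauss_def by (intro tendsto_intros) (use LIMSEQ_inverse_real_of_nat in \<open>simp_all add: inverse_eq_divide\<close>)
    then show "AE \<xi> in lebesgue. (\<lambda>k. fint s f \<xi> * (?g \<xi> * complex_of_real (gauss (1 / Suc k) \<xi>))) \<longlonglongrightarrow> fint s f \<xi> * ?g \<xi>"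
      by simp
    show "AE \<xi> in lebesgue. norm (fint s f \<xi> * (?g \<xi> * complex_of_real (gauss (1 / Suc k) \<xi>))) \<le> cmod (fint s f \<xi> * ?g \<xi>)" for k
      by (auto simp: norm_mult gauss_pos less_imp_le intro!: mult_left_mono mult_left_le gauss_le_1)
  qed (use i in auto)
  then show ?thesis using fint_box_tendsto[OF f(1) s] LIMSEQ_unique by blast
qed

text \<open>A vanishing transform makes all damped pairings zero, and their limits are, up to a
  nonzero factor, the integrals over boxes.\<close>

lemma fint_inject:
  fixes f :: "'a::euclidean_space \<Rightarrow> complex"
  assumes f: "integrable lebesgue f" and s: "s\<^sup>2 = 1" and 0: "\<And>\<xi>. fint s f \<xi> = 0"
  shows "AE x in lebesgue. f x = 0"
proof (rule AE_eq_0_if_box_integrals_0[OF f])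
  fix a b :: 'a
  show "(LINT x|lebesgue. indicator (box a b) x * f x) = 0"
    using LIMSEQ_unique[OF fint_box_tendsto[OF f s, of a b, unfolded 0, simplified] tendsto_const] by simp
qed

section \<open>The Fourier transform on square integrable functions\<close>

text \<open>The truncation built into \<open>fourier_trunc\<close>; it makes a square integrable
  function integrable, so that the integral formula applies.\<close>

definition trunc :: "real \<Rightarrow> ('a::euclidean_space \<Rightarrow> complex) \<Rightarrow> 'a \<Rightarrow> complex" where
  "trunc R f x = indicator (cball 0 R) x * f x"

lemma sets_lebesgue_cball [measurable]: "cball x r \<in> sets lebesgue"
  by simp

lemma trunc_measurable [measurable]:
  assumes [measurable]: "f \<in> borel_measurable lebesgue"
  shows "trunc R f \<in> borel_measurable lebesgue"
  unfolding trunc_def[abs_def] by measurable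

lemma trunc_L2:
  assumes "f \<in> L2"
  shows "trunc R f \<in> L2" and "integrable lebesgue (trunc R f)"
proof -
  have [measurable]: "f \<in> borel_measurable lebesgue" using assms by (rule L2_measurable)
  show "trunc R f \<in> L2"
    by (rule L2_mono(1)[OF _ assms, where C=1], measurable) (auto simp: trunc_def split: split_indicator)
  show "integrable lebesgue (trunc R f)"
    unfolding trunc_def[abs_def] by (intro L2_mult_integrable indicator_L2 assms) simp
qed

lemma trunc_tendsto:
  assumes f: "f \<in> L2"
  shows "L2_tendsto (\<lambda>R. trunc R f) f at_top"
proof -
  have [measurable]: "f \<in> borel_measurable lebesgue" using f by (rule L2_measurable)
  have "((\<lambda>R. LINT x|lebesgue. (norm (trunc R f x - f x))\<^sup>2) \<longlongrightarrow> (LINT x|(lebesgue :: 'a measure). 0)) at_top"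
  proof (rule integral_dominated_convergence_at_top[where w="\<lambda>x. (norm (f x))\<^sup>2"])
    show "AE x in lebesgue. ((\<lambda>R. (norm (trunc R f x - f x))\<^sup>2) \<longlongrightarrow> 0) at_top"
    proof (rule AE_I2, rule tendsto_eventually)
      fix x :: 'a
      show "\<forall>\<^sub>F R in at_top. (norm (trunc R f x - f x))\<^sup>2 = 0"
        by (rule eventually_at_top_linorderI[of "norm x"]) (simp add: trunc_def)
    qed
    show "\<forall>\<^sub>F R in at_top. AE x in lebesgue. norm ((norm (trunc R f x - f x))\<^sup>2) \<le> (norm (f x))\<^sup>2"
      by (auto simp: trunc_def split: split_indicator)
  qed (auto simp: L2_integrable[OF f])
  then show ?thesis using f trunc_L2(1)[OF f] by (simp add: L2_tendsto_sqn sqn_def)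
qed

definition fourier_L2 :: "real \<Rightarrow> ('a::euclidean_space \<Rightarrow> complex) \<Rightarrow> 'a \<Rightarrow> complex" where
  "fourier_L2 s f = (SOME g. L2_tendsto (\<lambda>R. fint s (trunc R f)) g at_top)"

lemma fint_diff_sqn:
  fixes f g :: "'a::euclidean_space \<Rightarrow> complex"
  assumes "integrable lebesgue f" "f \<in> L2" "integrable lebesgue g" "g \<in> L2" and s: "s\<^sup>2 = 1"
  shows "sqn (\<lambda>\<xi>. fint s f \<xi> - fint s g \<xi>) \<le> (2 * pi) ^ DIM('a) * sqn (\<lambda>x. f x - g x)"
  using fint_L2(2)[of "\<lambda>x. f x - g x" s] assms by (simp add: fint_diff[symmetric] L2_diff)

text \<open>Bessel's inequality bounds the difference of two truncated transforms by the tail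
  \<open>\<tau>\<close> at the smaller radius, which is the rate that completeness asks for.\<close>

lemma fourier_L2_tendsto:
  fixes f :: "'a::euclidean_space \<Rightarrow> complex"
  assumes f: "f \<in> L2" and s: "s\<^sup>2 = 1"
  shows "L2_tendsto (\<lambda>R. fint s (trunc R f)) (fourier_L2 s f) at_top"
proof -
  let ?c = "(2 * pi) ^ DIM('a)"
  let ?G = "\<lambda>R. fint s (trunc R f)"
  have [measurable]: "f \<in> borel_measurable lebesgue" using f by (rule L2_measurable)
  have m: "(\<lambda>x. trunc l f x - trunc k f x) \<in> borel_measurable lebesgue"
    "(\<lambda>x. trunc l f x - f x) \<in> borel_measurable lebesgue" for k l
    by measurable
  define \<tau> where "\<tau> R = sqn (\<lambda>x. trunc R f x - f x)" for R
  have \<tau>0: "(\<tau> \<longlongrightarrow> 0) at_top"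
    using trunc_tendsto[OF f] by (simp add: L2_tendsto_sqn \<tau>_def[abs_def])
  have G: "?G R \<in> L2" for R using trunc_L2[OF f] s by (intro fint_L2)
  have C: "sqn (\<lambda>x. ?G l x - ?G k x) \<le> ?c * \<tau> k" if "k \<le> l" for k l
  proof -
    have "sqn (\<lambda>x. ?G l x - ?G k x) \<le> ?c * sqn (\<lambda>x. trunc l f x - trunc k f x)"
      using trunc_L2[OF f] s by (intro fint_diff_sqn)
    \<comment> \<open>The difference of two truncations is \<open>f\<close> or 0 outside the smaller
      ball and 0 inside, hence below the tail beyond \<open>k\<close>.\<close>
    also have "sqn (\<lambda>x. trunc l f x - trunc k f x) \<le> 1\<^sup>2 * \<tau> k"
      unfolding \<tau>_def using that
      by (intro L2_mono(2) L2_diff trunc_L2 f)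
        (simp_all add: m, simp add: trunc_def split: split_indicator)
    finally show ?thesis by simp
  qed
  have "(\<lambda>k. ?c * \<tau> (real k)) \<longlonglongrightarrow> ?c * 0"
    by (intro tendsto_intros filterlim_compose[OF \<tau>0 filterlim_real_sequentially])
  then obtain g where g: "g \<in> L2" "\<And>k. sqn (\<lambda>x. g x - ?G (real k) x) \<le> ?c * \<tau> (real k)"
    using L2_complete[of "\<lambda>k. ?G (real k)" "\<lambda>k. ?c * \<tau> (real k)"] G C by auto
  \<comment> \<open>Completeness yields a limit along integer radii; a real radius is compared with
    an integer above it. Two errors of size \<open>?c * \<tau> R\<close>, each doubled by the bound
    on differences, make up the factor 4.\<close>
  have B: "sqn (\<lambda>x. ?G R x - g x) \<le> 4 * ?c * \<tau> R" for R
  proof -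
    obtain k :: nat where k: "R \<le> k" using real_arch_simple by blast
    have \<tau>k: "\<tau> k \<le> 1\<^sup>2 * \<tau> R"
      unfolding \<tau>_def using k
      by (intro L2_mono(2) L2_diff trunc_L2 f)
        (simp_all add: m, simp add: trunc_def split: split_indicator)
    have "sqn (\<lambda>x. ?G R x - g x) = sqn (\<lambda>x. (?G R x - ?G k x) - (g x - ?G k x))"
      by simp
    also have "\<dots> \<le> 2 * sqn (\<lambda>x. ?G R x - ?G k x) + 2 * sqn (\<lambda>x. g x - ?G k x)"
      using G g(1) by (intro L2_diff(2) L2_diff(1))
    also have "\<dots> \<le> 2 * (?c * \<tau> R) + 2 * (?c * \<tau> k)"
      using C[OF k] g(2)[of k] by (subst sqn_minus_commute) (intro add_mono mult_left_mono, auto)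
    also have "\<dots> \<le> 2 * (?c * \<tau> R) + 2 * (?c * \<tau> R)"
      using \<tau>k by (intro add_mono mult_left_mono) auto
    also have "\<dots> = 4 * ?c * \<tau> R" by simp
    finally show ?thesis .
  qed
  have lim: "((\<lambda>R. 4 * ?c * \<tau> R) \<longlongrightarrow> 4 * ?c * 0) at_top"
    by (intro tendsto_intros \<tau>0)
  have "((\<lambda>R. sqn (\<lambda>x. ?G R x - g x)) \<longlongrightarrow> 0) at_top"
    by (rule tendsto_sandwich[OF _ _ tendsto_const lim[simplified]]) (use B in auto)
  then have "L2_tendsto ?G g at_top" using G g(1) by (simp add: L2_tendsto_sqn)
  then show ?thesis unfolding fourier_L2_def by (rule someI[where P="\<lambda>g. L2_tendsto ?G g at_top"])
qed

lemma fourier_L2_in_L2: "f \<in> L2 \<Longrightarrow> s\<^sup>2 = 1 \<Longrightarrow> fourier_L2 s f \<in> L2"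
  using fourier_L2_tendsto by (auto simp: L2_tendsto_def)

lemma fourier_L2_eq_fint:
  fixes f :: "'a::euclidean_space \<Rightarrow> complex"
  assumes f: "f \<in> L2" "integrable lebesgue f" and s: "s\<^sup>2 = 1"
  shows "AE \<xi> in lebesgue. fourier_L2 s f \<xi> = fint s f \<xi>"
proof (rule L2_tendsto_unique[OF fourier_L2_tendsto[OF f(1) s]])
  have b: "sqn (\<lambda>\<xi>. fint s (trunc R f) \<xi> - fint s f \<xi>) \<le> (2 * pi) ^ DIM('a) * sqn (\<lambda>x. trunc R f x - f x)" for R
    using trunc_L2[OF f(1)] f s by (intro fint_diff_sqn)
  have lim: "((\<lambda>R. (2 * pi) ^ DIM('a) * sqn (\<lambda>x. trunc R f x - f x)) \<longlongrightarrow> (2 * pi) ^ DIM('a) * 0) at_top"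
    using trunc_tendsto[OF f(1)] by (intro tendsto_intros) (simp add: L2_tendsto_sqn)
  have "((\<lambda>R. sqn (\<lambda>\<xi>. fint s (trunc R f) \<xi> - fint s f \<xi>)) \<longlongrightarrow> 0) at_top"
    by (rule tendsto_sandwich[OF _ _ tendsto_const lim[simplified]]) (use b in auto)
  then show "L2_tendsto (\<lambda>R. fint s (trunc R f)) (fint s f) at_top"
    using fint_L2(1)[OF f(2,1) s] fint_L2(1)[OF trunc_L2(2,1)[OF f(1)] s] by (simp add: L2_tendsto_sqn)
qed simp

section \<open>Linearity, conjugation, inversion and Plancherel\<close>

lemma fourier_L2_add:
  assumes f: "f \<in> L2" and g: "g \<in> L2" and s: "s\<^sup>2 = 1"
  shows "AE \<xi> in lebesgue. fourier_L2 s (\<lambda>x. f x + g x) \<xi> = fourier_L2 s f \<xi> + fourier_L2 s g \<xi>"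
proof (rule L2_tendsto_unique[OF fourier_L2_tendsto[OF L2_add(1)[OF f g] s]])
  have "fint s (trunc R (\<lambda>x. f x + g x)) = (\<lambda>\<xi>. fint s (trunc R f) \<xi> + fint s (trunc R g) \<xi>)" for R
    using fint_add[OF trunc_L2(2)[OF f] trunc_L2(2)[OF g]]
    by (auto simp: fun_eq_iff trunc_def[abs_def] distrib_left)
  then show "L2_tendsto (\<lambda>R. fint s (trunc R (\<lambda>x. f x + g x))) (\<lambda>\<xi>. fourier_L2 s f \<xi> + fourier_L2 s g \<xi>) at_top"
    using L2_tendsto_add[OF fourier_L2_tendsto[OF f s] fourier_L2_tendsto[OF g s]] by simp
qed simp

lemma fourier_L2_cmult:
  assumes f: "f \<in> L2" and s: "s\<^sup>2 = 1"
  shows "AE \<xi> in lebesgue. fourier_L2 s (\<lambda>x. c * f x) \<xi> = c * fourier_L2 s f \<xi>"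
proof (rule L2_tendsto_unique[OF fourier_L2_tendsto[OF L2_cmult(1)[OF f] s]])
  have t: "trunc R (\<lambda>x. c * f x) = (\<lambda>x. c * trunc R f x)" for R
    by (auto simp: trunc_def)
  have "fint s (trunc R (\<lambda>x. c * f x)) = (\<lambda>\<xi>. c * fint s (trunc R f) \<xi>)" for R
    by (intro ext) (simp only: t fint_cmult)
  then show "L2_tendsto (\<lambda>R. fint s (trunc R (\<lambda>x. c * f x))) (\<lambda>\<xi>. c * fourier_L2 s f \<xi>) at_top"
    using L2_tendsto_cmult[OF fourier_L2_tendsto[OF f s]] by simp
qed simp

lemma fourier_L2_diff:
  assumes f: "f \<in> L2" and g: "g \<in> L2" and s: "s\<^sup>2 = 1"
  shows "AE \<xi> in lebesgue. fourier_L2 s (\<lambda>x. f x - g x) \<xi> = fourier_L2 s f \<xi> - fourier_L2 s g \<xi>"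
  using fourier_L2_add[OF f L2_cmult(1)[OF g, of "-1"] s] fourier_L2_cmult[OF g s, of "-1"]
  by (auto elim: eventually_elim2)

lemma cnj_fourier_L2:
  assumes f: "f \<in> L2" and s: "s\<^sup>2 = 1"
  shows "AE \<xi> in lebesgue. cnj (fourier_L2 s f \<xi>) = fourier_L2 (- s) (\<lambda>x. cnj (f x)) \<xi>"
proof (rule L2_tendsto_unique[OF L2_tendsto_cnj[OF fourier_L2_tendsto[OF f s]]])
  have "trunc R (\<lambda>x. cnj (f x)) = (\<lambda>x. cnj (trunc R f x))" for R
    by (auto simp: trunc_def split: split_indicator)
  then show "L2_tendsto (\<lambda>R x. cnj (fint s (trunc R f) x)) (fourier_L2 (- s) (\<lambda>x. cnj (f x))) at_top"
    using fourier_L2_tendsto[OF L2_cnj[OF f], of "- s"] s by (simp add: cnj_fint)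
qed simp

lemma fourier_L2_mult_formula:
  assumes f: "f \<in> L2" and g: "g \<in> L2" and s: "s\<^sup>2 = 1"
  shows "(LINT \<xi>|lebesgue. fourier_L2 s f \<xi> * g \<xi>) = (LINT x|lebesgue. f x * fourier_L2 s g x)"
proof (rule tendsto_unique)
  show "((\<lambda>R. LINT \<xi>|lebesgue. fint s (trunc R f) \<xi> * trunc R g \<xi>) \<longlongrightarrow> (LINT \<xi>|lebesgue. fourier_L2 s f \<xi> * g \<xi>)) at_top"
    by (intro L2_tendsto_integral_mult fourier_L2_tendsto trunc_tendsto f g s)
  have "((\<lambda>R. LINT x|lebesgue. trunc R f x * fint s (trunc R g) x) \<longlongrightarrow> (LINT x|lebesgue. f x * fourier_L2 s g x)) at_top"
    by (intro L2_tendsto_integral_mult fourier_L2_tendsto trunc_tendsto f g s)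
  then show "((\<lambda>R. LINT \<xi>|lebesgue. fint s (trunc R f) \<xi> * trunc R g \<xi>) \<longlongrightarrow> (LINT x|lebesgue. f x * fourier_L2 s g x)) at_top"
    by (simp add: fint_mult_formula trunc_L2 f g)
qed simp

text \<open>A square integrable function need not be integrable, but its restriction to a box is;
  boxes intersect in boxes, so the restrictions inherit the hypothesis.\<close>

lemma AE_eq_0_if_box_integrals_0_L2:
  fixes f :: "'a::euclidean_space \<Rightarrow> complex"
  assumes f: "f \<in> L2" and 0: "\<And>a b. (LINT x|lebesgue. indicator (box a b) x * f x) = 0"
  shows "AE x in lebesgue. f x = 0"
proof -
  define B where "B k = box (- (real k *\<^sub>R One)) (real k *\<^sub>R One :: 'a)" for k :: nat
  have "AE x in lebesgue. indicator (B k) x * f x = 0" for k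
  proof (rule AE_eq_0_if_box_integrals_0)
    show "integrable lebesgue (\<lambda>x. indicator (B k) x * f x)"
      unfolding B_def by (intro L2_mult_integrable box_indicator_L2 f)
    fix a b
    obtain c d where cd: "box a b \<inter> B k = box c d" unfolding B_def box_Int_box by blast
    have "indicator (box a b) x * (indicator (B k) x * f x) = indicator (box c d) x * f x" for x
      unfolding cd[symmetric] by (auto split: split_indicator)
    then show "(LINT x|lebesgue. indicator (box a b) x * (indicator (B k) x * f x)) = 0"
      by (simp only: 0)
  qed
  then have "AE x in lebesgue. \<forall>k. indicator (B k) x * f x = 0" by (subst AE_all_countable) blast
  then show ?thesis
  proof eventually_elim
    case (elim x)
    obtain k where "x \<in> B k"
      unfolding B_def using symmetric_boxes_exhaust[of x] by blast
    then show ?case using elim[rule_format, of k] by simp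
  qed
qed

text \<open>The multiplication formula moves the outer transform onto the indicator of a box, where
  the integral formula is available; the box pairing for the truncations of \<open>f\<close> then
  passes to the limit.\<close>

lemma fourier_L2_inverse:
  fixes f :: "'a::euclidean_space \<Rightarrow> complex"
  assumes f: "f \<in> L2" and s: "s\<^sup>2 = 1"
  shows "AE x in lebesgue. fourier_L2 (- s) (fourier_L2 s f) x = (2 * pi) ^ DIM('a) * f x"
proof -
  let ?c = "(2 * pi) ^ DIM('a)"
  have s': "(- s)\<^sup>2 = 1" using s by simp
  note F = fourier_L2_in_L2[OF f s] and FF = fourier_L2_in_L2[OF fourier_L2_in_L2[OF f s] s']
  have box: "(LINT x|lebesgue. indicator (box a b) x * fourier_L2 (- s) (fourier_L2 s f) x)
      = ?c * (LINT x|lebesgue. indicator (box a b) x * f x)" for a b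
  proof -
    let ?B = "indicator (box a b) :: 'a \<Rightarrow> complex"
    note B = box_indicator_L2[of a b]
    have BL: "fint (- s) ?B \<in> L2" using B s' by (intro fint_L2)
    note [measurable] = L2_measurable[OF F] L2_measurable[OF BL] L2_measurable[OF fourier_L2_in_L2[OF B(2) s']]
    have "(LINT x|lebesgue. ?B x * fourier_L2 (- s) (fourier_L2 s f) x)
        = (LINT \<xi>|lebesgue. fourier_L2 (- s) ?B \<xi> * fourier_L2 s f \<xi>)"
      by (rule fourier_L2_mult_formula[symmetric, OF B(2) F s'])
    also have "\<dots> = (LINT \<xi>|lebesgue. fourier_L2 s f \<xi> * fint (- s) ?B \<xi>)"
      using fourier_L2_eq_fint[OF B(2,1) s'] by (intro integral_cong_AE) (auto elim: eventually_mono)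
    also have "\<dots> = ?c * (LINT x|lebesgue. ?B x * f x)"
    proof (rule tendsto_unique)
      show "((\<lambda>R. LINT \<xi>|lebesgue. fint s (trunc R f) \<xi> * fint (- s) ?B \<xi>) \<longlongrightarrow> (LINT \<xi>|lebesgue. fourier_L2 s f \<xi> * fint (- s) ?B \<xi>)) at_top"
        using BL by (intro L2_tendsto_integral_mult fourier_L2_tendsto f s) (simp add: L2_tendsto_sqn)
      have "((\<lambda>R. ?c * (LINT x|lebesgue. ?B x * trunc R f x)) \<longlongrightarrow> ?c * (LINT x|lebesgue. ?B x * f x)) at_top"
        using B(2) by (intro tendsto_intros L2_tendsto_integral_mult trunc_tendsto f) (simp add: L2_tendsto_sqn)
      then show "((\<lambda>R. LINT \<xi>|lebesgue. fint s (trunc R f) \<xi> * fint (- s) ?B \<xi>) \<longlongrightarrow> ?c * (LINT x|lebesgue. ?B x * f x)) at_top"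
        by (simp add: fint_box_pairing[OF trunc_L2(2,1)[OF f] s])
    qed simp
    finally show ?thesis .
  qed
  have "AE x in lebesgue. fourier_L2 (- s) (fourier_L2 s f) x - ?c * f x = 0"
  proof (rule AE_eq_0_if_box_integrals_0_L2)
    note cf = L2_cmult(1)[OF f, of ?c]
    show "(\<lambda>x. fourier_L2 (- s) (fourier_L2 s f) x - ?c * f x) \<in> L2"
      by (rule L2_diff(1)[OF FF cf])
    fix a b :: 'a
    note B = box_indicator_L2(2)[of a b]
    have "(LINT x|lebesgue. indicator (box a b) x * (fourier_L2 (- s) (fourier_L2 s f) x - ?c * f x))
      = (LINT x|lebesgue. indicator (box a b) x * fourier_L2 (- s) (fourier_L2 s f) x) - (LINT x|lebesgue. indicator (box a b) x * (?c * f x))"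
      unfolding right_diff_distrib
      by (intro Bochner_Integration.integral_diff L2_mult_integrable B FF cf)
    also have "(LINT x|lebesgue. indicator (box a b) x * (?c * f x)) = ?c * (LINT x|lebesgue. indicator (box a b) x * f x)"
      unfolding integral_mult_right_zero[symmetric] by (simp add: mult_ac)
    finally show "(LINT x|lebesgue. indicator (box a b) x * (fourier_L2 (- s) (fourier_L2 s f) x - ?c * f x)) = 0"
      by (simp add: box)
  qed
  then show ?thesis by simp
qed

lemma fourier_L2_pairing:
  fixes f g :: "'a::euclidean_space \<Rightarrow> complex"
  assumes f: "f \<in> L2" and g: "g \<in> L2" and s: "s\<^sup>2 = 1"
  shows "(LINT \<xi>|lebesgue. fourier_L2 s f \<xi> * fourier_L2 (- s) g \<xi>) = (2 * pi) ^ DIM('a) * (LINT x|lebesgue. f x * g x)"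
proof -
  have s': "(- s)\<^sup>2 = 1" using s by simp
  note G = fourier_L2_in_L2[OF g s'] and GG = fourier_L2_in_L2[OF fourier_L2_in_L2[OF g s'] s]
  note [measurable] = L2_measurable[OF f] L2_measurable[OF g] L2_measurable[OF GG]
  have "(LINT \<xi>|lebesgue. fourier_L2 s f \<xi> * fourier_L2 (- s) g \<xi>) = (LINT x|lebesgue. f x * fourier_L2 s (fourier_L2 (- s) g) x)"
    by (rule fourier_L2_mult_formula[OF f G s])
  also have "\<dots> = (LINT x|lebesgue. (2 * pi) ^ DIM('a) * (f x * g x))"
    using fourier_L2_inverse[OF g s'] by (intro integral_cong_AE) (auto elim: eventually_mono)
  finally show ?thesis by simp
qed

lemma fourier_L2_inner:
  fixes f g :: "'a::euclidean_space \<Rightarrow> complex"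
  assumes f: "f \<in> L2" and g: "g \<in> L2" and s: "s\<^sup>2 = 1"
  shows "(LINT \<xi>|lebesgue. fourier_L2 s f \<xi> * cnj (fourier_L2 s g \<xi>)) = (2 * pi) ^ DIM('a) * (LINT x|lebesgue. f x * cnj (g x))"
proof -
  have s': "(- s)\<^sup>2 = 1" using s by simp
  note [measurable] = L2_measurable[OF fourier_L2_in_L2[OF f s]] L2_measurable[OF fourier_L2_in_L2[OF g s]]
    L2_measurable[OF fourier_L2_in_L2[OF L2_cnj[OF g] s']]
  have "(LINT \<xi>|lebesgue. fourier_L2 s f \<xi> * cnj (fourier_L2 s g \<xi>)) = (LINT \<xi>|lebesgue. fourier_L2 s f \<xi> * fourier_L2 (- s) (\<lambda>x. cnj (g x)) \<xi>)"
    using cnj_fourier_L2[OF g s] by (intro integral_cong_AE) (auto elim: eventually_mono)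
  then show ?thesis using fourier_L2_pairing[OF f L2_cnj[OF g] s] by simp
qed

lemma sqn_conv_integral: "complex_of_real (sqn f) = (LINT x|lebesgue. f x * cnj (f x))"
  unfolding sqn_def by (simp add: integral_complex_of_real[symmetric] complex_norm_square del: of_real_power)

lemma sqn_fourier_L2:
  fixes f :: "'a::euclidean_space \<Rightarrow> complex"
  assumes f: "f \<in> L2" and s: "s\<^sup>2 = 1"
  shows "sqn (fourier_L2 s f) = (2 * pi) ^ DIM('a) * sqn f"
proof -
  have "complex_of_real (sqn (fourier_L2 s f)) = complex_of_real ((2 * pi) ^ DIM('a) * sqn f)"
    using fourier_L2_inner[OF f f s] by (simp add: sqn_conv_integral)
  then show ?thesis by (simp only: of_real_eq_iff)
qed

text \<open>By inversion the preimage is the transform of opposite sign divided by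
  \<open>(2 * pi) ^ DIM('a)\<close>. Surjectivity is what turns a symbol into an operator on
  fields.\<close>

lemma fourier_L2_surj:
  fixes g :: "'a::euclidean_space \<Rightarrow> complex"
  assumes g: "g \<in> L2" and s: "s\<^sup>2 = 1"
  obtains f where "f \<in> L2" "AE \<xi> in lebesgue. fourier_L2 s f \<xi> = g \<xi>"
proof
  define c where "c = (2 * complex_of_real pi) ^ DIM('a)"
  have c: "c \<noteq> 0" by (simp add: c_def)

  have s': "(- s)\<^sup>2 = 1" using s by simp
  note G = fourier_L2_in_L2[OF g s']
  show "(\<lambda>x. inverse c * fourier_L2 (- s) g x) \<in> L2" by (rule L2_cmult(1)[OF G])
  have "AE \<xi> in lebesgue. fourier_L2 s (fourier_L2 (- s) g) \<xi> = c * g \<xi>"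
    using fourier_L2_inverse[OF g s'] by (simp add: c_def)
  then show "AE \<xi> in lebesgue. fourier_L2 s (\<lambda>x. inverse c * fourier_L2 (- s) g x) \<xi> = g \<xi>"
    using fourier_L2_cmult[OF G s, of "inverse c"] by eventually_elim (use c in simp)
qed

section \<open>Vector fields\<close>

lemma borel_measurable_vec_nth [measurable (raw)]:
  fixes f :: "'a \<Rightarrow> 'b::real_normed_vector ^ 'n"
  shows "f \<in> borel_measurable M \<Longrightarrow> (\<lambda>x. f x $ i) \<in> borel_measurable M"
  by (rule measurable_compose[OF _ borel_measurable_continuous_onI]) (auto intro!: continuous_intros)

lemma component_borel_measurable_lebesgue [measurable]:
  "(\<lambda>x::real^'n. x $ i) \<in> borel_measurable lebesgue"
  by (rule borel_measurable_vec_nth[OF ident_borel_measurable_lebesgue])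

lemma borel_measurable_vec_lambda:
  fixes f :: "'a \<Rightarrow> 'n::finite \<Rightarrow> complex"
  assumes [measurable]: "\<And>i. (\<lambda>x. f x i) \<in> borel_measurable M"
  shows "(\<lambda>x. \<chi> i. f x i) \<in> borel_measurable M"
proof -
  have eq: "(\<chi> i. f x i) = (\<Sum>i\<in>UNIV. axis i (f x i))" for x
    by (simp add: vec_eq_iff axis_def if_distrib cong: if_cong)
  have ax: "continuous_on UNIV (\<lambda>z. axis i z :: complex ^ 'n)" for i
    by (intro linear_continuous_on linear_conv_bounded_linear[THEN iffD1])
      (auto intro!: linearI simp: vec_eq_iff axis_def)
  have [measurable]: "(\<lambda>x. axis i (f x i) :: complex ^ 'n) \<in> borel_measurable M" for i
    by (rule measurable_compose[OF assms borel_measurable_continuous_onI[OF ax]])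
  show ?thesis unfolding eq by measurable
qed

lemma norm_vec_sq: "(norm (z :: complex ^ 'n))\<^sup>2 = (\<Sum>i\<in>UNIV. (cmod (z $ i))\<^sup>2)"
  by (simp add: norm_vec_def L2_set_def sum_nonneg)

lemma L2_component:
  fixes f :: "'a::euclidean_space \<Rightarrow> complex ^ 'n"
  assumes f: "f \<in> L2"
  shows "(\<lambda>x. f x $ i) \<in> L2"
proof (rule L2_mono(1)[OF _ f, where C=1])
  show "(\<lambda>x. f x $ i) \<in> borel_measurable lebesgue"
    by (rule borel_measurable_vec_nth[OF L2_measurable[OF f]])
qed (simp add: Finite_Cartesian_Product.norm_nth_le)

lemma L2_vec_lambda:
  fixes f :: "'n::finite \<Rightarrow> 'a::euclidean_space \<Rightarrow> complex"
  assumes f: "\<And>i. f i \<in> L2"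
  shows "(\<lambda>x. \<chi> i. f i x) \<in> L2" and "sqn (\<lambda>x. \<chi> i. f i x) = (\<Sum>i\<in>UNIV. sqn (f i))"
proof -
  show "(\<lambda>x. \<chi> i. f i x) \<in> L2"
  proof (rule L2_bound)
    show "(\<lambda>x. \<chi> i. f i x) \<in> borel_measurable lebesgue"
      by (rule borel_measurable_vec_lambda[OF L2_measurable[OF f]])
    show "integrable lebesgue (\<lambda>x. \<Sum>i\<in>UNIV. (cmod (f i x))\<^sup>2)"
      by (rule Bochner_Integration.integrable_sum) (rule L2_integrable[OF f])
  qed (simp add: norm_vec_sq)
  show "sqn (\<lambda>x. \<chi> i. f i x) = (\<Sum>i\<in>UNIV. sqn (f i))"
    unfolding sqn_def norm_vec_sq using L2_integrable[OF f] by simp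
qed

lemma sqn_vec:
  fixes f :: "'a::euclidean_space \<Rightarrow> complex ^ 'n"
  assumes "f \<in> L2"
  shows "sqn f = (\<Sum>i\<in>UNIV. sqn (\<lambda>x. f x $ i))"
  using L2_vec_lambda(2)[of "\<lambda>i x. f x $ i"] L2_component[OF assms] by simp

text \<open>A concrete representative with which the choice \<open>fourier\<close> has to agree
  almost everywhere.\<close>

definition fourier_vec :: "(real^'n \<Rightarrow> complex^'n) \<Rightarrow> real^'n \<Rightarrow> complex^'n" where
  "fourier_vec f \<xi> = (\<chi> i. fourier_L2 (- 1) (\<lambda>x. f x $ i) \<xi>)"

lemma integrable_vec:
  fixes f :: "'a \<Rightarrow> complex ^ 'n"
  assumes "\<And>i. integrable M (\<lambda>x. f x $ i)"
  shows "integrable M f"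
proof (rule Bochner_Integration.integrable_bound)
  show "integrable M (\<lambda>x. \<Sum>i\<in>UNIV. norm (f x $ i))" using assms by auto
  have "(\<lambda>x. \<chi> i. f x $ i) \<in> borel_measurable M"
    using assms by (intro borel_measurable_vec_lambda) auto
  then show "f \<in> borel_measurable M" by simp
  show "AE x in M. norm (f x) \<le> norm (\<Sum>i\<in>UNIV. norm (f x $ i))"
    by (auto simp: norm_vec_def intro!: AE_I2 order_trans[OF L2_set_le_sum])
qed

text \<open>Taking a component is bounded and linear, hence commutes with the integral once the
  truncated vector integrand is known to be integrable.\<close>

lemma fourier_trunc_component:
  fixes f :: "real^'n \<Rightarrow> complex^'n"
  assumes f: "f \<in> L2"
  shows "fourier_trunc R f \<xi> $ i = fint (- 1) (trunc R (\<lambda>x. f x $ i)) \<xi>"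
proof -
  let ?g = "\<lambda>x. indicat_real (cball 0 R) x *\<^sub>R (cis (- (x \<bullet> \<xi>)) *s f x)"
  have eq: "?g x $ i = trunc R (\<lambda>x. f x $ i) x * cis (- 1 * (x \<bullet> \<xi>))" for x i
    by (auto simp: trunc_def split: split_indicator)
  have "integrable lebesgue (\<lambda>x. ?g x $ i)" for i
    unfolding eq by (rule fint_integrand[OF trunc_L2(2)[OF L2_component[OF f]]])
  then have "integrable lebesgue ?g" by (rule integrable_vec)
  then have "(LINT x|lebesgue. ?g x) $ i = (LINT x|lebesgue. ?g x $ i)"
    by (rule integral_bounded_linear[OF bounded_linear_vec_nth, symmetric])
  then show ?thesis unfolding eq by (simp add: fourier_trunc_def set_lebesgue_integral_def fint_def)
qed

lemma fourier_vec_L2: "f \<in> L2 \<Longrightarrow> fourier_vec f \<in> L2"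
  unfolding fourier_vec_def[abs_def] by (intro L2_vec_lambda fourier_L2_in_L2 L2_component) auto

lemma fourier_vec_tendsto:
  fixes f :: "real^'n \<Rightarrow> complex^'n"
  assumes f: "f \<in> L2"
  shows "L2_tendsto (\<lambda>R. fourier_trunc R f) (fourier_vec f) at_top"
proof -
  have T: "fourier_trunc R f = (\<lambda>\<xi>. \<chi> i. fint (- 1) (trunc R (\<lambda>x. f x $ i)) \<xi>)" for R
    by (auto simp: vec_eq_iff fourier_trunc_component[OF f])
  have t: "L2_tendsto (\<lambda>R. fint (- 1) (trunc R (\<lambda>x. f x $ i))) (fourier_L2 (- 1) (\<lambda>x. f x $ i)) at_top" for i
    by (intro fourier_L2_tendsto L2_component f) simp
  then have L: "fint (- 1) (trunc R (\<lambda>x. f x $ i)) \<in> L2" "fourier_L2 (- 1) (\<lambda>x. f x $ i) \<in> L2" for i R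
    by (auto simp: L2_tendsto_def)
  have TL: "fourier_trunc R f \<in> L2" for R unfolding T by (intro L2_vec_lambda L)
  have "((\<lambda>R. \<Sum>i\<in>UNIV. sqn (\<lambda>\<xi>. fint (- 1) (trunc R (\<lambda>x. f x $ i)) \<xi> - fourier_L2 (- 1) (\<lambda>x. f x $ i) \<xi>)) \<longlongrightarrow> (\<Sum>i\<in>(UNIV :: 'n set). 0)) at_top"
    by (intro tendsto_sum) (use t in \<open>auto simp: L2_tendsto_sqn\<close>)
  moreover have "sqn (\<lambda>\<xi>. fourier_trunc R f \<xi> - fourier_vec f \<xi>)
      = (\<Sum>i\<in>UNIV. sqn (\<lambda>\<xi>. fint (- 1) (trunc R (\<lambda>x. f x $ i)) \<xi> - fourier_L2 (- 1) (\<lambda>x. f x $ i) \<xi>))" for R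
    by (subst sqn_vec[OF L2_diff(1)[OF TL fourier_vec_L2[OF f]]]) (simp add: T fourier_vec_def)
  ultimately show ?thesis using TL fourier_vec_L2[OF f] by (simp add: L2_tendsto_sqn)
qed

lemma fourier_tendsto:
  assumes f: "f \<in> L2"
  shows "L2_tendsto (\<lambda>R. fourier_trunc R f) (fourier f) at_top"
  unfolding fourier_def
  by (rule someI[where P="\<lambda>g. L2_tendsto (\<lambda>R. fourier_trunc R f) g at_top"]) (rule fourier_vec_tendsto[OF f])

lemma fourier_AE:
  assumes f: "f \<in> L2"
  shows "AE \<xi> in lebesgue. fourier f \<xi> = fourier_vec f \<xi>"
  by (rule L2_tendsto_unique[OF fourier_tendsto[OF f] fourier_vec_tendsto[OF f]]) simp

lemma fourier_in_L2: "f \<in> L2 \<Longrightarrow> fourier f \<in> L2"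
  using fourier_tendsto by (auto simp: L2_tendsto_def)

lemma fourier_component:
  assumes "f \<in> L2"
  shows "AE \<xi> in lebesgue. \<forall>i. fourier f \<xi> $ i = fourier_L2 (- 1) (\<lambda>x. f x $ i) \<xi>"
  using fourier_AE[OF assms] by eventually_elim (simp add: fourier_vec_def)

lemma sqn_fourier:
  fixes f :: "real^'n \<Rightarrow> complex^'n"
  assumes f: "f \<in> L2"
  shows "sqn (fourier f) = (2 * pi) ^ CARD('n) * sqn f"
proof -
  have "sqn (fourier f) = sqn (fourier_vec f)"
    by (rule sqn_cong_AE[OF fourier_in_L2[OF f] fourier_AE[OF f]])
  also have "\<dots> = (\<Sum>i\<in>UNIV. sqn (fourier_L2 (- 1) (\<lambda>x. f x $ i)))"
    by (subst sqn_vec[OF fourier_vec_L2[OF f]]) (simp add: fourier_vec_def)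
  also have "\<dots> = (2 * pi) ^ CARD('n) * sqn f"
    by (simp add: sqn_fourier_L2 L2_component[OF f] sqn_vec[OF f] sum_distrib_left)
  finally show ?thesis .
qed

lemma fourier_add:
  assumes f: "f \<in> L2" and g: "g \<in> L2"
  shows "AE \<xi> in lebesgue. fourier (\<lambda>x. f x + g x) \<xi> = fourier f \<xi> + fourier g \<xi>"
proof -
  have "AE \<xi> in lebesgue. \<forall>i. fourier_L2 (- 1) (\<lambda>x. f x $ i + g x $ i) \<xi> = fourier_L2 (- 1) (\<lambda>x. f x $ i) \<xi> + fourier_L2 (- 1) (\<lambda>x. g x $ i) \<xi>"
    by (subst AE_all_countable) (auto intro!: fourier_L2_add L2_component f g)
  with fourier_component[OF f] fourier_component[OF g] fourier_component[OF L2_add(1)[OF f g]]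
  show ?thesis by eventually_elim (simp add: vec_eq_iff)
qed

lemma fourier_diff:
  assumes f: "f \<in> L2" and g: "g \<in> L2"
  shows "AE \<xi> in lebesgue. fourier (\<lambda>x. f x - g x) \<xi> = fourier f \<xi> - fourier g \<xi>"
proof -
  have "AE \<xi> in lebesgue. \<forall>i. fourier_L2 (- 1) (\<lambda>x. f x $ i - g x $ i) \<xi> = fourier_L2 (- 1) (\<lambda>x. f x $ i) \<xi> - fourier_L2 (- 1) (\<lambda>x. g x $ i) \<xi>"
    by (subst AE_all_countable) (auto intro!: fourier_L2_diff L2_component f g)
  with fourier_component[OF f] fourier_component[OF g] fourier_component[OF L2_diff(1)[OF f g]]
  show ?thesis by eventually_elim (simp add: vec_eq_iff)
qed

lemma fourier_sum:
  fixes f :: "nat \<Rightarrow> real^'n \<Rightarrow> complex^'n"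
  assumes f: "\<And>p. f p \<in> L2"
  shows "AE \<xi> in lebesgue. fourier (\<lambda>x. \<Sum>p<N. f p x) \<xi> = (\<Sum>p<N. fourier (f p) \<xi>)"
proof (induction N)
  case 0
  let ?z = "\<lambda>x::real^'n. 0 :: complex^'n"
  have "sqn (fourier ?z) = 0" using sqn_fourier[of ?z] by simp
  then show ?case using sqn_eq_0_iff[OF fourier_in_L2[of ?z]] by simp
next
  case (Suc N)
  then show ?case using fourier_add[OF L2_sum[of "{..<N}" f] f[of N]] f
    by (auto elim: eventually_elim2)
qed

lemma fourier_surj:
  fixes g :: "real^'n \<Rightarrow> complex^'n"
  assumes g: "g \<in> L2"
  obtains f where "f \<in> L2" "AE \<xi> in lebesgue. fourier f \<xi> = g \<xi>"
proof -
  have "\<exists>f. f \<in> L2 \<and> (AE \<xi> in lebesgue. fourier_L2 (- 1) f \<xi> = g \<xi> $ i)" for i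
    using fourier_L2_surj[OF L2_component[OF g, of i], of "- 1"] by auto
  then obtain f where f: "\<And>i. f i \<in> L2" "\<And>i. AE \<xi> in lebesgue. fourier_L2 (- 1) (f i) \<xi> = g \<xi> $ i"
    by metis
  have L: "(\<lambda>x. \<chi> i. f i x) \<in> L2" by (rule L2_vec_lambda(1)[OF f(1)])
  have "AE \<xi> in lebesgue. \<forall>i. fourier_L2 (- 1) (f i) \<xi> = g \<xi> $ i"
    by (subst AE_all_countable) (use f(2) in auto)
  with fourier_component[OF L] have "AE \<xi> in lebesgue. fourier (\<lambda>x. \<chi> i. f i x) \<xi> = g \<xi>"
    by eventually_elim (simp add: vec_eq_iff)
  with L show thesis by (rule that)
qed

section \<open>Shannon multipliers\<close>

text \<open>The logarithm makes the boxes half-open and thereby selects a single index per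
  frequency, so that the family of symbols can be glued into one function of \<xi>.\<close>

definition box_index :: "real^'n \<Rightarrow> int^'n" where
  "box_index \<xi> = (\<chi> i. \<lfloor>log 2 (\<bar>\<xi> $ i\<bar> / pi)\<rfloor>)"

lemma box_index_eq_iff:
  assumes "\<And>i. \<xi> $ i \<noteq> 0"
  shows "box_index \<xi> = j \<longleftrightarrow> (\<forall>i. 2 powi (j $ i) * pi \<le> \<bar>\<xi> $ i\<bar> \<and> \<bar>\<xi> $ i\<bar> < 2 powi (j $ i + 1) * pi)"
proof -
  have "\<lfloor>log 2 (\<bar>\<xi> $ i\<bar> / pi)\<rfloor> = k \<longleftrightarrow> 2 powi k * pi \<le> \<bar>\<xi> $ i\<bar> \<and> \<bar>\<xi> $ i\<bar> < 2 powi (k + 1) * pi" for i k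
  proof -
    have "\<lfloor>log 2 (\<bar>\<xi> $ i\<bar> / pi)\<rfloor> = k \<longleftrightarrow> 2 powr k \<le> \<bar>\<xi> $ i\<bar> / pi \<and> \<bar>\<xi> $ i\<bar> / pi < 2 powr (k + 1)"
      using assms[of i] by (intro floor_log_eq_powr_iff) auto
    then show ?thesis
      using powr_real_of_int'[of 2 k] powr_real_of_int'[of 2 "k + 1"] by (simp add: field_simps)
  qed
  then show ?thesis by (simp add: box_index_def vec_eq_iff)
qed

lemma mem_shannon_box_index: "(\<And>i. \<xi> $ i \<noteq> 0) \<Longrightarrow> \<xi> \<in> shannon_box (box_index \<xi>)"
  using box_index_eq_iff[of \<xi> "box_index \<xi>"] by (auto simp: shannon_box_def less_imp_le)

lemma box_index_measurable [measurable]: "box_index \<in> (lebesgue :: (real^'n) measure) \<rightarrow>\<^sub>M count_space UNIV"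
proof -
  have "box_index -` {j} \<inter> space lebesgue \<in> sets (lebesgue :: (real^'n) measure)" for j
  proof -
    have "box_index -` {j} \<inter> space lebesgue = {\<xi> \<in> space lebesgue. \<forall>i. \<lfloor>log 2 (\<bar>\<xi> $ i\<bar> / pi)\<rfloor> = j $ i}"
      by (auto simp: box_index_def vec_eq_iff)
    also have "\<dots> \<in> sets lebesgue" by measurable
    finally show ?thesis .
  qed
  then show ?thesis by (subst measurable_count_space_eq_countable) auto
qed

lemma AE_component_neq: "AE \<xi> in lebesgue. \<xi> $ i \<noteq> (c :: real)"
proof -
  have "negligible {x :: real^'a. x \<bullet> axis i 1 = c}" by (rule negligible_standard_hyperplane) auto
  then have "AE x in lebesgue. x \<notin> {x :: real^'a. x \<bullet> axis i 1 = c}"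
    by (intro AE_not_in) (simp add: negligible_iff_null_sets)
  then show ?thesis by (simp add: inner_axis)
qed

text \<open>Distinct closed boxes meet only where some \<open>\<bar>\<xi> $ i\<bar>\<close> is a
  dyadic multiple of pi; these are countably many hyperplanes, and the coordinate hyperplanes are
  discarded with them.\<close>

lemma AE_box_index:
  "AE \<xi> in lebesgue. (\<forall>i. \<xi> $ i \<noteq> 0) \<and> (\<forall>j. \<xi> \<in> shannon_box j \<longrightarrow> box_index \<xi> = j)"
proof -
  have "AE \<xi> in (lebesgue :: (real^'a) measure). \<forall>i. \<xi> $ i \<noteq> 0"
    by (subst AE_all_countable) (auto intro: AE_component_neq)
  moreover have "AE \<xi> in (lebesgue :: (real^'a) measure). \<forall>i. \<forall>k. \<xi> $ i \<noteq> 2 powi k * pi \<and> \<xi> $ i \<noteq> - (2 powi k * pi)"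
    by (subst AE_all_countable, rule, subst AE_all_countable, rule) (intro AE_conjI AE_component_neq)
  ultimately show ?thesis
  proof eventually_elim
    case (elim \<xi>)
    have "box_index \<xi> = j" if "\<xi> \<in> shannon_box j" for j
    proof (subst box_index_eq_iff)
      show "\<forall>i. 2 powi (j $ i) * pi \<le> \<bar>\<xi> $ i\<bar> \<and> \<bar>\<xi> $ i\<bar> < 2 powi (j $ i + 1) * pi"
      proof
        fix i
        have "2 powi (j $ i) * pi \<le> \<bar>\<xi> $ i\<bar>" "\<bar>\<xi> $ i\<bar> \<le> 2 powi (j $ i + 1) * pi"
          using that by (auto simp: shannon_box_def)
        moreover have "\<bar>\<xi> $ i\<bar> \<noteq> 2 powi (j $ i + 1) * pi"
          using elim(2)[rule_format, of i "j $ i + 1"] by (auto simp: abs_if)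
        ultimately show "2 powi (j $ i) * pi \<le> \<bar>\<xi> $ i\<bar> \<and> \<bar>\<xi> $ i\<bar> < 2 powi (j $ i + 1) * pi"
          by auto
      qed
    qed (use elim in auto)
    then show ?case using elim by auto
  qed
qed

text \<open>A bounded symbol applied to the transform of \<open>f\<close> is square integrable,
  hence the transform of some field, and this field witnesses the choice. The conclusion speaks of
  one index per frequency instead of one condition per box.\<close>

lemma shannon_multiplier:
  fixes m :: "real^'n \<Rightarrow> real^'n \<Rightarrow> real^'n^'n"
  assumes f: "f \<in> L2"
    and m: "\<And>\<omega> i k. (\<lambda>\<xi>. m \<omega> \<xi> $ i $ k) \<in> borel_measurable borel"
    and b: "\<forall>j. \<forall>\<xi>\<in>shannon_box j. \<forall>z. norm (map_matrix complex_of_real (m (scale j) \<xi>) *v z) \<le> C * norm z"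
  shows "shannon_multiplier m f \<in> L2"
    and "AE \<xi> in lebesgue. (\<forall>i. \<xi> $ i \<noteq> 0) \<and> \<xi> \<in> shannon_box (box_index \<xi>) \<and>
      fourier (shannon_multiplier m f) \<xi> = map_matrix complex_of_real (m (scale (box_index \<xi>)) \<xi>) *v fourier f \<xi>"
proof -
  let ?A = "\<lambda>j \<xi>. map_matrix complex_of_real (m (scale j) \<xi>) *v fourier f \<xi>"
  have mf [measurable]: "fourier f \<in> borel_measurable lebesgue"
    by (rule L2_measurable[OF fourier_in_L2[OF f]])
  have [measurable]: "(\<lambda>\<xi>. m \<omega> \<xi> $ i $ k) \<in> borel_measurable lebesgue" for \<omega> i k
    by (rule measurable_completion) (simp add: m)
  have A: "?A j \<in> borel_measurable lebesgue" for j
    unfolding matrix_vector_mult_def by (intro borel_measurable_vec_lambda) simp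
  \<comment> \<open>Each fixed index gives a measurable function; the index takes countably many
    values, so gluing preserves measurability.\<close>
  have mG: "(\<lambda>\<xi>. ?A (box_index \<xi>) \<xi>) \<in> borel_measurable lebesgue"
    by (rule measurable_compose_countable[OF A box_index_measurable])
  have "(\<lambda>\<xi>. ?A (box_index \<xi>) \<xi>) \<in> L2"
  proof (rule L2_mono(1)[OF mG fourier_in_L2[OF f]])
    show "AE \<xi> in lebesgue. norm (?A (box_index \<xi>) \<xi>) \<le> C * norm (fourier f \<xi>)"
      using AE_box_index by eventually_elim (intro b[rule_format] mem_shannon_box_index, auto)
  qed
  then obtain g where g: "g \<in> L2" "AE \<xi> in lebesgue. fourier g \<xi> = ?A (box_index \<xi>) \<xi>"
    by (rule fourier_surj)
  have "AE \<xi> in lebesgue. \<xi> \<in> shannon_box j \<longrightarrow> fourier g \<xi> = ?A j \<xi>" for j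
    using g(2) AE_box_index by eventually_elim auto
  then have "shannon_multiplier m f \<in> L2 \<and> (\<forall>j. AE \<xi> in lebesgue. \<xi> \<in> shannon_box j \<longrightarrow> fourier (shannon_multiplier m f) \<xi> = ?A j \<xi>)"
    unfolding shannon_multiplier_def
    by (intro someI[where P="\<lambda>g. g \<in> L2 \<and> (\<forall>j. AE \<xi> in lebesgue. \<xi> \<in> shannon_box j \<longrightarrow> fourier g \<xi> = ?A j \<xi>)"])
      (use g(1) in auto)
  then show "shannon_multiplier m f \<in> L2"
    and *: "AE \<xi> in lebesgue. (\<forall>i. \<xi> $ i \<noteq> 0) \<and> \<xi> \<in> shannon_box (box_index \<xi>) \<and>
      fourier (shannon_multiplier m f) \<xi> = ?A (box_index \<xi>) \<xi>"
  proof -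
    assume a: "shannon_multiplier m f \<in> L2 \<and> (\<forall>j. AE \<xi> in lebesgue. \<xi> \<in> shannon_box j \<longrightarrow> fourier (shannon_multiplier m f) \<xi> = ?A j \<xi>)"
    then show "shannon_multiplier m f \<in> L2" by simp
    \<comment> \<open>The definition provides one null set per box; countability of the indices
      merges them.\<close>
    have "AE \<xi> in lebesgue. \<forall>j. \<xi> \<in> shannon_box j \<longrightarrow> fourier (shannon_multiplier m f) \<xi> = ?A j \<xi>"
      by (subst AE_all_countable) (use a in auto)
    then show "AE \<xi> in lebesgue. (\<forall>i. \<xi> $ i \<noteq> 0) \<and> \<xi> \<in> shannon_box (box_index \<xi>) \<and>
      fourier (shannon_multiplier m f) \<xi> = ?A (box_index \<xi>) \<xi>"
      using AE_box_index by eventually_elim (auto intro: mem_shannon_box_index)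
  qed
qed

section \<open>The symbols\<close>

definition cdot :: "real^'n \<Rightarrow> complex^'n \<Rightarrow> complex" where
  "cdot a z = (\<Sum>i\<in>UNIV. complex_of_real (a $ i) * z $ i)"

text \<open>Together with \<open>cdot\<close> this writes rank-one maps without matrices:
  \<open>cvec a (cdot b z)\<close> is the product of the matrix \<open>outer a b\<close> with
  \<open>z\<close>.\<close>

definition cvec :: "real^'n \<Rightarrow> complex \<Rightarrow> complex^'n" where
  "cvec a t = (\<chi> i. complex_of_real (a $ i) * t)"

lemma cvec_nth [simp]: "cvec a t $ i = complex_of_real (a $ i) * t"
  by (simp add: cvec_def)

lemma cdot_diff: "cdot a (y - z) = cdot a y - cdot a z"
  and cdot_sum: "cdot a (\<Sum>p\<in>P. f p) = (\<Sum>p\<in>P. cdot a (f p))"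
  and cdot_0 [simp]: "cdot a 0 = 0"
proof -
  show "cdot a (y - z) = cdot a y - cdot a z"
    by (simp add: cdot_def right_diff_distrib sum_subtractf)
  show "cdot a (\<Sum>p\<in>P. f p) = (\<Sum>p\<in>P. cdot a (f p))"
    unfolding cdot_def by (subst sum.swap) (simp add: sum_distrib_left)
  show "cdot a 0 = 0" by (simp add: cdot_def)
qed

lemma cvec_diff: "cvec a (s - t) = cvec a s - cvec a t"
  and cvec_scaleR: "cvec (c *\<^sub>R a) t = cvec a (complex_of_real c * t)"
  and cdot_scaleR: "cdot (c *\<^sub>R a) z = complex_of_real c * cdot a z"
  by (simp_all add: vec_eq_iff algebra_simps cdot_def sum_distrib_left)

lemma cdot_cvec: "cdot a (cvec b t) = complex_of_real (a \<bullet> b) * t"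
  by (simp add: cdot_def inner_vec_def sum_distrib_right mult.assoc)

lemma norm_real_vec_sq: "(norm (a :: real^'n))\<^sup>2 = (\<Sum>i\<in>UNIV. (a $ i)\<^sup>2)"
  unfolding power2_norm_eq_inner by (simp add: inner_vec_def power2_eq_square)

lemma norm_cvec: "norm (cvec a t) = norm a * cmod t"
proof -
  have "(norm (cvec a t))\<^sup>2 = (norm a * cmod t)\<^sup>2"
    unfolding norm_vec_sq power_mult_distrib norm_real_vec_sq
    by (simp add: norm_mult power_mult_distrib sum_distrib_right)
  then show ?thesis by (rule power2_eq_imp_eq) auto
qed

lemma norm_cdot_le: "cmod (cdot a z) \<le> norm a * norm z"
proof -
  have "cmod (cdot a z) \<le> (\<Sum>i\<in>UNIV. \<bar>a $ i\<bar> * \<bar>cmod (z $ i)\<bar>)"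
    unfolding cdot_def by (intro order_trans[OF norm_sum]) (simp add: norm_mult)
  also have "\<dots> \<le> L2_set (\<lambda>i. a $ i) UNIV * L2_set (\<lambda>i. cmod (z $ i)) UNIV"
    by (rule L2_set_mult_ineq)
  also have "\<dots> = norm a * norm z" by (simp add: norm_vec_def L2_set_def)
  finally show ?thesis .
qed

lemma map_matrix_vector_simps:
  fixes A B :: "real^'n^'n"
  shows "map_matrix complex_of_real (A ** B) *v z = map_matrix complex_of_real A *v (map_matrix complex_of_real B *v z)"
    and "map_matrix complex_of_real (mat 1 - A) *v z = z - map_matrix complex_of_real A *v z"
    and "map_matrix complex_of_real (c *\<^sub>R outer a b) *v z = cvec (c *\<^sub>R a) (cdot b z)"
proof -
  show "map_matrix complex_of_real (A ** B) *v z = map_matrix complex_of_real A *v (map_matrix complex_of_real B *v z)"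
    unfolding matrix_vector_mul_assoc
    by (intro arg_cong[where f="\<lambda>A. A *v z"]) (simp add: vec_eq_iff matrix_matrix_mult_def)
  show "map_matrix complex_of_real (mat 1 - A) *v z = z - map_matrix complex_of_real A *v z"
  proof -
    have "map_matrix complex_of_real (mat 1 - A) = mat 1 - map_matrix complex_of_real A"
      by (simp add: vec_eq_iff mat_def)
    then show ?thesis by (simp add: matrix_vector_mult_diff_rdistrib)
  qed
  show "map_matrix complex_of_real (c *\<^sub>R outer a b) *v z = cvec (c *\<^sub>R a) (cdot b z)"
    by (simp add: vec_eq_iff matrix_vector_mult_def outer_def cdot_def sum_distrib_left mult_ac)
qed

definition dual_vec :: "real^'n \<Rightarrow> real^'n \<Rightarrow> real^'n" where
  "dual_vec \<omega> \<xi> = (1 / (norm \<omega>)\<^sup>2) *\<^sub>R w_vec \<omega> \<xi>"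

lemma L_symbol_apply: "map_matrix complex_of_real (L_symbol \<omega> \<xi>) *v z = cvec \<xi> (cdot (dual_vec \<omega> \<xi>) z)"
  by (simp add: L_symbol_def map_matrix_vector_simps dual_vec_def cvec_scaleR cdot_scaleR)

lemma M_symbol_apply:
  defines "y \<omega> \<xi> z \<equiv> z - cvec \<xi> (cdot (dual_vec \<omega> \<xi>) z)"
  shows "map_matrix complex_of_real (M_symbol \<omega> \<xi>) *v z
    = y \<omega> \<xi> z - cvec (dual_vec \<omega> \<xi>) (cdot \<xi> (y \<omega> \<xi> z))"
  by (simp add: M_symbol_def map_matrix_vector_simps dual_vec_def cvec_scaleR cdot_scaleR y_def)

text \<open>Subtracting the image under L leaves the intermediate vector inside M, so only the
  correction of M along \<open>dual_vec\<close> survives.\<close>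

lemma residual_symbol_apply:
  "z - map_matrix complex_of_real (M_symbol \<omega> \<xi>) *v z - map_matrix complex_of_real (L_symbol \<omega> \<xi>) *v z
    = cvec (dual_vec \<omega> \<xi>) (cdot \<xi> z - complex_of_real ((norm \<xi>)\<^sup>2) * cdot (dual_vec \<omega> \<xi>) z)"
  unfolding M_symbol_apply L_symbol_apply
  by (simp add: cdot_diff cdot_cvec power2_norm_eq_inner)

text \<open>Here \<open>X\<close> and \<open>Y\<close> are the squared norms of \<xi> and
  \<open>w\<close>. The upper bound is the Kantorovich argument, linear in each coordinate and
  closed by the arithmetic-geometric mean; the lower bound is Cauchy-Schwarz. With the product in
  \<open>[1, 25/16]\<close>, its distance from 1 is at most \<open>9/16\<close>.\<close>

lemma shannon_box_dual_vec:
  assumes \<xi>: "\<xi> \<in> shannon_box j"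
  defines "b \<equiv> dual_vec (scale j) \<xi>"
  shows "\<xi> \<bullet> b = 1" and "norm \<xi> * norm b \<le> 5 / 4" and "\<bar>1 - (norm \<xi> * norm b)\<^sup>2\<bar> \<le> 9 / 16"
proof -
  define \<omega> where "\<omega> = scale j"
  define W where "W = (norm \<omega>)\<^sup>2"
  have \<omega>0: "0 < \<omega> $ i" for i by (simp add: \<omega>_def scale_def)
  have \<omega>\<xi>: "\<omega> $ i * pi \<le> \<bar>\<xi> $ i\<bar>" "\<bar>\<xi> $ i\<bar> \<le> 2 * (\<omega> $ i * pi)" for i
    using \<xi> by (auto simp: shannon_box_def \<omega>_def scale_def power_int_add mult_ac)
  have \<xi>0: "\<xi> $ i \<noteq> 0" for i using \<omega>\<xi>(1)[of i] mult_pos_pos[OF \<omega>0[of i] pi_gt_zero] by auto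
  have W: "W = (\<Sum>i\<in>UNIV. (\<omega> $ i)\<^sup>2)"
    by (simp add: W_def norm_real_vec_sq)
  have "0 < (\<omega> $ i)\<^sup>2" for i using \<omega>0[of i] by simp
  then have W0: "0 < W" unfolding W by (intro sum_pos) auto
  define X where "X = (norm \<xi>)\<^sup>2"
  define Y where "Y = (norm (w_vec \<omega> \<xi>))\<^sup>2"
  have X: "X = (\<Sum>i\<in>UNIV. (\<xi> $ i)\<^sup>2)"
    by (simp add: X_def norm_real_vec_sq)
  have Y: "Y = (\<Sum>i\<in>UNIV. ((\<omega> $ i)\<^sup>2 / \<xi> $ i)\<^sup>2)"
    by (simp add: Y_def norm_real_vec_sq w_vec_def)
  show 1: "\<xi> \<bullet> b = 1"
    unfolding b_def \<omega>_def[symmetric] dual_vec_def using W0 \<xi>0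
    by (simp add: inner_vec_def w_vec_def W_def[symmetric] sum_divide_distrib[symmetric]) (simp add: W)
  \<comment> \<open>The weight balances the two extremes: with
    \<open>a = (\<omega> $ i * pi)\<^sup>2\<close> the weighted terms are \<open>t\<close> and
    \<open>4 * a\<^sup>2 / t\<close>, which trade places when \<open>t\<close> runs from
    \<open>a\<close> to \<open>4 * a\<close>.\<close>
  have "X + 4 * pi^4 * Y = (\<Sum>i\<in>UNIV. (\<xi> $ i)\<^sup>2 + 4 * pi^4 * ((\<omega> $ i)\<^sup>2 / \<xi> $ i)\<^sup>2)"
    by (simp add: X Y sum.distrib sum_distrib_left)
  also have "\<dots> \<le> (\<Sum>i\<in>UNIV. 5 * pi\<^sup>2 * (\<omega> $ i)\<^sup>2)"
  proof (rule sum_mono)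
    fix i
    define a where "a = (\<omega> $ i * pi)\<^sup>2"
    define t where "t = (\<xi> $ i)\<^sup>2"
    have t: "a \<le> t" "t \<le> 4 * a"
      using \<omega>\<xi>[of i] \<omega>0[of i] power_mono[OF \<omega>\<xi>(1)[of i], of 2] power_mono[OF \<omega>\<xi>(2)[of i], of 2]
      by (auto simp: a_def t_def power_mult_distrib)
    have t0: "0 < t" using \<xi>0 by (simp add: t_def)
    \<comment> \<open>Both factors are nonnegative because \<open>t\<close> lies between its extreme
      values; dividing the expanded product by \<open>t\<close> gives the linear estimate.\<close>
    have "0 \<le> (t - a) * (4 * a - t)" using t by (intro mult_nonneg_nonneg) auto
    then have "t * t + 4 * a\<^sup>2 \<le> 5 * a * t" by (simp add: algebra_simps power2_eq_square)
    then have "(t * t + 4 * a\<^sup>2) / t \<le> 5 * a * t / t" using t0 by (intro divide_right_mono) auto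
    then have "t + 4 * a\<^sup>2 / t \<le> 5 * a" using t0 by (simp add: add_divide_distrib)
    moreover have "4 * pi^4 * ((\<omega> $ i)\<^sup>2 / \<xi> $ i)\<^sup>2 = 4 * a\<^sup>2 / t"
      by (simp add: a_def t_def power_mult_distrib power_divide)
    ultimately show "(\<xi> $ i)\<^sup>2 + 4 * pi^4 * ((\<omega> $ i)\<^sup>2 / \<xi> $ i)\<^sup>2 \<le> 5 * pi\<^sup>2 * (\<omega> $ i)\<^sup>2"
      by (simp add: a_def t_def power_mult_distrib mult_ac)
  qed
  also have "\<dots> = 5 * pi\<^sup>2 * W" by (simp add: W sum_distrib_left)
  finally have K: "X + 4 * pi^4 * Y \<le> 5 * pi\<^sup>2 * W" .
  have XY0: "0 \<le> X" "0 \<le> Y" by (simp_all add: X_def Y_def)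
  \<comment> \<open>Arithmetic-geometric mean: a bound on the weighted sum becomes a bound on the
    product, and the powers of pi cancel.\<close>
  have "4 * X * (4 * pi^4 * Y) \<le> (X + 4 * pi^4 * Y)\<^sup>2"
    using sum_squares_bound[of X "4 * pi^4 * Y"] unfolding power2_sum by linarith
  also have "\<dots> \<le> (5 * pi\<^sup>2 * W)\<^sup>2" using K XY0 by (intro power_mono) auto
  finally have "16 * pi^4 * (X * Y) \<le> 16 * pi^4 * (25 / 16 * W\<^sup>2)"
    by (simp add: power_mult_distrib mult_ac)
  then have XY: "X * Y \<le> 25 / 16 * W\<^sup>2" by (subst (asm) mult_le_cancel_left_pos) auto
  have nb: "(norm \<xi> * norm b)\<^sup>2 = X * Y / W\<^sup>2"
    using W0 by (simp add: b_def \<omega>_def[symmetric] dual_vec_def W_def[symmetric] X_def Y_def power_mult_distrib power_divide)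
  have ub: "(norm \<xi> * norm b)\<^sup>2 \<le> 25 / 16"
    unfolding nb using XY W0 by (simp add: pos_divide_le_eq)
  then have "(norm \<xi> * norm b)\<^sup>2 \<le> (5 / 4)\<^sup>2" by (simp add: power_divide)
  then show "norm \<xi> * norm b \<le> 5 / 4" by (rule power2_le_imp_le) simp
  have "1 \<le> norm \<xi> * norm b" using Cauchy_Schwarz_ineq2[of \<xi> b] 1 by simp
  then have "1 \<le> (norm \<xi> * norm b)\<^sup>2" by (rule one_le_power)
  with ub show "\<bar>1 - (norm \<xi> * norm b)\<^sup>2\<bar> \<le> 9 / 16" by (simp add: abs_if)
qed

lemma L_symbol_bound:
  assumes "\<xi> \<in> shannon_box j"
  shows "norm (map_matrix complex_of_real (L_symbol (scale j) \<xi>) *v z) \<le> 5 / 4 * norm z"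
proof -
  have "norm (map_matrix complex_of_real (L_symbol (scale j) \<xi>) *v z) \<le> norm \<xi> * (norm (dual_vec (scale j) \<xi>) * norm z)"
    unfolding L_symbol_apply norm_cvec by (intro mult_left_mono norm_cdot_le) simp
  also have "\<dots> = norm \<xi> * norm (dual_vec (scale j) \<xi>) * norm z" by simp
  also have "\<dots> \<le> 5 / 4 * norm z"
    by (intro mult_right_mono shannon_box_dual_vec(2) assms) simp
  finally show ?thesis .
qed

text \<open>Each of the two factors of M has norm at most \<open>1 + 5/4\<close>, and
  \<open>(9/4)\<^sup>2 = 81/16\<close> is below 6.\<close>

lemma M_symbol_bound:
  assumes "\<xi> \<in> shannon_box j"
  shows "norm (map_matrix complex_of_real (M_symbol (scale j) \<xi>) *v z) \<le> 6 * norm z"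
proof -
  define b where "b = dual_vec (scale j) \<xi>"
  define y where "y = z - cvec \<xi> (cdot b z)"
  have y: "norm y \<le> 9 / 4 * norm z"
    using norm_triangle_ineq4[of z "cvec \<xi> (cdot b z)"] L_symbol_bound[OF assms, of z]
    by (simp add: y_def b_def L_symbol_apply)
  have "norm (cvec b (cdot \<xi> y)) \<le> norm b * (norm \<xi> * norm y)"
    unfolding norm_cvec by (intro mult_left_mono norm_cdot_le) simp
  also have "\<dots> = norm \<xi> * norm b * norm y" by simp
  also have "\<dots> \<le> 5 / 4 * norm y"
    unfolding b_def by (intro mult_right_mono shannon_box_dual_vec(2) assms) simp
  finally have "norm (y - cvec b (cdot \<xi> y)) \<le> 9 / 4 * norm y"
    using norm_triangle_ineq4[of y "cvec b (cdot \<xi> y)"] by simp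
  also have "\<dots> \<le> 6 * norm z" using y norm_ge_zero[of z] by linarith
  finally show ?thesis by (simp add: M_symbol_apply y_def b_def)
qed

lemma vec_nth_borel_measurable [measurable]: "(\<lambda>x::real^'n. x $ i) \<in> borel_measurable borel"
  by (rule borel_measurable_vec_nth) simp

lemma symbols_measurable:
  "(\<lambda>\<xi>. L_symbol \<omega> \<xi> $ i $ k) \<in> borel_measurable borel"
  "(\<lambda>\<xi>. M_symbol \<omega> \<xi> $ i $ k) \<in> borel_measurable borel"
  unfolding L_symbol_def M_symbol_def outer_def w_vec_def matrix_matrix_mult_def mat_def
  by simp_all

lemma L_op:
  assumes "f \<in> L2"
  shows "L_op f \<in> L2"
    and "AE \<xi> in lebesgue. fourier (L_op f) \<xi> = cvec \<xi> (cdot (dual_vec (scale (box_index \<xi>)) \<xi>) (fourier f \<xi>))"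
proof -
  have b: "\<forall>j. \<forall>\<xi>\<in>shannon_box j. \<forall>z. norm (map_matrix complex_of_real (L_symbol (scale j) \<xi>) *v z) \<le> 5 / 4 * norm z"
    using L_symbol_bound by blast
  note * = shannon_multiplier[where m=L_symbol, OF assms symbols_measurable(1) b]
  show "L_op f \<in> L2" unfolding L_op_def by (rule *)
  show "AE \<xi> in lebesgue. fourier (L_op f) \<xi> = cvec \<xi> (cdot (dual_vec (scale (box_index \<xi>)) \<xi>) (fourier f \<xi>))"
    using *(2) by eventually_elim (simp add: L_op_def L_symbol_apply)
qed

text \<open>Since \<open>\<xi> \<bullet> b = 1\<close> on a box, the correction along
  \<open>b\<close> cancels exactly the product with \<xi>, so the images are divergence free in
  frequency.\<close>

lemma M_op:
  assumes "f \<in> L2"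
  shows "M_op f \<in> L2"
    and "AE \<xi> in lebesgue. cdot \<xi> (fourier (M_op f) \<xi>) = 0"
    and "AE \<xi> in lebesgue. fourier f \<xi> - fourier (M_op f) \<xi> - fourier (L_op f) \<xi>
      = cvec (dual_vec (scale (box_index \<xi>)) \<xi>)
          (cdot \<xi> (fourier f \<xi>) - complex_of_real ((norm \<xi>)\<^sup>2) * cdot (dual_vec (scale (box_index \<xi>)) \<xi>) (fourier f \<xi>))"
proof -
  have b: "\<forall>j. \<forall>\<xi>\<in>shannon_box j. \<forall>z. norm (map_matrix complex_of_real (M_symbol (scale j) \<xi>) *v z) \<le> 6 * norm z"
    using M_symbol_bound by blast
  note * = shannon_multiplier[where m=M_symbol, OF assms symbols_measurable(2) b]
  show "M_op f \<in> L2" unfolding M_op_def by (rule *)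
  show "AE \<xi> in lebesgue. cdot \<xi> (fourier (M_op f) \<xi>) = 0"
    using *(2) by eventually_elim
      (simp add: M_op_def M_symbol_apply cdot_diff cdot_cvec shannon_box_dual_vec(1))
  show "AE \<xi> in lebesgue. fourier f \<xi> - fourier (M_op f) \<xi> - fourier (L_op f) \<xi>
      = cvec (dual_vec (scale (box_index \<xi>)) \<xi>)
          (cdot \<xi> (fourier f \<xi>) - complex_of_real ((norm \<xi>)\<^sup>2) * cdot (dual_vec (scale (box_index \<xi>)) \<xi>) (fourier f \<xi>))"
    using *(2) L_op(2)[OF assms]
    by eventually_elim (simp only: M_op_def residual_symbol_apply[symmetric] L_symbol_apply)
qed

section \<open>Convergence of the iteration\<close>

text \<open>The symbol of the Leray projector; at \<xi> = 0 it is the identity, and the image is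
  still annihilated by \<open>cdot \<xi>\<close> there.\<close>

definition leray :: "real^'n \<Rightarrow> complex^'n \<Rightarrow> complex^'n" where
  "leray \<xi> z = z - cvec \<xi> (cdot \<xi> z / complex_of_real ((norm \<xi>)\<^sup>2))"

lemma cdot_leray: "cdot \<xi> (leray \<xi> z) = 0"
proof (cases "\<xi> = 0")
  case True
  then show ?thesis by (simp add: cdot_def)
next
  case False
  then show ?thesis by (simp add: leray_def cdot_diff cdot_cvec power2_norm_eq_inner)
qed

text \<open>The real inner product on complex vectors is the real part of the hermitian one, so a
  complex multiple of \<xi> is orthogonal to \<open>e\<close> and subtracting \<open>e\<close> from
  it cannot give anything shorter than \<open>e\<close>.\<close>

lemma norm_pythagoras_le:
  assumes "cdot \<xi> e = 0"
  shows "norm e \<le> norm (cvec \<xi> t - e)"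
proof -
  have "(norm (cvec \<xi> t - e))\<^sup>2 = (norm (cvec \<xi> t))\<^sup>2 + (norm e)\<^sup>2 - 2 * (cvec \<xi> t \<bullet> e)"
    by (simp add: power2_norm_eq_inner inner_diff_left inner_diff_right inner_commute)
  moreover have "cvec \<xi> t \<bullet> e = Re (cnj t * cdot \<xi> e)"
    by (simp add: inner_vec_def cdot_def inner_complex_def sum_distrib_left algebra_simps sum.distrib sum_subtractf)
  ultimately have "(norm e)\<^sup>2 \<le> (norm (cvec \<xi> t - e))\<^sup>2" using assms by simp
  then show ?thesis by (rule power2_le_imp_le) simp
qed

lemma leray_L2:
  assumes f: "f \<in> L2"
  shows "(\<lambda>\<xi>. leray \<xi> (fourier f \<xi>)) \<in> L2"
proof (rule L2_mono(1)[OF _ fourier_in_L2[OF f], where C=1])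
  note [measurable] = L2_measurable[OF fourier_in_L2[OF f]]
  show "(\<lambda>\<xi>. leray \<xi> (fourier f \<xi>)) \<in> borel_measurable lebesgue"
    unfolding leray_def cvec_def cdot_def
    by (intro borel_measurable_diff borel_measurable_vec_lambda) measurable
  have "norm (leray \<xi> z) \<le> norm z" for \<xi> :: "real^'a" and z
  proof -
    have "cvec \<xi> (- (cdot \<xi> z / complex_of_real ((norm \<xi>)\<^sup>2))) - leray \<xi> z = - z"
      by (simp add: leray_def vec_eq_iff)
    then show ?thesis using norm_pythagoras_le[OF cdot_leray] by (metis norm_minus_cancel)
  qed
  then show "AE \<xi> in lebesgue. norm (leray \<xi> (fourier f \<xi>)) \<le> 1 * norm (fourier f \<xi>)" by simp
qed

text \<open>Plancherel puts the same constant on both sides, so a pointwise bound between transforms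
  becomes a bound between fields.\<close>

lemma sqn_le_fourier:
  fixes f :: "real^'n \<Rightarrow> complex^'n"
  assumes f: "f \<in> L2" and g: "g \<in> L2"
    and le: "AE \<xi> in lebesgue. norm (fourier f \<xi>) \<le> C * norm (fourier g \<xi>)"
  shows "sqn f \<le> C\<^sup>2 * sqn g"
proof -
  have "(2 * pi) ^ CARD('n) * sqn f \<le> (2 * pi) ^ CARD('n) * (C\<^sup>2 * sqn g)"
    using L2_mono(2)[OF L2_measurable[OF fourier_in_L2[OF f]] fourier_in_L2[OF g] le]
    by (simp add: sqn_fourier f g mult_ac)
  then show ?thesis by (subst (asm) mult_le_cancel_left_pos) auto
qed

text \<open>\<open>d\<close> is any field whose transform is the Leray projection of that of
  \<open>u\<close>; the passage to the chosen representatives \<open>div_part\<close> and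
  \<open>curl_part\<close> is kept separate.\<close>

lemma iteration_convergence:
  fixes u :: "real^'n \<Rightarrow> complex^'n"
  assumes u: "u \<in> L2" and v0: "v 0 = u"
    and vS: "\<And>p. v (Suc p) = (\<lambda>x. v p x - M_op (v p) x - L_op (v p) x)"
    and d: "d \<in> L2" "AE \<xi> in lebesgue. fourier d \<xi> = leray \<xi> (fourier u \<xi>)"
  shows "L2_tendsto v (\<lambda>x. 0) sequentially"
    and "L2_sums (\<lambda>p. M_op (v p)) d" and "L2_sums (\<lambda>p. L_op (v p)) (\<lambda>x. u x - d x)"
proof -
  define b where "b \<xi> = dual_vec (scale (box_index \<xi>)) \<xi>" for \<xi> :: "real^'n"
  have v: "v p \<in> L2" for p
    by (induction p) (simp_all add: v0 u vS L2_diff M_op L_op)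
  define r where "r z \<xi> = cvec (b \<xi>) (cdot \<xi> z - complex_of_real ((norm \<xi>)\<^sup>2) * cdot (b \<xi>) z)" for z \<xi>
  have F: "AE \<xi> in lebesgue. fourier (v (Suc p)) \<xi> = r (fourier (v p) \<xi>) \<xi>" for p
    using fourier_diff[OF L2_diff(1)[OF v[of p] M_op(1)[OF v[of p]]] L_op(1)[OF v[of p]]]
      fourier_diff[OF v[of p] M_op(1)[OF v[of p]]] M_op(3)[OF v[of p]]
    by eventually_elim (simp add: vS r_def b_def)
  \<comment> \<open>The estimate begins at \<open>v 1\<close>: from there on the transform is a
    multiple of \<open>b\<close>, an eigenvector of the residual symbol.\<close>
  have contr: "sqn (v (Suc (Suc p))) \<le> (9/16)\<^sup>2 * sqn (v (Suc p))" for p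
  proof (rule sqn_le_fourier[OF v v])
    show "AE \<xi> in lebesgue. norm (fourier (v (Suc (Suc p))) \<xi>) \<le> 9 / 16 * norm (fourier (v (Suc p)) \<xi>)"
      using F[of p] F[of "Suc p"] AE_box_index
    proof eventually_elim
      case (elim \<xi>)
      define t where "t = cdot \<xi> (fourier (v p) \<xi>) - complex_of_real ((norm \<xi>)\<^sup>2) * cdot (b \<xi>) (fourier (v p) \<xi>)"
      have box: "\<xi> \<in> shannon_box (box_index \<xi>)" using elim mem_shannon_box_index by blast
      have 1: "fourier (v (Suc p)) \<xi> = cvec (b \<xi>) t" using elim(1) by (simp add: r_def t_def)
      \<comment> \<open>On multiples of \<open>b\<close> the first term is \<open>t\<close> itself
        because \<open>\<xi> \<bullet> b = 1\<close>.\<close>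
      have "cdot \<xi> (cvec (b \<xi>) t) - complex_of_real ((norm \<xi>)\<^sup>2) * cdot (b \<xi>) (cvec (b \<xi>) t)
          = complex_of_real (1 - (norm \<xi> * norm (b \<xi>))\<^sup>2) * t"
        using shannon_box_dual_vec(1)[OF box]
        by (simp add: cdot_cvec b_def power_mult_distrib power2_norm_eq_inner[symmetric] left_diff_distrib)
      then have "norm (fourier (v (Suc (Suc p))) \<xi>) = \<bar>1 - (norm \<xi> * norm (b \<xi>))\<^sup>2\<bar> * norm (fourier (v (Suc p)) \<xi>)"
        unfolding elim(2) 1 r_def norm_cvec by (simp add: norm_mult del: of_real_diff of_real_mult of_real_power)
      also have "\<dots> \<le> 9 / 16 * norm (fourier (v (Suc p)) \<xi>)"
        using shannon_box_dual_vec(3)[OF box] by (intro mult_right_mono) (auto simp: b_def)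
      finally show ?case .
    qed
  qed
  have geo: "sqn (v (Suc p)) \<le> ((9/16)\<^sup>2) ^ p * sqn (v 1)" for p
  proof (induction p)
    case (Suc p)
    have "sqn (v (Suc (Suc p))) \<le> (9/16)\<^sup>2 * sqn (v (Suc p))" by (rule contr)
    also have "\<dots> \<le> (9/16)\<^sup>2 * (((9/16)\<^sup>2) ^ p * sqn (v 1))" by (rule mult_left_mono[OF Suc]) simp
    finally show ?case by simp
  qed simp
  have "(\<lambda>p. ((9/16)\<^sup>2 :: real) ^ p) \<longlonglongrightarrow> 0"
    by (rule LIMSEQ_realpow_zero) (simp_all add: power2_eq_square)
  from tendsto_mult[OF this tendsto_const[of "sqn (v 1)"]]
  have lim: "(\<lambda>p. ((9/16)\<^sup>2) ^ p * sqn (v 1)) \<longlonglongrightarrow> 0" by (simp only: mult_zero_left)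
  have "(\<lambda>p. sqn (v (Suc p))) \<longlonglongrightarrow> 0"
    by (rule tendsto_sandwich[OF _ _ tendsto_const lim]) (rule always_eventually, rule allI, rule sqn_nonneg geo)+
  then have v_lim: "(\<lambda>p. sqn (v p)) \<longlonglongrightarrow> 0" by (rule LIMSEQ_imp_Suc)
  show "L2_tendsto v (\<lambda>x. 0) sequentially"
    using v v_lim by (simp add: L2_tendsto_sqn)
  define S where "S N x = (\<Sum>p<N. M_op (v p) x)" for N x
  define T where "T N x = (\<Sum>p<N. L_op (v p) x)" for N x
  have S: "S N \<in> L2" and T: "T N \<in> L2" for N
    unfolding S_def[abs_def] T_def[abs_def] using M_op(1)[OF v] L_op(1)[OF v] by (auto intro: L2_sum)
  have tel: "S N x + T N x + v N x = u x" for N x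
    by (induction N) (simp_all add: S_def T_def v0 vS algebra_simps)
  \<comment> \<open>Up to a multiple of \<xi>, the transform of \<open>v N\<close> is minus that of
    \<open>S N - d\<close>, which is orthogonal to \<xi>; Pythagoras then gives the constant
    1.\<close>
  have SD: "sqn (\<lambda>x. S N x - d x) \<le> 1\<^sup>2 * sqn (v N)" for N
  proof (rule sqn_le_fourier[OF L2_diff(1)[OF S d(1)] v])
    have u_eq: "(\<lambda>x. S N x + T N x + v N x) = u" using tel by auto
    have "AE \<xi> in lebesgue. \<forall>p. cdot \<xi> (fourier (M_op (v p)) \<xi>) = 0"
      by (subst AE_all_countable) (auto intro: M_op(2)[OF v])
    moreover have "AE \<xi> in lebesgue. \<forall>p. fourier (L_op (v p)) \<xi> = cvec \<xi> (cdot (b \<xi>) (fourier (v p) \<xi>))"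
      by (subst AE_all_countable) (auto intro: L_op(2)[OF v] simp: b_def)
    ultimately show "AE \<xi> in lebesgue. norm (fourier (\<lambda>x. S N x - d x) \<xi>) \<le> 1 * norm (fourier (v N) \<xi>)"
      using fourier_sum[of "\<lambda>p. M_op (v p)" N, OF M_op(1)[OF v]]
        fourier_sum[of "\<lambda>p. L_op (v p)" N, OF L_op(1)[OF v]]
        fourier_diff[OF S[of N] d(1)] fourier_add[OF L2_add(1)[OF S[of N] T[of N]] v[of N]]
        fourier_add[OF S[of N] T[of N]] d(2)
    proof eventually_elim
      case (elim \<xi>)
      let ?e = "fourier (\<lambda>x. S N x - d x) \<xi>"
      let ?t = "\<Sum>p<N. cdot (b \<xi>) (fourier (v p) \<xi>)"
      have fS: "fourier (S N) \<xi> = (\<Sum>p<N. fourier (M_op (v p)) \<xi>)" using elim(3) by (simp add: S_def[abs_def])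
      have fT: "fourier (T N) \<xi> = cvec \<xi> ?t"
        using elim(4) elim(2) by (simp add: T_def[abs_def] vec_eq_iff sum_distrib_left)
      have e0: "cdot \<xi> ?e = 0"
        unfolding elim(5) elim(8) fS cdot_diff cdot_leray cdot_sum using elim(1) by simp
      have "fourier (v N) \<xi> = fourier u \<xi> - fourier (S N) \<xi> - fourier (T N) \<xi>"
        using elim(6,7) unfolding u_eq by simp
      also have "\<dots> = cvec \<xi> (cdot \<xi> (fourier u \<xi>) / complex_of_real ((norm \<xi>)\<^sup>2) - ?t) - ?e"
        unfolding elim(5) elim(8) fT by (simp add: leray_def cvec_diff)
      finally show ?case using norm_pythagoras_le[OF e0] by simp
    qed
  qed
  have "(\<lambda>N. sqn (\<lambda>x. S N x - d x)) \<longlonglongrightarrow> 0"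
    by (rule tendsto_sandwich[OF _ _ tendsto_const v_lim]) (use SD in auto)
  then have Sd: "L2_tendsto S d sequentially" using S d by (simp add: L2_tendsto_sqn)
  then show "L2_sums (\<lambda>p. M_op (v p)) d" by (simp add: L2_sums_def S_def[abs_def])
  \<comment> \<open>By telescoping, the error of \<open>T N\<close> is minus the sum of the error of
    \<open>S N\<close> and \<open>v N\<close>.\<close>
  have TD: "sqn (\<lambda>x. T N x - (u x - d x)) \<le> 2 * sqn (\<lambda>x. S N x - d x) + 2 * sqn (v N)" for N
  proof -
    have "sqn (\<lambda>x. T N x - (u x - d x)) = sqn (\<lambda>x. - ((S N x - d x) + v N x))"
      by (intro arg_cong[where f=sqn] ext) (simp add: tel[symmetric, of _ N])
    also have "\<dots> \<le> 2 * sqn (\<lambda>x. S N x - d x) + 2 * sqn (v N)"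
      unfolding sqn_uminus by (intro L2_add L2_diff S d v)
    finally show ?thesis .
  qed
  have "(\<lambda>N. 2 * sqn (\<lambda>x. S N x - d x) + 2 * sqn (v N)) \<longlonglongrightarrow> 2 * 0 + 2 * 0"
    using Sd v_lim by (intro tendsto_intros) (auto simp: L2_tendsto_sqn)
  then have lim: "(\<lambda>N. 2 * sqn (\<lambda>x. S N x - d x) + 2 * sqn (v N)) \<longlonglongrightarrow> 0" by simp
  have "(\<lambda>N. sqn (\<lambda>x. T N x - (u x - d x))) \<longlonglongrightarrow> 0"
    by (rule tendsto_sandwich[OF _ _ tendsto_const lim]) (rule always_eventually, rule allI, rule sqn_nonneg TD)+
  then have "L2_tendsto T (\<lambda>x. u x - d x) sequentially"
    using T L2_diff(1)[OF u d(1)] by (simp add: L2_tendsto_sqn)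
  then show "L2_sums (\<lambda>p. L_op (v p)) (\<lambda>x. u x - d x)" by (simp add: L2_sums_def T_def[abs_def])
qed

section \<open>Test functions\<close>

lemma continuous_compact_support:
  fixes f :: "'a::euclidean_space \<Rightarrow> complex"
  assumes c: "continuous_on UNIV f" and K: "compact (closure {x. f x \<noteq> 0})"
  shows "f \<in> borel_measurable borel" and "\<exists>C. \<forall>x. cmod (f x) \<le> C"
    and "integrable lebesgue f" and "f \<in> L2"
proof -
  show m: "f \<in> borel_measurable borel" by (rule borel_measurable_continuous_onI[OF c])
  have [measurable]: "f \<in> borel_measurable lebesgue" by (rule measurable_completion) (simp add: m)
  let ?K = "closure {x. f x \<noteq> 0}"
  have f0: "f x = 0" if "x \<notin> ?K" for x using that closure_subset[of "{x. f x \<noteq> 0}"] by blast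
  have "bounded (f ` ?K)"
    by (intro compact_imp_bounded compact_continuous_image K continuous_on_subset[OF c]) simp
  then obtain C where C: "\<And>x. x \<in> ?K \<Longrightarrow> cmod (f x) \<le> C" by (auto simp: bounded_iff)
  have C': "cmod (f x) \<le> \<bar>C\<bar> * indicator ?K x" for x
    using C[of x] f0[of x] by (auto split: split_indicator)
  then have "cmod (f x) \<le> \<bar>C\<bar>" for x
    by (rule order_trans) (auto split: split_indicator)
  then show "\<exists>C. \<forall>x. cmod (f x) \<le> C" by blast
  have Km: "?K \<in> lmeasurable" by (rule lmeasurable_compact[OF K])
  have i: "integrable lebesgue (indicat_real ?K)" using Km by (simp add: lmeasurable_iff_integrable)
  show "integrable lebesgue f"
    by (rule Bochner_Integration.integrable_bound[of _ "\<lambda>x. \<bar>C\<bar> * indicator ?K x"])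
      (use i C' in \<open>auto simp: abs_mult\<close>)
  show "f \<in> L2"
  proof (rule L2_mono(1)[OF _ indicator_L2(2)[OF Km], where C="\<bar>C\<bar>"])
    have "cmod (f x) \<le> \<bar>C\<bar> * cmod (indicator ?K x)" for x
      using C'[of x] by (cases "x \<in> ?K") auto
    then show "AE x in lebesgue. cmod (f x) \<le> \<bar>C\<bar> * cmod (indicator ?K x)" by simp
  qed simp
qed

lemma test_function_partial: 
  assumes "test_function \<phi>"
  shows "test_function (partial i \<phi>)"
proof -
  have d: "foldr partial js (partial i \<phi>) differentiable_on UNIV" for js
    \<comment> \<open>\<open>foldr\<close> applies the last index first, so \<open>i\<close> is
      appended at the end.\<close>
    using assms[unfolded test_function_def] by (auto dest!: spec[of _ "js @ [i]"])
  have "{x. partial i \<phi> x \<noteq> 0} \<subseteq> closure {x. \<phi> x \<noteq> 0}"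
  proof
    fix x assume x: "x \<in> {x. partial i \<phi> x \<noteq> 0}"
    show "x \<in> closure {x. \<phi> x \<noteq> 0}"
    proof (rule ccontr)
      assume nx: "x \<notin> closure {x. \<phi> x \<noteq> 0}"
      have z: "\<phi> y = 0" if "y \<in> - closure {x. \<phi> x \<noteq> 0}" for y
        using that closure_subset[of "{x. \<phi> x \<noteq> 0}"] by blast
      have "(\<phi> has_derivative (\<lambda>_. 0)) (at x)"
      proof (rule has_derivative_transform_within_open)
        show "((\<lambda>_. 0) has_derivative (\<lambda>_. 0)) (at x)" by simp
        show "open (- closure {x. \<phi> x \<noteq> 0})" by (rule open_Compl[OF closed_closure])
        show "x \<in> - closure {x. \<phi> x \<noteq> 0}" using nx by simp
        show "0 = \<phi> y" if "y \<in> - closure {x. \<phi> x \<noteq> 0}" for y using z[OF that] by simp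
      qed
      then have "frechet_derivative \<phi> (at x) = (\<lambda>_. 0)" by (rule frechet_derivative_at[symmetric])
      then show False using x by (simp add: partial_def)
    qed
  qed
  moreover have "bounded (closure {x. \<phi> x \<noteq> 0})"
    using assms unfolding test_function_def by (blast intro: compact_imp_bounded)
  ultimately have "bounded {x. partial i \<phi> x \<noteq> 0}"
    by (metis bounded_subset)
  with d show ?thesis by (simp add: test_function_def)
qed

lemma test_function_differentiable: "test_function \<phi> \<Longrightarrow> \<phi> differentiable (at x)"
  unfolding test_function_def by (drule conjunct1, drule spec[of _ "[]"]) (simp add: differentiable_on_def)

lemma test_function_continuous: "test_function \<phi> \<Longrightarrow> continuous_on UNIV \<phi>"
  unfolding test_function_def
  by (drule conjunct1, drule spec[of _ "[]"]) (simp add: differentiable_imp_continuous_on)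

lemma test_function_facts:
  assumes "test_function \<phi>"
  shows "\<phi> \<in> borel_measurable borel" "\<exists>C. \<forall>x. cmod (\<phi> x) \<le> C" "integrable lebesgue \<phi>" "\<phi> \<in> L2"
  using continuous_compact_support[OF test_function_continuous[OF assms]] assms
  by (auto simp: test_function_def)

lemma test_function_line_derivative:
  assumes "test_function \<phi>"
  shows "((\<lambda>t. \<phi> (x + t *\<^sub>R axis i 1)) has_vector_derivative partial i \<phi> (x + t *\<^sub>R axis i 1)) (at t)"
proof -
  have d: "(\<phi> has_derivative frechet_derivative \<phi> (at (x + t *\<^sub>R axis i 1))) (at (x + t *\<^sub>R axis i 1))"
    using test_function_differentiable[OF assms] by (simp add: frechet_derivative_works)
  have l: "((\<lambda>t. x + t *\<^sub>R axis i 1) has_derivative (\<lambda>h. h *\<^sub>R axis i 1)) (at t)"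
    by (auto intro!: derivative_eq_intros)
  have "((\<lambda>t. \<phi> (x + t *\<^sub>R axis i 1)) has_derivative (\<lambda>h. frechet_derivative \<phi> (at (x + t *\<^sub>R axis i 1)) (h *\<^sub>R axis i 1))) (at t)"
    by (rule has_derivative_compose[OF l d])
  moreover have "frechet_derivative \<phi> (at (x + t *\<^sub>R axis i 1)) (h *\<^sub>R axis i 1) = h *\<^sub>R partial i \<phi> (x + t *\<^sub>R axis i 1)" for h
    unfolding partial_def by (rule linear_scale[OF has_derivative_linear[OF d]])
  ultimately show ?thesis by (simp add: has_vector_derivative_def)
qed

section \<open>Translation and differentiation under the transform\<close>

lemma fint_translate:
  fixes f :: "'a::euclidean_space \<Rightarrow> complex"
  assumes [measurable]: "f \<in> borel_measurable borel"
  shows "fint s (\<lambda>x. f (a + x)) \<xi> = cis (- (s * (a \<bullet> \<xi>))) * fint s f \<xi>"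
proof -
  have "fint s (\<lambda>x. f (a + x)) \<xi> = (LINT x|lborel. f (a + x) * cis (s * (x \<bullet> \<xi>)))"
    unfolding fint_def by (rule integral_completion) simp
  also have "\<dots> = (LINT x|lborel. cis (- (s * (a \<bullet> \<xi>))) * (f (a + 1 *\<^sub>R x) * cis (s * ((a + 1 *\<^sub>R x) \<bullet> \<xi>))))"
    by (simp add: inner_add_left distrib_left cis_mult mult.left_commute)
  also have "\<dots> = cis (- (s * (a \<bullet> \<xi>))) * (LINT x|lborel. f (a + 1 *\<^sub>R x) * cis (s * ((a + 1 *\<^sub>R x) \<bullet> \<xi>)))"
    by (rule integral_mult_right_zero)
  also have "(LINT x|lborel. f (a + 1 *\<^sub>R x) * cis (s * ((a + 1 *\<^sub>R x) \<bullet> \<xi>))) = (LINT x|lborel. f x * cis (s * (x \<bullet> \<xi>)))"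
    by (subst lborel_integral_affine(2)[where t=a and c=1]) auto
  also have "\<dots> = fint s f \<xi>"
    unfolding fint_def by (rule integral_completion[symmetric]) simp
  finally show ?thesis .
qed

text \<open>
  Differentiation becomes multiplication: the translation property of the transform turns the
  difference quotients of \<open>\<phi>\<close> into those of the exponential.
\<close>

lemma fint_partial:
  fixes \<phi> :: "real^'n \<Rightarrow> complex"
  assumes \<phi>: "test_function \<phi>"
  shows "fint s (partial i \<phi>) \<xi> = - (\<i> * complex_of_real (s * \<xi> $ i)) * fint s \<phi> \<xi>"
proof -
  define t where "t k = 1 / Suc k" for k
  define e where "e = (axis i 1 :: real^'n)"
  have t0: "t k > 0" "t k \<le> 1" for k by (simp_all add: t_def)
  have tlim: "t \<longlonglongrightarrow> 0"
    unfolding t_def[abs_def] using LIMSEQ_inverse_real_of_nat by (simp add: inverse_eq_divide)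
  note p = test_function_partial[OF \<phi>, of i]
  note [measurable] = test_function_facts(1)[OF \<phi>]
  have e1: "norm e = 1" by (simp add: e_def norm_axis_1)
  \<comment> \<open>Difference quotients are taken along the sequence \<open>t\<close>, to which
    dominated convergence applies.\<close>
  have quot: "(\<lambda>k. (g (t k) - g 0) /\<^sub>R t k) \<longlonglongrightarrow> D" if "(g has_vector_derivative D) (at 0)" for g :: "real \<Rightarrow> complex" and D
  proof -
    have "((\<lambda>h. (g h - g 0 - h *\<^sub>R D) /\<^sub>R norm h) \<longlongrightarrow> 0) (at 0)"
      using that unfolding has_vector_derivative_def has_derivative_at_within by simp
    moreover have "filterlim t (at 0) sequentially"
      unfolding filterlim_at using tlim t0 by (auto intro!: always_eventually simp: less_imp_neq[symmetric])
    ultimately have "(\<lambda>k. (g (t k) - g 0 - t k *\<^sub>R D) /\<^sub>R norm (t k)) \<longlonglongrightarrow> 0"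
      by (rule filterlim_compose)
    moreover have "(g (t k) - g 0 - t k *\<^sub>R D) /\<^sub>R norm (t k) = (g (t k) - g 0) /\<^sub>R t k - D" for k
      using t0(1)[of k] by (simp add: scaleR_diff_right)
    ultimately show ?thesis by (simp add: LIM_zero_iff)
  qed
  obtain C where C: "\<And>x. cmod (partial i \<phi> x) \<le> C" using test_function_facts(2)[OF p] by blast
  have "0 \<le> C" using order_trans[OF norm_ge_zero C] by blast
  obtain R where R: "\<And>x. \<phi> x \<noteq> 0 \<Longrightarrow> norm x \<le> R"
    using \<phi> by (auto simp: test_function_def compact_closure bounded_iff)
  define q where "q k x = (\<phi> (t k *\<^sub>R e + x) - \<phi> x) /\<^sub>R t k" for k x
  \<comment> \<open>The mean value inequality bounds the quotient by the supremum of the partial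
    derivative; the steps are at most 1, so the supports stay within radius
    \<open>R + 1\<close>.\<close>
  have qb: "cmod (q k x) \<le> C * indicator (cball 0 (R + 1)) x" for k x
  proof (cases "x \<in> cball 0 (R + 1)")
    case True
    have "\<exists>z\<in>{0<..<t k}. cmod (\<phi> (x + t k *\<^sub>R e) - \<phi> (x + 0 *\<^sub>R e)) \<le> cmod ((\<lambda>h. h *\<^sub>R partial i \<phi> (x + z *\<^sub>R e)) (t k - 0))"
    proof (rule mvt_general)
      show "continuous_on {0..t k} (\<lambda>z. \<phi> (x + z *\<^sub>R e))"
        by (intro continuous_intros continuous_on_compose2[OF test_function_continuous[OF \<phi>]]) auto
      show "((\<lambda>z. \<phi> (x + z *\<^sub>R e)) has_derivative (\<lambda>h. h *\<^sub>R partial i \<phi> (x + z *\<^sub>R e))) (at z)" for z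
        using test_function_line_derivative[OF \<phi>] by (simp add: has_vector_derivative_def e_def)
    qed (rule t0)
    then obtain z where "cmod (\<phi> (x + t k *\<^sub>R e) - \<phi> x) \<le> t k * cmod (partial i \<phi> (x + z *\<^sub>R e))"
      using t0(1)[of k] by auto
    also have "\<dots> \<le> t k * C" using t0(1)[of k] by (intro mult_left_mono C) simp
    finally have "cmod (\<phi> (x + t k *\<^sub>R e) - \<phi> x) / t k \<le> C"
      using t0(1)[of k] by (simp add: pos_divide_le_eq mult.commute)
    then show ?thesis using True t0(1)[of k] by (simp add: q_def add.commute divide_inverse mult.commute)
  next
    case False
    then have "R + 1 < norm x" by simp
    moreover have "norm x - 1 \<le> norm (t k *\<^sub>R e + x)"
      using norm_triangle_ineq4[of "t k *\<^sub>R e + x" "t k *\<^sub>R e"] t0[of k] e1 by simp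
    ultimately have "\<phi> x = 0" "\<phi> (t k *\<^sub>R e + x) = 0" using R[of x] R[of "t k *\<^sub>R e + x"] by force+
    then show ?thesis using \<open>0 \<le> C\<close> by (simp add: q_def)
  qed
  have qm: "q k \<in> borel_measurable borel" for k unfolding q_def[abs_def] by measurable
  have [measurable]: "q k \<in> borel_measurable lebesgue" for k
    by (rule measurable_completion) (simp add: qm)
  have qlim: "(\<lambda>k. q k x) \<longlonglongrightarrow> partial i \<phi> x" for x
    using quot[OF test_function_line_derivative[OF \<phi>, of x i 0, simplified]]
    by (simp add: q_def e_def add.commute)
  have [measurable]: "partial i \<phi> \<in> borel_measurable lebesgue" "\<phi> \<in> borel_measurable lebesgue"
    using test_function_facts(3)[OF p] test_function_facts(3)[OF \<phi>] by auto
  have lim1: "(\<lambda>k. fint s (q k) \<xi>) \<longlonglongrightarrow> fint s (partial i \<phi>) \<xi>"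
    unfolding fint_def
  proof (rule integral_dominated_convergence[where w="\<lambda>x. C * indicator (cball 0 (R + 1)) x"])
    show "AE x in lebesgue. (\<lambda>k. q k x * cis (s * (x \<bullet> \<xi>))) \<longlonglongrightarrow> partial i \<phi> x * cis (s * (x \<bullet> \<xi>))"
      by (intro AE_I2 tendsto_intros qlim)
    show "AE x in lebesgue. cmod (q k x * cis (s * (x \<bullet> \<xi>))) \<le> C * indicator (cball 0 (R + 1)) x" for k
      using qb[of k] by (simp add: norm_mult)
    have "integrable lebesgue (indicat_real (cball (0 :: real^'n) (R + 1)))"
      by (simp add: lmeasurable_iff_integrable[symmetric])
    then show "integrable lebesgue (\<lambda>x. C * indicat_real (cball (0 :: real^'n) (R + 1)) x)" by simp
  qed measurable
  have eq: "fint s (q k) \<xi> = (cis (- (s * \<xi> $ i) * t k) - 1) /\<^sub>R t k * fint s \<phi> \<xi>" for k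
  proof -
    have tr: "integrable lebesgue (\<lambda>x. \<phi> (t k *\<^sub>R e + x))"
    proof -
      have "(\<lambda>x. \<phi> (t k *\<^sub>R e + x)) = (\<lambda>x. t k *\<^sub>R q k x + \<phi> x)"
        using t0(1)[of k] by (auto simp: q_def)
      moreover have "integrable lebesgue (q k)"
      proof (rule Bochner_Integration.integrable_bound)
        have "integrable lebesgue (indicat_real (cball (0 :: real^'n) (R + 1)))"
          by (simp add: lmeasurable_iff_integrable[symmetric])
        then show "integrable lebesgue (\<lambda>x. C * indicat_real (cball (0 :: real^'n) (R + 1)) x)" by simp
        show "AE x in lebesgue. norm (q k x) \<le> norm (C * indicat_real (cball (0 :: real^'n) (R + 1)) x)"
          unfolding real_norm_def by (intro AE_I2 order_trans[OF qb abs_ge_self])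
      qed simp
      ultimately show ?thesis using test_function_facts(3)[OF \<phi>] by simp
    qed
    have qe: "q k = (\<lambda>x. complex_of_real (1 / t k) * (\<phi> (t k *\<^sub>R e + x) - \<phi> x))"
      by (auto simp: q_def scaleR_conv_of_real divide_inverse)
    have "fint s (q k) \<xi> = complex_of_real (1 / t k) * (fint s (\<lambda>x. \<phi> (t k *\<^sub>R e + x)) \<xi> - fint s \<phi> \<xi>)"
      unfolding qe fint_cmult fint_diff[OF tr test_function_facts(3)[OF \<phi>]] ..
    also have "fint s (\<lambda>x. \<phi> (t k *\<^sub>R e + x)) \<xi> = cis (- (s * \<xi> $ i) * t k) * fint s \<phi> \<xi>"
      by (subst fint_translate) (simp_all add: e_def inner_axis' mult_ac)
    finally show ?thesis by (simp add: scaleR_conv_of_real divide_inverse algebra_simps)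
  qed
  have lim2: "(\<lambda>k. (cis (- (s * \<xi> $ i) * t k) - 1) /\<^sub>R t k * fint s \<phi> \<xi>) \<longlonglongrightarrow> (- (s * \<xi> $ i) *\<^sub>R \<i>) * fint s \<phi> \<xi>"
  proof -
    let ?a = "- (s * \<xi> $ i)"
    have "((\<lambda>t. exp (t *\<^sub>R (\<i> * ?a))) has_vector_derivative exp (0 *\<^sub>R (\<i> * ?a)) * (\<i> * ?a)) (at 0)"
      by (rule exp_scaleR_has_vector_derivative_right)
    then have "((\<lambda>t. cis (?a * t)) has_vector_derivative ?a *\<^sub>R \<i>) (at 0)"
      by (simp add: cis_conv_exp scaleR_conv_of_real mult_ac)
    from quot[OF this] show ?thesis by (intro tendsto_mult tendsto_const) simp
  qed
  have "fint s (partial i \<phi>) \<xi> = (- (s * \<xi> $ i) *\<^sub>R \<i>) * fint s \<phi> \<xi>"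
    using LIMSEQ_unique[OF lim1 lim2[folded eq]] .
  then show ?thesis by (simp add: scaleR_conv_of_real mult_ac)
qed

text \<open>Schwarz's theorem by transform: both sides have the transform of \<phi> times the same
  two factors, injectivity makes them equal almost everywhere, and continuity everywhere.\<close>

lemma partial_commute:
  fixes \<phi> :: "real^'n \<Rightarrow> complex"
  assumes \<phi>: "test_function \<phi>"
  shows "partial i (partial j \<phi>) = partial j (partial i \<phi>)"
proof
  fix x :: "real^'n"
  note p = test_function_partial[OF test_function_partial[OF \<phi>]]
  note P = test_function_facts(3)[OF p]
  have "AE x in lebesgue. partial i (partial j \<phi>) x - partial j (partial i \<phi>) x = 0"
  proof (rule fint_inject[where s=1])
    show "integrable lebesgue (\<lambda>x. partial i (partial j \<phi>) x - partial j (partial i \<phi>) x)"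
      by (intro Bochner_Integration.integrable_diff P)
    show "fint 1 (\<lambda>x. partial i (partial j \<phi>) x - partial j (partial i \<phi>) x) \<xi> = 0" for \<xi>
      by (simp add: fint_diff P fint_partial \<phi> test_function_partial)
  qed simp
  then have "AE x in lebesgue. x \<in> {x. partial i (partial j \<phi>) x = partial j (partial i \<phi>) x}" by simp
  then have "x \<in> {x. partial i (partial j \<phi>) x = partial j (partial i \<phi>) x}"
    by (intro mem_closed_if_AE_lebesgue closed_Collect_eq test_function_continuous p)
  then show "partial i (partial j \<phi>) x = partial j (partial i \<phi>) x" by simp
qed

section \<open>Bump functions\<close>

text \<open>The polynomial in \<open>1 / t\<close> is carried along so that the class of such
  functions is closed under differentiation; \<open>p = 1\<close> is the classical flat
  function.\<close>

definition flat :: "real poly \<Rightarrow> real \<Rightarrow> real" where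
  "flat p t = (if 0 < t then poly p (1 / t) * exp (- (1 / t)) else 0)"

lemma poly_times_exp_tendsto_0: "((\<lambda>y::real. poly p y * exp (- y)) \<longlongrightarrow> 0) at_top"
proof -
  have "((\<lambda>y::real. \<Sum>i\<le>degree p. coeff p i * (y ^ i / exp y)) \<longlongrightarrow> (\<Sum>i\<le>degree p. coeff p i * 0)) at_top"
    by (intro tendsto_intros tendsto_power_div_exp_0)
  then show ?thesis by (simp add: poly_altdef sum_distrib_right exp_minus divide_inverse mult.assoc)
qed

text \<open>For positive \<open>t\<close> the chain rule produces the factor
  \<open>1 / t\<^sup>2\<close> and the polynomial \<open>p - pderiv p\<close>; at 0 the exponential
  beats every power of \<open>1 / t\<close>.\<close>

lemma flat_has_derivative:
  "(flat p has_real_derivative flat (monom 1 2 * (p - pderiv p)) t) (at t)"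
proof -
  consider "0 < t" | "t < 0" | "t = 0" by linarith
  then show ?thesis
  proof cases
    case 1
    have "((\<lambda>t. poly p (1 / t) * exp (- (1 / t))) has_real_derivative flat (monom 1 2 * (p - pderiv p)) t) (at t)"
      using 1 by (auto intro!: derivative_eq_intros DERIV_chain2[OF poly_DERIV]
          simp: flat_def poly_monom field_simps power2_eq_square)
    then show ?thesis
      by (rule DERIV_cong_ev[THEN iffD1, OF refl _ refl, rotated])
        (use 1 in \<open>auto simp: flat_def intro!: eventually_nhds_in_open[of "{0<..}", THEN eventually_mono]\<close>)
  next
    case 2
    have "((\<lambda>t. 0) has_real_derivative flat (monom 1 2 * (p - pderiv p)) t) (at t)"
      using 2 by (simp add: flat_def)
    then show ?thesis
      by (rule DERIV_cong_ev[THEN iffD1, OF refl _ refl, rotated])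
        (use 2 in \<open>auto simp: flat_def intro!: eventually_nhds_in_open[of "{..<0}", THEN eventually_mono]\<close>)
  next
    case 3
    \<comment> \<open>The difference quotient at 0 from the right: division by \<open>h\<close>
      multiplies the polynomial by its variable.\<close>
    have "((\<lambda>h. poly (monom 1 1 * p) (inverse h) * exp (- inverse h)) \<longlongrightarrow> 0) (at_right 0)"
      by (rule filterlim_compose[OF poly_times_exp_tendsto_0 filterlim_inverse_at_top_right])
    then have "((\<lambda>h. (flat p (0 + h) - flat p 0) / h) \<longlongrightarrow> 0) (at_right 0)"
      by (rule Lim_transform_eventually)
        (auto simp: flat_def poly_monom field_simps eventually_at_right_less[THEN eventually_mono])
    moreover have "((\<lambda>h. (flat p (0 + h) - flat p 0) / h) \<longlongrightarrow> 0) (at_left 0)"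
      by (rule tendsto_eventually) (auto simp: flat_def eventually_at_left_field intro!: exI[of _ "-1"])
    ultimately have "((\<lambda>h. (flat p (0 + h) - flat p 0) / h) \<longlongrightarrow> 0) (at 0)"
      by (simp add: filterlim_at_split)
    then show ?thesis using 3 by (simp add: DERIV_def flat_def)
  qed
qed

text \<open>A class of functions of one variable, vanishing for
  \<open>\<bar>k * (t - y)\<bar> \<ge> 1\<close>, that is closed under derivatives.\<close>

inductive_set bump_span :: "real \<Rightarrow> real \<Rightarrow> (real \<Rightarrow> real) set" for k y where
  base: "(\<lambda>t. flat p (1 + k * (t - y)) * flat q (1 - k * (t - y))) \<in> bump_span k y"
| add: "f \<in> bump_span k y \<Longrightarrow> g \<in> bump_span k y \<Longrightarrow> (\<lambda>t. f t + g t) \<in> bump_span k y"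

lemma flat_smult: "flat (smult c p) t = c * flat p t"
  by (simp add: flat_def)

lemma bump_span_derivative:
  "f \<in> bump_span k y \<Longrightarrow> \<exists>f'\<in>bump_span k y. \<forall>t. (f has_real_derivative f' t) (at t)"
proof (induction rule: bump_span.induct)
  case (base p q)
  let ?D = "\<lambda>p. monom 1 2 * (p - pderiv p)"
  \<comment> \<open>The chain rule factors \<open>k\<close> and \<open>- k\<close> are absorbed into
    the polynomials, so sums are the only closure operation required.\<close>
  let ?f' = "\<lambda>t. flat (smult k (?D p)) (1 + k * (t - y)) * flat q (1 - k * (t - y))
    + flat p (1 + k * (t - y)) * flat (smult (- k) (?D q)) (1 - k * (t - y))"
  have der: "((\<lambda>t. flat p (1 + k * (t - y)) * flat q (1 - k * (t - y))) has_real_derivative ?f' t) (at t)" for t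
    unfolding flat_smult
    by (auto intro!: derivative_eq_intros DERIV_chain2[OF flat_has_derivative])
  have "?f' \<in> bump_span k y" by (intro bump_span.intros)
  then show ?case by (intro bexI[where x="?f'"] allI der)
next
  case (add f g)
  then obtain f' g' where "f' \<in> bump_span k y" "g' \<in> bump_span k y"
    "\<And>t. (f has_real_derivative f' t) (at t)" "\<And>t. (g has_real_derivative g' t) (at t)" by blast
  then show ?case by (intro bexI[of _ "\<lambda>t. f' t + g' t"] allI DERIV_add bump_span.add)
qed

text \<open>A partial derivative replaces one factor by its derivative and keeps the others, so the
  result is again a single product. For this the factors must be allowed to differ from coordinate
  to coordinate.\<close>

lemma product_smooth:
  fixes y :: "real^'n"
  assumes "\<And>i. f i \<in> bump_span k (y $ i)"
  defines "\<phi> \<equiv> \<lambda>x::real^'n. complex_of_real (\<Prod>i\<in>UNIV. f i (x $ i))"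
  shows "\<phi> differentiable_on UNIV"
    and "\<exists>g. (\<forall>i. g i \<in> bump_span k (y $ i)) \<and> partial j \<phi> = (\<lambda>x. complex_of_real (\<Prod>i\<in>UNIV. g i (x $ i)))"
proof -
  have "\<forall>i. \<exists>f'. f' \<in> bump_span k (y $ i) \<and> (\<forall>t. (f i has_real_derivative f' t) (at t))"
    using bump_span_derivative[OF assms(1)] by blast
  then obtain f' where f': "\<And>i. f' i \<in> bump_span k (y $ i)" "\<And>i t. (f i has_real_derivative f' i t) (at t)"
    by metis
  have "((\<lambda>x. f i (x $ i)) has_derivative (\<lambda>h. f' i (x $ i) * (h $ i))) (at x)" for i and x :: "real^'n"
    using has_derivative_compose[OF bounded_linear_imp_has_derivative[OF bounded_linear_vec_nth[of i]], of "f i" "\<lambda>h. f' i (x $ i) * h" x UNIV]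
      f'(2)[of i "x $ i"] by (simp add: has_field_derivative_def)
  then have "((\<lambda>x. \<Prod>i\<in>UNIV. f i (x $ i)) has_derivative
      (\<lambda>h. \<Sum>i\<in>UNIV. f' i (x $ i) * (h $ i) * (\<Prod>l\<in>UNIV - {i}. f l (x $ l)))) (at x)" for x :: "real^'n"
    by (rule has_derivative_prod)
  then have d: "(\<phi> has_derivative
      (\<lambda>h. complex_of_real (\<Sum>i\<in>UNIV. f' i (x $ i) * (h $ i) * (\<Prod>l\<in>UNIV - {i}. f l (x $ l))))) (at x)" for x
    unfolding \<phi>_def by (rule has_derivative_of_real)
  then show "\<phi> differentiable_on UNIV"
    unfolding differentiable_on_def differentiable_def by blast
  have "partial j \<phi> x = complex_of_real (\<Prod>i\<in>UNIV. (f(j := f' j)) i (x $ i))" for x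
  proof -
    have "partial j \<phi> x = complex_of_real (\<Sum>i\<in>UNIV. f' i (x $ i) * (axis j 1 $ i) * (\<Prod>l\<in>UNIV - {i}. f l (x $ l)))"
      unfolding partial_def frechet_derivative_at[OF d, symmetric] ..
    also have "(\<Sum>i\<in>UNIV. f' i (x $ i) * (axis j 1 $ i) * (\<Prod>l\<in>UNIV - {i}. f l (x $ l)))
        = (\<Sum>i\<in>UNIV. if i = j then f' i (x $ i) * (\<Prod>l\<in>UNIV - {i}. f l (x $ l)) else 0)"
      by (intro sum.cong) (auto simp: axis_def)
    also have "\<dots> = f' j (x $ j) * (\<Prod>l\<in>UNIV - {j}. f l (x $ l))" by simp
    also have "\<dots> = (\<Prod>i\<in>UNIV. (f(j := f' j)) i (x $ i))"
      by (subst prod.remove[of UNIV j]) auto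
    finally show ?thesis .
  qed
  then show "\<exists>g. (\<forall>i. g i \<in> bump_span k (y $ i)) \<and> partial j \<phi> = (\<lambda>x. complex_of_real (\<Prod>i\<in>UNIV. g i (x $ i)))"
    using f'(1) assms(1) by (intro exI[of _ "f(j := f' j)"]) auto
qed

text \<open>A product of one-dimensional bumps, supported in the cube of half-width
  \<open>1 / Suc m\<close> around \<open>y\<close>; \<open>Suc\<close> keeps the width finite for
  \<open>m = 0\<close>.\<close>

definition bump :: "nat \<Rightarrow> real^'n \<Rightarrow> real^'n \<Rightarrow> complex" where
  "bump m y x = complex_of_real (\<Prod>i\<in>UNIV. flat 1 (1 + Suc m * (x $ i - y $ i)) * flat 1 (1 - Suc m * (x $ i - y $ i)))"

lemma bump_support:
  assumes "bump m y x \<noteq> 0"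
  shows "\<bar>x $ i - y $ i\<bar> < 1 / Suc m"
proof -
  have "0 < 1 + Suc m * (x $ i - y $ i)" "0 < 1 - Suc m * (x $ i - y $ i)"
    using assms by (auto simp: bump_def flat_def split: if_splits)
  then have "\<bar>Suc m * (x $ i - y $ i)\<bar> < 1" by linarith
  then have "\<bar>x $ i - y $ i\<bar> * Suc m < 1" by (simp only: abs_mult mult.commute abs_of_nat)
  then show ?thesis by (simp only: pos_less_divide_eq[OF of_nat_0_less_iff[THEN iffD2, OF zero_less_Suc]])
qed

text \<open>The invariant under differentiation is the product form with factors in
  \<open>bump_span\<close>, not the shape of \<open>bump\<close> itself.\<close>

lemma test_function_bump: "test_function (bump m y)"
proof -
  have smooth: "\<exists>g. (\<forall>i. g i \<in> bump_span (Suc m) (y $ i)) \<and>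
      foldr partial js (bump m y) = (\<lambda>x. complex_of_real (\<Prod>i\<in>UNIV. g i (x $ i)))" for js
  proof (induction js)
    case Nil
    show ?case
      by (intro exI[of _ "\<lambda>i t. flat 1 (1 + Suc m * (t - y $ i)) * flat 1 (1 - Suc m * (t - y $ i))"])
        (auto simp: bump_def fun_eq_iff intro: bump_span.base)
  next
    case (Cons j js)
    then obtain g where g: "\<And>i. g i \<in> bump_span (Suc m) (y $ i)"
      "foldr partial js (bump m y) = (\<lambda>x. complex_of_real (\<Prod>i\<in>UNIV. g i (x $ i)))" by blast
    show ?case using product_smooth(2)[of g "Suc m" y j, OF g(1)] by (simp add: g(2))
  qed
  have "foldr partial js (bump m y) differentiable_on UNIV" for js
  proof -
    obtain g where g: "\<And>i. g i \<in> bump_span (Suc m) (y $ i)"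
      "foldr partial js (bump m y) = (\<lambda>x. complex_of_real (\<Prod>i\<in>UNIV. g i (x $ i)))" using smooth[of js] by blast
    show ?thesis unfolding g(2) by (rule product_smooth(1)[OF g(1)])
  qed
  moreover have "bounded {x. bump m y x \<noteq> 0}"
  proof (rule boundedI)
    fix x assume "x \<in> {x. bump m y x \<noteq> 0}"
    then have s: "\<bar>x $ i - y $ i\<bar> < 1 / Suc m" for i by (intro bump_support) simp
    have "\<bar>(x - y) $ i\<bar> \<le> 1" for i
    proof -
      have "1 / Suc m \<le> (1 :: real)" by simp
      with s[of i] show ?thesis unfolding vector_minus_component by linarith
    qed
    then have "norm (x - y) \<le> (\<Sum>i\<in>(UNIV :: 'a set). 1)"
      by (intro order_trans[OF norm_le_l1_cart sum_mono])
    then show "norm x \<le> norm y + (\<Sum>i\<in>(UNIV :: 'a set). 1)"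
      using norm_triangle_sub[of x y] by linarith
  qed
  ultimately show ?thesis by (simp add: test_function_def)
qed

lemma fint_bump: "fint s (bump m y) \<xi> = cis (s * (y \<bullet> \<xi>)) * fint s (bump m 0) \<xi>"
proof -
  have "bump m 0 = (\<lambda>x. bump m y (y + x))" by (simp add: bump_def fun_eq_iff)
  then have "fint s (bump m 0) \<xi> = cis (- (s * (y \<bullet> \<xi>))) * fint s (bump m y) \<xi>"
    using fint_translate[OF test_function_facts(1)[OF test_function_bump[of m y]], of s y] by simp
  then show ?thesis by (simp add: mult.assoc[symmetric] cis_mult)
qed

text \<open>A narrow bump around 0 sees only phases of modulus at most 1, where the cosine is
  nonnegative; the real part of its transform is then the integral of a nonnegative continuous
  function that is positive at 0. How narrow depends on \<xi>.\<close>

lemma fint_bump_nonzero: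
  fixes \<xi> :: "real^'n"
  shows "\<exists>m. fint 1 (bump m 0) \<xi> \<noteq> 0"
proof -
  \<comment> \<open>On the support, \<open>\<bar>x \<bullet> \<xi>\<bar>\<close> is at most this sum
    divided by \<open>Suc m\<close>, hence at most 1.\<close>
  obtain m :: nat where m: "(\<Sum>i\<in>UNIV. \<bar>\<xi> $ i\<bar>) < m" using reals_Archimedean2 by blast
  let ?b = "\<lambda>x. Re (bump m 0 x)"
  let ?r = "\<lambda>x. ?b x * cos (x \<bullet> \<xi>)"
  note t = test_function_bump[of m "0 :: real^'n"]
  have b0: "0 \<le> ?b x" for x unfolding bump_def Re_complex_of_real by (intro prod_nonneg mult_nonneg_nonneg) (auto simp: flat_def)
  have r0: "0 \<le> ?r x" for x
  proof (cases "bump m 0 x = 0")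
    case False
    have "\<bar>x \<bullet> \<xi>\<bar> \<le> (\<Sum>i\<in>UNIV. \<bar>x $ i\<bar> * \<bar>\<xi> $ i\<bar>)"
      unfolding inner_vec_def by (intro order_trans[OF sum_abs]) (simp add: abs_mult)
    also have "\<dots> \<le> (\<Sum>i\<in>UNIV. (1 / Suc m) * \<bar>\<xi> $ i\<bar>)"
      using bump_support[OF False] by (intro sum_mono mult_right_mono) (auto intro: less_imp_le)
    also have "\<dots> = (\<Sum>i\<in>UNIV. \<bar>\<xi> $ i\<bar>) / Suc m" by (simp add: sum_divide_distrib)
    also have "\<dots> \<le> 1" using m by (simp add: divide_le_eq)
    finally have "\<bar>x \<bullet> \<xi>\<bar> \<le> pi / 2" using pi_gt3 by linarith
    then have "0 \<le> cos (x \<bullet> \<xi>)" by (intro cos_ge_zero) auto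
    then show ?thesis by (rule mult_nonneg_nonneg[OF b0])
  qed simp
  have i: "integrable lebesgue (\<lambda>x. bump m 0 x * cis (1 * (x \<bullet> \<xi>)))"
    by (rule fint_integrand[OF test_function_facts(3)[OF t]])
  have "Im (bump m 0 x) = 0" for x :: "real^'n" unfolding bump_def by (rule Im_complex_of_real)
  then have Re: "Re (bump m 0 x * cis (1 * (x \<bullet> \<xi>))) = ?r x" for x by simp
  have ri: "integrable lebesgue ?r" using integrable_Re[OF i] unfolding Re .
  have "fint 1 (bump m 0) \<xi> \<noteq> 0"
  proof
    assume "fint 1 (bump m 0) \<xi> = 0"
    then have "(LINT x|lebesgue. ?r x) = 0"
      using integral_Re[OF i] unfolding Re fint_def by simp
    then have "AE x in lebesgue. ?r x = 0"
      using integral_nonneg_eq_0_iff_AE[OF ri] r0 by simp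
    then have "AE x in lebesgue. x \<in> {x. ?r x = 0}" by simp
    moreover have "closed {x. ?r x = 0}"
      by (intro closed_Collect_eq continuous_intros test_function_continuous[OF t])
    ultimately have "0 \<in> {x. ?r x = 0}" by (intro mem_closed_if_AE_lebesgue)
    then show False by (simp add: bump_def flat_def)
  qed
  then show ?thesis by blast
qed

section \<open>Divergence-free and gradient fields in frequency\<close>

text \<open>Opposite signs make Parseval bilinear, and for a test function the integral formula
  replaces the representative chosen in \<open>fourier_L2\<close>.\<close>

lemma test_function_pairing:
  fixes h \<psi> :: "real^'n \<Rightarrow> complex"
  assumes h: "h \<in> L2" and \<psi>: "test_function \<psi>"
  shows "integrable lebesgue (\<lambda>\<xi>. fourier_L2 (- 1) h \<xi> * fint 1 \<psi> \<xi>)"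
    and "(LINT \<xi>|lebesgue. fourier_L2 (- 1) h \<xi> * fint 1 \<psi> \<xi>) = (2 * pi) ^ CARD('n) * (LINT x|lebesgue. h x * \<psi> x)"
proof -
  note t = test_function_facts(3,4)[OF \<psi>]
  have F: "fourier_L2 (- 1) h \<in> L2" and P: "fint 1 \<psi> \<in> L2" and Q: "fourier_L2 1 \<psi> \<in> L2"
    using h t by (auto intro: fourier_L2_in_L2 fint_L2)
  note [measurable] = F[THEN L2_measurable] P[THEN L2_measurable] Q[THEN L2_measurable]
  show "integrable lebesgue (\<lambda>\<xi>. fourier_L2 (- 1) h \<xi> * fint 1 \<psi> \<xi>)"
    by (rule L2_mult_integrable[OF F P])
  have "(LINT \<xi>|lebesgue. fourier_L2 (- 1) h \<xi> * fint 1 \<psi> \<xi>) = (LINT \<xi>|lebesgue. fourier_L2 (- 1) h \<xi> * fourier_L2 1 \<psi> \<xi>)"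
    using fourier_L2_eq_fint[OF t(2,1), of 1] by (intro integral_cong_AE) (auto elim: eventually_mono)
  also have "\<dots> = (2 * pi) ^ CARD('n) * (LINT x|lebesgue. h x * \<psi> x)"
    using fourier_L2_pairing[OF h t(2), of "- 1"] by simp
  finally show "(LINT \<xi>|lebesgue. fourier_L2 (- 1) h \<xi> * fint 1 \<psi> \<xi>) = (2 * pi) ^ CARD('n) * (LINT x|lebesgue. h x * \<psi> x)" .
qed

text \<open>The factor \<open>\<xi> $ i\<close> is absorbed by the transform of the derivative of
  \<phi>, which is square integrable; this gives integrability without any decay of the transform of
  \<open>h\<close> beyond square integrability.\<close>

lemma partial_pairing:
  fixes h \<phi> :: "real^'n \<Rightarrow> complex"
  assumes h: "h \<in> L2" and \<phi>: "test_function \<phi>"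
  shows "integrable lebesgue (\<lambda>\<xi>. complex_of_real (\<xi> $ i) * fourier_L2 (- 1) h \<xi> * fint 1 \<phi> \<xi>)"
    and "- \<i> * (LINT \<xi>|lebesgue. complex_of_real (\<xi> $ i) * fourier_L2 (- 1) h \<xi> * fint 1 \<phi> \<xi>)
      = (2 * pi) ^ CARD('n) * (LINT x|lebesgue. h x * partial i \<phi> x)"
proof -
  have eq: "fourier_L2 (- 1) h \<xi> * fint 1 (partial i \<phi>) \<xi> = - \<i> * (complex_of_real (\<xi> $ i) * fourier_L2 (- 1) h \<xi> * fint 1 \<phi> \<xi>)" for \<xi>
    by (simp add: fint_partial[OF \<phi>])
  note p = test_function_pairing[OF h test_function_partial[OF \<phi>, of i], unfolded eq]
  show "integrable lebesgue (\<lambda>\<xi>. complex_of_real (\<xi> $ i) * fourier_L2 (- 1) h \<xi> * fint 1 \<phi> \<xi>)"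
    using integrable_mult_right[OF p(1), of \<i>] by (simp add: mult.assoc[symmetric])
  show "- \<i> * (LINT \<xi>|lebesgue. complex_of_real (\<xi> $ i) * fourier_L2 (- 1) h \<xi> * fint 1 \<phi> \<xi>)
      = (2 * pi) ^ CARD('n) * (LINT x|lebesgue. h x * partial i \<phi> x)"
    using p(2) unfolding integral_mult_right_zero .
qed

text \<open>
  Translating a test function multiplies its transform by exponentials, so that the hypothesis says
  that the \<open>L\<^sup>1\<close> function \<open>G \<cdot> fint 1 (bump m 0)\<close> has vanishing Fourier transform.
\<close>

lemma AE_eq_0_if_orthogonal_test_functions:
  fixes G :: "real^'n \<Rightarrow> complex"
  assumes "\<And>\<phi>. test_function \<phi> \<Longrightarrow> integrable lebesgue (\<lambda>\<xi>. G \<xi> * fint 1 \<phi> \<xi>)"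
    and "\<And>\<phi>. test_function \<phi> \<Longrightarrow> (LINT \<xi>|lebesgue. G \<xi> * fint 1 \<phi> \<xi>) = 0"
  shows "AE \<xi> in lebesgue. G \<xi> = 0"
proof -
  have "AE \<xi> in lebesgue. G \<xi> * fint 1 (bump m 0) \<xi> = 0" for m
  proof (rule fint_inject[where s=1])
    show "integrable lebesgue (\<lambda>\<xi>. G \<xi> * fint 1 (bump m 0) \<xi>)"
      by (rule assms(1)[OF test_function_bump])
    fix y :: "real^'n"
    have "fint 1 (\<lambda>\<xi>. G \<xi> * fint 1 (bump m 0) \<xi>) y = (LINT \<xi>|lebesgue. G \<xi> * fint 1 (bump m y) \<xi>)"
      unfolding fint_bump[of 1 m y] unfolding fint_def[of 1 "\<lambda>\<xi>. G \<xi> * fint 1 (bump m 0) \<xi>"]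
      by (simp add: mult_ac inner_commute)
    then show "fint 1 (\<lambda>\<xi>. G \<xi> * fint 1 (bump m 0) \<xi>) y = 0"
      by (simp add: assms(2)[OF test_function_bump])
  qed simp
  \<comment> \<open>The transform of one bump may have zeros, but at each frequency some
    \<open>m\<close> is good, and there are countably many \<open>m\<close>.\<close>
  then have "AE \<xi> in lebesgue. \<forall>m. G \<xi> * fint 1 (bump m 0) \<xi> = 0" by (subst AE_all_countable) blast
  then show ?thesis by eventually_elim (use fint_bump_nonzero in force)
qed

lemma integral_div_test_function:
  fixes v :: "real^'n \<Rightarrow> complex^'n"
  assumes v: "v \<in> L2" and \<phi>: "test_function \<phi>"
  shows "integrable lebesgue (\<lambda>\<xi>. cdot \<xi> (fourier_vec v \<xi>) * fint 1 \<phi> \<xi>)"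
    and "- \<i> * (LINT \<xi>|lebesgue. cdot \<xi> (fourier_vec v \<xi>) * fint 1 \<phi> \<xi>)
    = (2 * pi) ^ CARD('n) * (LINT x|lebesgue. (\<Sum>i\<in>UNIV. v x $ i * partial i \<phi> x))"
proof -
  note p = partial_pairing[OF L2_component[OF v] \<phi>]
  have eq: "cdot \<xi> (fourier_vec v \<xi>) * fint 1 \<phi> \<xi>
      = (\<Sum>i\<in>UNIV. complex_of_real (\<xi> $ i) * fourier_L2 (- 1) (\<lambda>x. v x $ i) \<xi> * fint 1 \<phi> \<xi>)" for \<xi>
    by (simp add: cdot_def fourier_vec_def sum_distrib_right)
  show "integrable lebesgue (\<lambda>\<xi>. cdot \<xi> (fourier_vec v \<xi>) * fint 1 \<phi> \<xi>)"
    unfolding eq by (intro Bochner_Integration.integrable_sum p)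
  have i: "integrable lebesgue (\<lambda>x. v x $ i * partial i \<phi> x)" for i
    by (intro L2_mult_integrable L2_component v test_function_facts(4) test_function_partial \<phi>)
  show "- \<i> * (LINT \<xi>|lebesgue. cdot \<xi> (fourier_vec v \<xi>) * fint 1 \<phi> \<xi>)
    = (2 * pi) ^ CARD('n) * (LINT x|lebesgue. (\<Sum>i\<in>UNIV. v x $ i * partial i \<phi> x))"
    unfolding eq Bochner_Integration.integral_sum[OF p(1)] Bochner_Integration.integral_sum[OF i]
      sum_distrib_left p(2) ..
qed

text \<open>The weak divergence pairs \<open>cdot \<xi>\<close> of the transform with transforms of
  test functions. That function need not be square integrable, hence the uniqueness criterion that
  asks only for integrability against those transforms.\<close>

lemma H_div0_iff: "v \<in> H_div0 \<longleftrightarrow> v \<in> L2 \<and> (AE \<xi> in lebesgue. cdot \<xi> (fourier v \<xi>) = 0)"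
proof (cases "v \<in> L2")
  case True
  have c: "(2 * complex_of_real pi) ^ CARD('a) \<noteq> 0" by simp
  have "(AE \<xi> in lebesgue. cdot \<xi> (fourier v \<xi>) = 0) \<longleftrightarrow> (AE \<xi> in lebesgue. cdot \<xi> (fourier_vec v \<xi>) = 0)"
    using fourier_AE[OF True] by (auto elim: eventually_elim2)
  also have "\<dots> \<longleftrightarrow> (\<forall>\<phi>. test_function \<phi> \<longrightarrow> (LINT x|lebesgue. (\<Sum>i\<in>UNIV. v x $ i * partial i \<phi> x)) = 0)"
  proof
    assume a: "AE \<xi> in lebesgue. cdot \<xi> (fourier_vec v \<xi>) = 0"
    show "\<forall>\<phi>. test_function \<phi> \<longrightarrow> (LINT x|lebesgue. (\<Sum>i\<in>UNIV. v x $ i * partial i \<phi> x)) = 0"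
    proof (intro allI impI)
      fix \<phi> :: "real^'a \<Rightarrow> complex" assume \<phi>: "test_function \<phi>"
      have "(LINT \<xi>|lebesgue. cdot \<xi> (fourier_vec v \<xi>) * fint 1 \<phi> \<xi>) = 0"
        by (rule integral_eq_zero_AE) (use a in \<open>auto elim: eventually_mono\<close>)
      then show "(LINT x|lebesgue. (\<Sum>i\<in>UNIV. v x $ i * partial i \<phi> x)) = 0"
        using integral_div_test_function(2)[OF True \<phi>] c by simp
    qed
  next
    assume a: "\<forall>\<phi>. test_function \<phi> \<longrightarrow> (LINT x|lebesgue. (\<Sum>i\<in>UNIV. v x $ i * partial i \<phi> x)) = 0"
    show "AE \<xi> in lebesgue. cdot \<xi> (fourier_vec v \<xi>) = 0"
    proof (rule AE_eq_0_if_orthogonal_test_functions)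
      fix \<phi> :: "real^'a \<Rightarrow> complex" assume \<phi>: "test_function \<phi>"
      show "integrable lebesgue (\<lambda>\<xi>. cdot \<xi> (fourier_vec v \<xi>) * fint 1 \<phi> \<xi>)"
        by (rule integral_div_test_function[OF True \<phi>])
      show "(LINT \<xi>|lebesgue. cdot \<xi> (fourier_vec v \<xi>) * fint 1 \<phi> \<xi>) = 0"
        using integral_div_test_function(2)[OF True \<phi>] a \<phi> by simp
    qed
  qed
  finally show ?thesis using True by (simp add: H_div0_def)
qed (simp add: H_div0_def)

text \<open>Testing the gradient against \<open>partial i \<phi>\<close> leaves \<open>q\<close>
  paired with a second derivative, which is symmetric in the two indices. Thus no transform of the
  potential, which may grow at infinity, has to be taken.\<close>

lemma weak_gradient_curl_free:
  fixes h :: "real^'n \<Rightarrow> complex^'n"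
  assumes h: "h \<in> L2" and q: "is_weak_gradient q h"
  shows "AE \<xi> in lebesgue. complex_of_real (\<xi> $ i) * fourier h \<xi> $ j = complex_of_real (\<xi> $ j) * fourier h \<xi> $ i"
proof -
  let ?h = "\<lambda>i x. h x $ i"
  let ?G = "\<lambda>\<xi>. complex_of_real (\<xi> $ i) * fourier_L2 (- 1) (?h j) \<xi> - complex_of_real (\<xi> $ j) * fourier_L2 (- 1) (?h i) \<xi>"
  have "AE \<xi> in lebesgue. ?G \<xi> = 0"
  proof (rule AE_eq_0_if_orthogonal_test_functions)
    fix \<phi> :: "real^'n \<Rightarrow> complex" assume \<phi>: "test_function \<phi>"
    note p = partial_pairing[OF L2_component[OF h] \<phi>]
    show "integrable lebesgue (\<lambda>\<xi>. ?G \<xi> * fint 1 \<phi> \<xi>)"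
      unfolding left_diff_distrib by (intro Bochner_Integration.integrable_diff p)
    have w: "(LINT x|lebesgue. h x $ j * partial i \<phi> x) = - (LINT x|lebesgue. q x * partial j (partial i \<phi>) x)" for i j
      using q[unfolded is_weak_gradient_def, rule_format, of "partial i \<phi>" j] test_function_partial[OF \<phi>] by simp
    have "- \<i> * (LINT \<xi>|lebesgue. ?G \<xi> * fint 1 \<phi> \<xi>)
        = (2 * pi) ^ CARD('n) * (LINT x|lebesgue. h x $ j * partial i \<phi> x) - (2 * pi) ^ CARD('n) * (LINT x|lebesgue. h x $ i * partial j \<phi> x)"
      unfolding left_diff_distrib Bochner_Integration.integral_diff[OF p(1) p(1)] right_diff_distrib p(2) ..
    also have "\<dots> = 0" unfolding w partial_commute[OF \<phi>, of j i] by simp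
    finally show "(LINT \<xi>|lebesgue. ?G \<xi> * fint 1 \<phi> \<xi>) = 0" by simp
  qed
  then show ?thesis using fourier_component[OF h] by eventually_elim simp
qed

text \<open>
  At low frequencies the potential with transform \<open>- \<i> s\<close> need not be square integrable; subtracting
  the constant \<open>1\<close> from the exponential gains the missing factor \<open>norm \<xi>\<close>.
\<close>

lemma low_frequency_potential:
  fixes s :: "real^'n \<Rightarrow> complex"
  assumes [measurable]: "s \<in> borel_measurable lebesgue"
    and s: "integrable lebesgue (\<lambda>\<xi>. norm \<xi> * cmod (s \<xi>))"
  defines "q \<equiv> \<lambda>x. LINT \<xi>|lebesgue. s \<xi> * (cis (x \<bullet> \<xi>) - 1)"
  shows "locally_integrable q"
    and "\<And>\<phi>. test_function \<phi> \<Longrightarrow> (LINT x|lebesgue. q x * partial i \<phi> x)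
      = - \<i> * (LINT \<xi>|lebesgue. complex_of_real (\<xi> $ i) * s \<xi> * fint 1 \<phi> \<xi>)"
proof -
  have cis_le: "cmod (cis t - 1) \<le> \<bar>t\<bar>" for t
    using iexp_approx1[of t 0] by (simp add: cis_conv_exp)
  have le: "cmod (s \<xi> * (cis (x \<bullet> \<xi>) - 1)) \<le> norm x * (norm \<xi> * cmod (s \<xi>))" for x \<xi>
  proof -
    have "cmod (s \<xi> * (cis (x \<bullet> \<xi>) - 1)) \<le> cmod (s \<xi>) * \<bar>x \<bullet> \<xi>\<bar>"
      unfolding norm_mult by (intro mult_left_mono cis_le) simp
    also have "\<dots> \<le> cmod (s \<xi>) * (norm x * norm \<xi>)"
      by (intro mult_left_mono Cauchy_Schwarz_ineq2) simp
    finally show ?thesis by (simp add: mult_ac)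
  qed
  have int: "integrable lebesgue (\<lambda>\<xi>. s \<xi> * (cis (x \<bullet> \<xi>) - 1))" for x
  proof (rule Bochner_Integration.integrable_bound)
    show "integrable lebesgue (\<lambda>\<xi>. norm x * (norm \<xi> * cmod (s \<xi>)))" using s by simp
    show "AE \<xi> in lebesgue. norm (s \<xi> * (cis (x \<bullet> \<xi>) - 1)) \<le> norm (norm x * (norm \<xi> * cmod (s \<xi>)))"
      unfolding real_norm_def by (intro AE_I2 order_trans[OF le abs_ge_self])
  qed measurable
  define D where "D = (LINT \<xi>|lebesgue. norm \<xi> * cmod (s \<xi>))"
  have D0: "0 \<le> D" unfolding D_def by (intro integral_nonneg_AE) simp
  have qb: "cmod (q x) \<le> norm x * D" for x
  proof -
    have "cmod (q x) \<le> (LINT \<xi>|lebesgue. cmod (s \<xi> * (cis (x \<bullet> \<xi>) - 1)))"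
      unfolding q_def by (rule integral_norm_bound)
    also have "\<dots> \<le> (LINT \<xi>|lebesgue. norm x * (norm \<xi> * cmod (s \<xi>)))"
      using s by (intro integral_mono le integrable_norm int) simp
    finally show ?thesis by (simp add: D_def)
  qed
  have [measurable]: "q \<in> borel_measurable lebesgue"
    unfolding q_def
  proof (rule lebesgue.borel_measurable_lebesgue_integral)
    show "(\<lambda>(x, \<xi>). s \<xi> * (cis (x \<bullet> \<xi>) - 1)) \<in> borel_measurable (lebesgue \<Otimes>\<^sub>M lebesgue)"
      unfolding split_beta by measurable
  qed
  show "locally_integrable q"
    unfolding locally_integrable_def
  proof (intro allI impI)
    fix K :: "(real^'n) set" assume K: "compact K"
    then obtain B where B: "\<And>x. x \<in> K \<Longrightarrow> norm x \<le> B" using compact_imp_bounded bounded_iff by metis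
    have KL: "K \<in> lmeasurable" by (rule lmeasurable_compact[OF K])
    then have [measurable]: "K \<in> sets lebesgue" by blast
    have iK: "integrable lebesgue (indicat_real K)" using KL by (simp add: lmeasurable_iff_integrable)
    show "set_integrable lebesgue K q"
      unfolding set_integrable_def
    proof (rule Bochner_Integration.integrable_bound)
      show "integrable lebesgue (\<lambda>x. B * D * indicat_real K x)" using iK by simp
      show "AE x in lebesgue. norm (indicat_real K x *\<^sub>R q x) \<le> norm (B * D * indicat_real K x)"
      proof (rule AE_I2)
        fix x
        show "norm (indicat_real K x *\<^sub>R q x) \<le> norm (B * D * indicat_real K x)"
        proof (cases "x \<in> K")
          case True
          have "cmod (q x) \<le> B * D" by (rule order_trans[OF qb mult_right_mono[OF B[OF True] D0]])
          then show ?thesis using True by simp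
        qed simp
      qed
    qed measurable
  qed
  fix \<phi> :: "real^'n \<Rightarrow> complex" assume \<phi>: "test_function \<phi>"
  let ?\<psi> = "partial i \<phi>"
  note \<psi> = test_function_facts[OF test_function_partial[OF \<phi>, of i]]
  have [measurable]: "?\<psi> \<in> borel_measurable lebesgue" using \<psi>(3) by simp
  obtain R where R: "\<And>x. ?\<psi> x \<noteq> 0 \<Longrightarrow> norm x \<le> R"
    using test_function_partial[OF \<phi>, of i] by (auto simp: test_function_def bounded_iff)
  \<comment> \<open>The potential grows at most linearly, so the exchange of integrals is dominated
    by the first moment of the test function.\<close>
  have x\<psi>: "integrable lebesgue (\<lambda>x. norm x * cmod (?\<psi> x))"
  proof (rule Bochner_Integration.integrable_bound)
    show "integrable lebesgue (\<lambda>x. R * cmod (?\<psi> x))" using \<psi>(3) by simp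
    have "norm x * cmod (?\<psi> x) \<le> \<bar>R * cmod (?\<psi> x)\<bar>" for x
    proof (cases "?\<psi> x = 0")
      case False
      then have "norm x * cmod (?\<psi> x) \<le> R * cmod (?\<psi> x)" by (intro mult_right_mono R) auto
      then show ?thesis by simp
    qed simp
    then show "AE x in lebesgue. norm (norm x * cmod (?\<psi> x)) \<le> norm (R * cmod (?\<psi> x))" by simp
  qed measurable
  have I: "integrable (lebesgue \<Otimes>\<^sub>M lebesgue) (\<lambda>(x, \<xi>). s \<xi> * (cis (x \<bullet> \<xi>) - 1) * ?\<psi> x)"
  proof (rule lebesgue_pair.Fubini_integrable)
    show m: "(\<lambda>(x, \<xi>). s \<xi> * (cis (x \<bullet> \<xi>) - 1) * ?\<psi> x) \<in> borel_measurable (lebesgue \<Otimes>\<^sub>M lebesgue)"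
      unfolding split_beta by measurable
    show "AE x in lebesgue. integrable lebesgue (\<lambda>\<xi>. case (x, \<xi>) of (x, \<xi>) \<Rightarrow> s \<xi> * (cis (x \<bullet> \<xi>) - 1) * ?\<psi> x)"
      using int by simp
    show "integrable lebesgue (\<lambda>x. LINT \<xi>|lebesgue. norm (case (x, \<xi>) of (x, \<xi>) \<Rightarrow> s \<xi> * (cis (x \<bullet> \<xi>) - 1) * ?\<psi> x))"
    proof (rule Bochner_Integration.integrable_bound)
      show "integrable lebesgue (\<lambda>x. D * (norm x * cmod (?\<psi> x)))" using x\<psi> by simp
      show "(\<lambda>x. LINT \<xi>|lebesgue. norm (case (x, \<xi>) of (x, \<xi>) \<Rightarrow> s \<xi> * (cis (x \<bullet> \<xi>) - 1) * ?\<psi> x)) \<in> borel_measurable lebesgue"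
      proof (rule lebesgue.borel_measurable_lebesgue_integral)
        show "(\<lambda>(x, \<xi>). norm (case (x, \<xi>) of (x, \<xi>) \<Rightarrow> s \<xi> * (cis (x \<bullet> \<xi>) - 1) * ?\<psi> x)) \<in> borel_measurable (lebesgue \<Otimes>\<^sub>M lebesgue)"
          unfolding split_beta by measurable
      qed
      have "(LINT \<xi>|lebesgue. norm (s \<xi> * (cis (x \<bullet> \<xi>) - 1) * ?\<psi> x)) \<le> D * (norm x * cmod (?\<psi> x))" for x
      proof -
        have "(LINT \<xi>|lebesgue. norm (s \<xi> * (cis (x \<bullet> \<xi>) - 1) * ?\<psi> x)) = (LINT \<xi>|lebesgue. cmod (s \<xi> * (cis (x \<bullet> \<xi>) - 1))) * cmod (?\<psi> x)"
          by (simp only: norm_mult[of _ "?\<psi> x"] integral_mult_left_zero)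
        also have "\<dots> \<le> (LINT \<xi>|lebesgue. norm x * (norm \<xi> * cmod (s \<xi>))) * cmod (?\<psi> x)"
          using s by (intro mult_right_mono integral_mono le integrable_norm int) auto
        also have "\<dots> = D * (norm x * cmod (?\<psi> x))"
          unfolding integral_mult_right_zero D_def by (simp only: mult_ac)
        finally show ?thesis .
      qed
      then show "AE x in lebesgue. norm (LINT \<xi>|lebesgue. norm (case (x, \<xi>) of (x, \<xi>) \<Rightarrow> s \<xi> * (cis (x \<bullet> \<xi>) - 1) * ?\<psi> x))
          \<le> norm (D * (norm x * cmod (?\<psi> x)))"
        using D0 by (simp add: abs_mult)
    qed
  qed
  \<comment> \<open>The subtracted constant contributes the transform of a derivative at frequency
    0, which vanishes.\<close>
  have inner: "(LINT x|lebesgue. s \<xi> * (cis (x \<bullet> \<xi>) - 1) * ?\<psi> x) = - \<i> * (complex_of_real (\<xi> $ i) * s \<xi> * fint 1 \<phi> \<xi>)" for \<xi>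
  proof -
    have "(LINT x|lebesgue. s \<xi> * (cis (x \<bullet> \<xi>) - 1) * ?\<psi> x)
        = (LINT x|lebesgue. s \<xi> * (?\<psi> x * cis (1 * (x \<bullet> \<xi>)) - ?\<psi> x * cis (1 * (x \<bullet> 0))))"
      by (simp add: algebra_simps)
    also have "\<dots> = s \<xi> * (fint 1 ?\<psi> \<xi> - fint 1 ?\<psi> 0)"
      unfolding integral_mult_right_zero fint_def
      by (subst Bochner_Integration.integral_diff[OF fint_integrand fint_integrand]) (use \<psi>(3) in auto)
    also have "\<dots> = - \<i> * (complex_of_real (\<xi> $ i) * s \<xi> * fint 1 \<phi> \<xi>)"
      by (simp add: fint_partial[OF \<phi>])
    finally show ?thesis .
  qed
  have "(LINT x|lebesgue. q x * ?\<psi> x) = (LINT x|lebesgue. LINT \<xi>|lebesgue. s \<xi> * (cis (x \<bullet> \<xi>) - 1) * ?\<psi> x)"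
    unfolding q_def by (simp only: integral_mult_left_zero)
  also have "\<dots> = (LINT \<xi>|lebesgue. LINT x|lebesgue. s \<xi> * (cis (x \<bullet> \<xi>) - 1) * ?\<psi> x)"
    by (rule lebesgue_pair.Fubini_integral[OF I, symmetric])
  also have "\<dots> = - \<i> * (LINT \<xi>|lebesgue. complex_of_real (\<xi> $ i) * s \<xi> * fint 1 \<phi> \<xi>)"
    unfolding inner by (rule integral_mult_right_zero)
  finally show "(LINT x|lebesgue. q x * ?\<psi> x) = - \<i> * (LINT \<xi>|lebesgue. complex_of_real (\<xi> $ i) * s \<xi> * fint 1 \<phi> \<xi>)" .
qed

section \<open>Potentials of fields with transform parallel to \<xi>\<close>

lemma integrable_mult_test_function:
  assumes q: "locally_integrable q" and \<psi>: "test_function \<psi>"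
  shows "integrable lebesgue (\<lambda>x. q x * \<psi> x)"
proof -
  let ?K = "closure {x. \<psi> x \<noteq> 0}"
  have [measurable]: "\<psi> \<in> borel_measurable lebesgue" using test_function_facts(3)[OF \<psi>] by simp
  obtain C where C: "\<And>x. cmod (\<psi> x) \<le> C" using test_function_facts(2)[OF \<psi>] by blast
  have K: "compact ?K" using \<psi> unfolding test_function_def by blast
  have "integrable lebesgue (\<lambda>x. indicat_real ?K x *\<^sub>R q x)"
    using q[unfolded locally_integrable_def, rule_format, OF K] unfolding set_integrable_def .
  then have "integrable lebesgue (\<lambda>x. indicat_real ?K x *\<^sub>R q x * \<psi> x)"
    by (rule integrable_mult_bounded[OF _ _ C]) simp
  moreover have "indicat_real ?K x *\<^sub>R q x * \<psi> x = q x * \<psi> x" for x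
    using closure_subset[of "{x. \<psi> x \<noteq> 0}"] by (auto split: split_indicator)
  ultimately show ?thesis by simp
qed

lemma L2_locally_integrable:
  fixes q :: "real^'n \<Rightarrow> complex"
  assumes "q \<in> L2"
  shows "locally_integrable q"
  unfolding locally_integrable_def set_integrable_def
proof (intro allI impI)
  fix K :: "(real^'n) set" assume "compact K"
  then have "K \<in> lmeasurable" by (rule lmeasurable_compact)
  then have "integrable lebesgue (\<lambda>x. indicator K x * q x)"
    by (intro L2_mult_integrable indicator_L2 assms)
  moreover have "indicator K x * q x = indicat_real K x *\<^sub>R q x" for x by (auto split: split_indicator)
  ultimately show "integrable lebesgue (\<lambda>x. indicat_real K x *\<^sub>R q x)" by simp
qed

lemma locally_integrable_add_cmult:
  assumes "locally_integrable p" "locally_integrable q"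
  shows "locally_integrable (\<lambda>x. p x + c * q x)"
proof -
  have eq: "indicat_real K x *\<^sub>R (p x + c * q x) = indicat_real K x *\<^sub>R p x + c * (indicat_real K x *\<^sub>R q x)" for K x
    by (simp add: scaleR_add_right)
  show ?thesis
    using assms unfolding locally_integrable_def set_integrable_def eq
    by (intro allI impI Bochner_Integration.integrable_add integrable_mult_right) blast+
qed

text \<open>The potential ought to have transform \<open>- \<i> * s\<close>. It is assembled from a
  high-frequency part obtained by surjectivity and a low-frequency part given by an explicit
  integral.\<close>

lemma H_curl0I:
  fixes g :: "real^'n \<Rightarrow> complex^'n"
  assumes g: "g \<in> L2" and [measurable]: "s \<in> borel_measurable lebesgue"
    and gs: "AE \<xi> in lebesgue. fourier g \<xi> = cvec \<xi> (s \<xi>)"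
  shows "g \<in> H_curl0"
proof -
  define c where "c = complex_of_real ((2 * pi) ^ CARD('n))"
  have c: "c \<noteq> 0" by (simp add: c_def)
  have bm [measurable]: "{\<xi>::real^'n. 1 \<le> norm \<xi>} \<in> sets lebesgue" "ball (0::real^'n) 1 \<in> sets lebesgue"
    by (auto intro!: borel_closed closed_Collect_le continuous_intros)
  \<comment> \<open>Cutting at \<open>norm \<xi> = 1\<close>: above it \<open>cmod (s \<xi>)\<close>
    is at most the norm of the transform of \<open>g\<close>; below it
    \<open>norm \<xi> * cmod (s \<xi>)\<close> is integrable because the ball has finite
    measure.\<close>
  define s1 where "s1 \<xi> = indicator {\<xi>. 1 \<le> norm \<xi>} \<xi> * s \<xi>" for \<xi>
  define s0 where "s0 \<xi> = indicator (ball 0 1) \<xi> * s \<xi>" for \<xi>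
  have s_eq: "s \<xi> = s1 \<xi> + s0 \<xi>" for \<xi> by (auto simp: s1_def s0_def split: split_indicator)
  have [measurable]: "s1 \<in> borel_measurable lebesgue" "s0 \<in> borel_measurable lebesgue"
    unfolding s1_def[abs_def] s0_def[abs_def] by measurable
  have ng: "AE \<xi> in lebesgue. norm (fourier g \<xi>) = norm \<xi> * cmod (s \<xi>)"
    using gs by eventually_elim (simp add: norm_cvec)
  have s1: "s1 \<in> L2"
  proof (rule L2_mono(1)[OF _ fourier_in_L2[OF g], where C=1])
    show "AE \<xi> in lebesgue. norm (s1 \<xi>) \<le> 1 * norm (fourier g \<xi>)"
      using ng
    proof eventually_elim
      case (elim \<xi>)
      show ?case
      proof (cases "1 \<le> norm \<xi>")
        case True
        then show ?thesis
          using mult_right_mono[OF True norm_ge_zero[of "s \<xi>"]] by (simp add: s1_def elim)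
      qed (simp add: s1_def)
    qed
  qed measurable
  have s0i: "integrable lebesgue (\<lambda>\<xi>. norm \<xi> * cmod (- \<i> * s0 \<xi>))"
  proof (rule integrable_cong_AE_imp)
    have "(\<lambda>\<xi>. complex_of_real (norm (fourier g \<xi>))) \<in> L2"
    proof (rule L2_mono(1)[OF _ fourier_in_L2[OF g], where C=1])
      note [measurable] = L2_measurable[OF fourier_in_L2[OF g]]
      show "(\<lambda>\<xi>. complex_of_real (norm (fourier g \<xi>))) \<in> borel_measurable lebesgue" by measurable
    qed simp
    then have "integrable lebesgue (\<lambda>\<xi>. cmod (indicator (ball 0 1) \<xi> * complex_of_real (norm (fourier g \<xi>))))"
      by (intro integrable_norm L2_mult_integrable indicator_L2) simp_all
    then show "integrable lebesgue (\<lambda>\<xi>. cmod (indicator (ball 0 1) \<xi> * complex_of_real (norm (fourier g \<xi>))))" .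
    show "AE \<xi> in lebesgue. cmod (indicator (ball 0 1) \<xi> * complex_of_real (norm (fourier g \<xi>))) = norm \<xi> * cmod (- \<i> * s0 \<xi>)"
      using ng by eventually_elim (auto simp: s0_def norm_mult split: split_indicator)
  qed measurable
  obtain p where p: "p \<in> L2" "AE \<xi> in lebesgue. fourier_L2 (- 1) p \<xi> = - \<i> * s1 \<xi>"
    using fourier_L2_surj[OF L2_cmult(1)[OF s1, of "- \<i>"], of "- 1"] by auto
  define q0 where "q0 x = (LINT \<xi>|lebesgue. - \<i> * s0 \<xi> * (cis (x \<bullet> \<xi>) - 1))" for x
  have "(\<lambda>\<xi>. - \<i> * s0 \<xi>) \<in> borel_measurable lebesgue" by measurable
  note low = low_frequency_potential[OF this s0i, folded q0_def]
  \<comment> \<open>The integral defining \<open>q0\<close> is unnormalised, hence the division by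
    \<open>c\<close>, whereas \<open>p\<close> already has the right transform.\<close>
  define q where "q x = p x + inverse c * q0 x" for x
  have "locally_integrable q"
    unfolding q_def[abs_def] by (intro locally_integrable_add_cmult L2_locally_integrable p low)
  moreover have "is_weak_gradient q g"
    unfolding is_weak_gradient_def
  proof (intro allI impI)
    fix \<phi> :: "real^'n \<Rightarrow> complex" and i assume \<phi>: "test_function \<phi>"
    note \<psi> = test_function_partial[OF \<phi>, of i]
    have [measurable]: "fint 1 \<phi> \<in> borel_measurable lebesgue"
      using test_function_facts(3)[OF \<phi>] by simp
    note [measurable] = L2_measurable[OF fourier_L2_in_L2[OF p(1), of "- 1", simplified]]
      L2_measurable[OF fourier_L2_in_L2[OF L2_component[OF g, of i], of "- 1", simplified]]
    let ?T = "\<lambda>\<xi>. complex_of_real (\<xi> $ i) * s \<xi> * fint 1 \<phi> \<xi>"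
    let ?A = "\<lambda>\<xi>. complex_of_real (\<xi> $ i) * (- \<i> * s1 \<xi>) * fint 1 \<phi> \<xi>"
    let ?B = "\<lambda>\<xi>. complex_of_real (\<xi> $ i) * (- \<i> * s0 \<xi>) * fint 1 \<phi> \<xi>"
    have Tae: "AE \<xi> in lebesgue. fourier_L2 (- 1) (\<lambda>x. g x $ i) \<xi> * fint 1 \<phi> \<xi> = ?T \<xi>"
      using gs fourier_component[OF g] by eventually_elim (metis cvec_nth)
    have Ti: "integrable lebesgue ?T"
      by (rule integrable_cong_AE_imp[OF test_function_pairing(1)[OF L2_component[OF g] \<phi>] _ Tae]) measurable
    have "(LINT \<xi>|lebesgue. ?T \<xi>) = (LINT \<xi>|lebesgue. fourier_L2 (- 1) (\<lambda>x. g x $ i) \<xi> * fint 1 \<phi> \<xi>)"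
      using Tae by (intro integral_cong_AE) (auto elim: eventually_mono)
    also have "\<dots> = c * (LINT x|lebesgue. g x $ i * \<phi> x)"
      unfolding c_def by (rule test_function_pairing(2)[OF L2_component[OF g] \<phi>])
    finally have T: "(LINT \<xi>|lebesgue. ?T \<xi>) = c * (LINT x|lebesgue. g x $ i * \<phi> x)" .
    note pp = partial_pairing[OF p(1) \<phi>, of i]
    have Aae: "AE \<xi> in lebesgue. complex_of_real (\<xi> $ i) * fourier_L2 (- 1) p \<xi> * fint 1 \<phi> \<xi> = ?A \<xi>"
      using p(2) by eventually_elim simp
    have Ai: "integrable lebesgue ?A"
      by (rule integrable_cong_AE_imp[OF pp(1) _ Aae]) measurable
    have A: "c * (LINT x|lebesgue. p x * partial i \<phi> x) = - \<i> * (LINT \<xi>|lebesgue. ?A \<xi>)"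
      unfolding c_def pp(2)[symmetric] using Aae by (intro arg_cong[where f="\<lambda>z. - \<i> * z"] integral_cong_AE) auto
    \<comment> \<open>Adding the low and the high part restores \<open>s\<close>; the two factors
      \<open>- \<i>\<close> multiply to the minus sign of the weak gradient.\<close>
    have "?B \<xi> = - \<i> * ?T \<xi> - ?A \<xi>" for \<xi> by (simp add: s_eq algebra_simps)
    then have B: "(LINT \<xi>|lebesgue. ?B \<xi>) = - \<i> * (LINT \<xi>|lebesgue. ?T \<xi>) - (LINT \<xi>|lebesgue. ?A \<xi>)"
      using Bochner_Integration.integral_diff[OF integrable_mult_right[OF Ti, of "- \<i>"] Ai]
      unfolding integral_mult_right_zero by presburger
    have "(LINT x|lebesgue. q x * partial i \<phi> x)
        = (LINT x|lebesgue. p x * partial i \<phi> x + inverse c * (q0 x * partial i \<phi> x))"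
      by (simp add: q_def distrib_right mult.assoc)
    also have "\<dots> = (LINT x|lebesgue. p x * partial i \<phi> x) + inverse c * (LINT x|lebesgue. q0 x * partial i \<phi> x)"
      unfolding integral_mult_right_zero[symmetric]
      by (intro Bochner_Integration.integral_add integrable_mult_right integrable_mult_test_function
          L2_locally_integrable p low \<psi>)
    finally have "c * (LINT x|lebesgue. q x * partial i \<phi> x)
        = c * (LINT x|lebesgue. p x * partial i \<phi> x) + (LINT x|lebesgue. q0 x * partial i \<phi> x)"
      using c by (simp add: distrib_left mult.assoc[symmetric])
    also have "\<dots> = c * - (LINT x|lebesgue. g x $ i * \<phi> x)"
      unfolding A low(2)[OF \<phi>] B T by (simp add: algebra_simps)
    finally show "(LINT x|lebesgue. q x * partial i \<phi> x) = - (LINT x|lebesgue. g x $ i * \<phi> x)"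
      by (rule mult_left_cancel[OF c, THEN iffD1])
  qed
  ultimately show ?thesis using g by (auto simp: H_curl0_def)
qed

text \<open>Vanishing Leray projection means that the transform is parallel to \<xi>. The factor in
  front of \<xi> is \<open>cdot \<xi>\<close> of the transform over the squared norm, and it is the
  \<open>s\<close> that the construction of a potential takes.\<close>

lemma H_curl0_iff:
  fixes h :: "real^'n \<Rightarrow> complex^'n"
  shows "h \<in> H_curl0 \<longleftrightarrow> h \<in> L2 \<and> (AE \<xi> in lebesgue. leray \<xi> (fourier h \<xi>) = 0)"
proof
  assume "h \<in> H_curl0"
  then obtain q where h: "h \<in> L2" and q: "is_weak_gradient q h" by (auto simp: H_curl0_def)
  have "AE \<xi> in lebesgue. \<forall>i j. complex_of_real (\<xi> $ i) * fourier h \<xi> $ j = complex_of_real (\<xi> $ j) * fourier h \<xi> $ i"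
    by (subst AE_all_countable, rule, subst AE_all_countable, rule) (rule weak_gradient_curl_free[OF h q])
  then have "AE \<xi> in lebesgue. leray \<xi> (fourier h \<xi>) = 0"
    using AE_box_index
  proof eventually_elim
    case (elim \<xi>)
    have n0: "(norm \<xi>)\<^sup>2 \<noteq> 0" using elim(2) by auto
    \<comment> \<open>Multiplying the curl-free relation by \<open>\<xi> $ j\<close> and summing
      over \<open>j\<close>.\<close>
    have "complex_of_real ((norm \<xi>)\<^sup>2) * fourier h \<xi> $ i = complex_of_real (\<xi> $ i) * cdot \<xi> (fourier h \<xi>)" for i
    proof -
      have "complex_of_real ((norm \<xi>)\<^sup>2) * fourier h \<xi> $ i
          = (\<Sum>j\<in>UNIV. complex_of_real (\<xi> $ j) * (complex_of_real (\<xi> $ j) * fourier h \<xi> $ i))"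
        unfolding norm_real_vec_sq by (simp add: sum_distrib_right power2_eq_square mult.assoc)
      also have "\<dots> = (\<Sum>j\<in>UNIV. complex_of_real (\<xi> $ j) * (complex_of_real (\<xi> $ i) * fourier h \<xi> $ j))"
        using elim(1) by simp
      finally show ?thesis by (simp add: cdot_def sum_distrib_left mult.left_commute)
    qed
    then have "fourier h \<xi> $ i = complex_of_real (\<xi> $ i) * (cdot \<xi> (fourier h \<xi>) / complex_of_real ((norm \<xi>)\<^sup>2))" for i
      using n0 by (simp add: eq_divide_eq mult.commute del: of_real_power)
    then show ?case by (simp add: leray_def vec_eq_iff)
  qed
  then show "h \<in> L2 \<and> (AE \<xi> in lebesgue. leray \<xi> (fourier h \<xi>) = 0)" using h by simp
next
  assume a: "h \<in> L2 \<and> (AE \<xi> in lebesgue. leray \<xi> (fourier h \<xi>) = 0)"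
  then have h: "h \<in> L2" by simp
  note [measurable] = L2_measurable[OF fourier_in_L2[OF h]]
  show "h \<in> H_curl0"
  proof (rule H_curl0I[OF h])
    show "(\<lambda>\<xi>. cdot \<xi> (fourier h \<xi>) / complex_of_real ((norm \<xi>)\<^sup>2)) \<in> borel_measurable lebesgue"
      unfolding cdot_def by measurable
    show "AE \<xi> in lebesgue. fourier h \<xi> = cvec \<xi> (cdot \<xi> (fourier h \<xi>) / complex_of_real ((norm \<xi>)\<^sup>2))"
      using conjunct2[OF a] by eventually_elim (simp add: leray_def)
  qed
qed

section \<open>Orthogonality and the Helmholtz projections\<close>

lemma leray_diff: "leray \<xi> (y - z) = leray \<xi> y - leray \<xi> z"
  by (simp add: leray_def cdot_diff cvec_diff diff_divide_distrib)

lemma leray_idem: "leray \<xi> (leray \<xi> z) = leray \<xi> z"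
  unfolding leray_def[of \<xi> "leray \<xi> z"] cdot_leray by (simp add: vec_eq_iff)

lemma H_div0_diff: "v \<in> H_div0 \<Longrightarrow> w \<in> H_div0 \<Longrightarrow> (\<lambda>x. v x - w x) \<in> H_div0"
  unfolding H_div0_iff
proof (elim conjE, intro conjI L2_diff)
  assume vw: "v \<in> L2" "w \<in> L2" and a: "AE \<xi> in lebesgue. cdot \<xi> (fourier v \<xi>) = 0" "AE \<xi> in lebesgue. cdot \<xi> (fourier w \<xi>) = 0"
  show "AE \<xi> in lebesgue. cdot \<xi> (fourier (\<lambda>x. v x - w x) \<xi>) = 0"
    using fourier_diff[OF vw] a by eventually_elim (simp add: cdot_diff)
qed

lemma H_curl0_diff: "v \<in> H_curl0 \<Longrightarrow> w \<in> H_curl0 \<Longrightarrow> (\<lambda>x. v x - w x) \<in> H_curl0"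
  unfolding H_curl0_iff
proof (elim conjE, intro conjI L2_diff)
  assume vw: "v \<in> L2" "w \<in> L2" and a: "AE \<xi> in lebesgue. leray \<xi> (fourier v \<xi>) = 0" "AE \<xi> in lebesgue. leray \<xi> (fourier w \<xi>) = 0"
  show "AE \<xi> in lebesgue. leray \<xi> (fourier (\<lambda>x. v x - w x) \<xi>) = 0"
    using fourier_diff[OF vw] a by eventually_elim (simp add: leray_diff)
qed

lemma L2_inner_integrable:
  assumes "f \<in> L2" "g \<in> L2"
  shows "integrable lebesgue (\<lambda>x. f x $ i * cnj (g x $ i))"
  by (intro L2_mult_integrable L2_cnj L2_component assms)

lemma L2_inner_diff:
  assumes "f \<in> L2" "g \<in> L2" "h \<in> L2"
  shows "L2_inner (\<lambda>x. f x - g x) h = L2_inner f h - L2_inner g h"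
  using assms by (simp add: L2_inner_def left_diff_distrib sum_subtractf L2_inner_integrable)

lemma L2_inner_self:
  assumes "f \<in> L2"
  shows "L2_inner f f = complex_of_real (sqn f)"
  using assms by (simp add: L2_inner_def L2_inner_integrable sqn_vec sqn_conv_integral)

lemma L2_inner_commute: "L2_inner g f = cnj (L2_inner f g)"
  unfolding L2_inner_def by (subst Bochner_Integration.integral_cnj[symmetric]) (simp add: mult.commute)

text \<open>After Plancherel in each component, the integrand vanishes at almost every frequency:
  one transform is orthogonal to \<xi>, the other parallel to it.\<close>

lemma H_div0_H_curl0_orthogonal:
  fixes f g :: "real^'n \<Rightarrow> complex^'n"
  assumes f: "f \<in> H_div0" and g: "g \<in> H_curl0"
  shows "L2_inner f g = 0"
proof -
  have fL: "f \<in> L2" and gL: "g \<in> L2" using f g by (auto simp: H_div0_iff H_curl0_iff)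
  have "(2 * pi) ^ CARD('n) * L2_inner f g
      = (\<Sum>i\<in>UNIV. (2 * pi) ^ CARD('n) * (LINT x|lebesgue. f x $ i * cnj (g x $ i)))"
    using fL gL by (simp add: L2_inner_def L2_inner_integrable sum_distrib_left)
  also have "\<dots> = (\<Sum>i\<in>UNIV. (LINT \<xi>|lebesgue. fourier_vec f \<xi> $ i * cnj (fourier_vec g \<xi> $ i)))"
    using fourier_L2_inner[OF L2_component[OF fL] L2_component[OF gL], of "- 1"]
    by (simp add: fourier_vec_def)
  also have "\<dots> = (LINT \<xi>|lebesgue. (\<Sum>i\<in>UNIV. fourier_vec f \<xi> $ i * cnj (fourier_vec g \<xi> $ i)))"
    by (rule Bochner_Integration.integral_sum[symmetric]) (intro L2_inner_integrable fourier_vec_L2 fL gL)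
  also have "\<dots> = 0"
  proof (rule integral_eq_zero_AE)
    have "AE \<xi> in lebesgue. cdot \<xi> (fourier f \<xi>) = 0" "AE \<xi> in lebesgue. leray \<xi> (fourier g \<xi>) = 0"
      using f g by (auto simp: H_div0_iff H_curl0_iff)
    then show "AE \<xi> in lebesgue. (\<Sum>i\<in>UNIV. fourier_vec f \<xi> $ i * cnj (fourier_vec g \<xi> $ i)) = 0"
      using fourier_AE[OF fL] fourier_AE[OF gL]
    proof eventually_elim
      case (elim \<xi>)
      define t where "t = cdot \<xi> (fourier g \<xi>) / complex_of_real ((norm \<xi>)\<^sup>2)"
      have g: "fourier_vec g \<xi> = cvec \<xi> t" using elim by (simp add: leray_def t_def)
      have "(\<Sum>i\<in>UNIV. fourier_vec f \<xi> $ i * cnj (fourier_vec g \<xi> $ i)) = cnj t * cdot \<xi> (fourier_vec f \<xi>)"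
        unfolding g by (simp add: cdot_def sum_distrib_left mult_ac)
      then show ?case using elim by simp
    qed
  qed
  finally show ?thesis by simp
qed

text \<open>Any \<open>d\<close> with the defining property shows that the choice is sound. The
  difference from the chosen element lies in \<open>H\<close> and is orthogonal to \<open>H\<close>,
  hence to itself.\<close>

lemma orth_proj_AE:
  fixes u d :: "real^'n \<Rightarrow> complex^'n"
  assumes H: "\<And>h. h \<in> H \<Longrightarrow> h \<in> L2" "\<And>v w. v \<in> H \<Longrightarrow> w \<in> H \<Longrightarrow> (\<lambda>x. v x - w x) \<in> H"
    and u: "u \<in> L2" and d: "d \<in> H" and orth: "\<And>h. h \<in> H \<Longrightarrow> L2_inner (\<lambda>x. u x - d x) h = 0"
  shows "orth_proj H u \<in> H" and "AE x in lebesgue. d x = orth_proj H u x"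
proof -
  let ?e = "orth_proj H u"
  have e: "?e \<in> H \<and> (\<forall>h\<in>H. L2_inner (\<lambda>x. u x - ?e x) h = 0)"
    unfolding orth_proj_def
    by (rule someI[where x=d and P="\<lambda>d. d \<in> H \<and> (\<forall>h\<in>H. L2_inner (\<lambda>x. u x - d x) h = 0)"]) (use d orth in blast)
  then show eH: "?e \<in> H" by simp
  let ?f = "\<lambda>x. d x - ?e x"
  have f: "?f \<in> H" by (rule H(2)[OF d eH])
  have "L2_inner ?f ?f = L2_inner (\<lambda>x. (u x - ?e x) - (u x - d x)) ?f" by simp
  also have "\<dots> = 0"
    using e orth[OF f] f by (subst L2_inner_diff) (auto intro: L2_diff H u d)
  finally have "sqn ?f = 0" using L2_inner_self[OF H(1)[OF f]] by simp
  then have "AE x in lebesgue. ?f x = 0" using sqn_eq_0_iff[OF H(1)[OF f]] by simp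
  then show "AE x in lebesgue. d x = ?e x" by simp
qed

theorem theorem10p1:
  fixes u :: "real^'n \<Rightarrow> complex^'n"
    and v :: "nat \<Rightarrow> real^'n \<Rightarrow> complex^'n"
  assumes "u \<in> L2"
    and "v 0 = u"
    and "\<And>p. v (Suc p) = (\<lambda>x. v p x - M_op (v p) x - L_op (v p) x)"
  shows "L2_tendsto v (\<lambda>x. 0) sequentially
    \<and> div_part u \<in> H_div0 \<and> curl_part u \<in> H_curl0
    \<and> (AE x in lebesgue. u x = div_part u x + curl_part u x)
    \<and> L2_sums (\<lambda>p. M_op (v p)) (div_part u)
    \<and> L2_sums (\<lambda>p. L_op (v p)) (curl_part u)"
proof -
  \<comment> \<open>The candidate for the divergence-free part is the field whose transform is the
    Leray projection of that of \<open>u\<close>.\<close>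
  obtain d where d: "d \<in> L2" "AE \<xi> in lebesgue. fourier d \<xi> = leray \<xi> (fourier u \<xi>)"
    using fourier_surj[OF leray_L2[OF assms(1)]] by blast
  let ?c = "\<lambda>x. u x - d x"
  have dH: "d \<in> H_div0"
    unfolding H_div0_iff using d by (auto simp: cdot_leray elim: eventually_mono)
  have cL: "?c \<in> L2" by (rule L2_diff(1)[OF assms(1) d(1)])
  have "AE \<xi> in lebesgue. leray \<xi> (fourier ?c \<xi>) = 0"
    using fourier_diff[OF assms(1) d(1)] d(2)
    by eventually_elim (simp add: leray_diff leray_idem)
  then have cH: "?c \<in> H_curl0" using cL by (simp add: H_curl0_iff)
  have div: "div_part u \<in> H_div0" "AE x in lebesgue. d x = div_part u x"
  proof -
    \<comment> \<open>Orthogonality is stated with the divergence-free field first; conjugate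
      symmetry turns it around.\<close>
    have o: "L2_inner ?c h = 0" if "h \<in> H_div0" for h
      using L2_inner_commute[of ?c h] H_div0_H_curl0_orthogonal[OF that cH] by simp
    have L: "h \<in> L2" if "h \<in> H_div0" for h :: "real^'n \<Rightarrow> complex^'n" using that by (simp add: H_div0_iff)
    show "div_part u \<in> H_div0" "AE x in lebesgue. d x = div_part u x"
      unfolding div_part_def using orth_proj_AE[OF L H_div0_diff assms(1) dH o] by blast+
  qed
  have curl: "curl_part u \<in> H_curl0" "AE x in lebesgue. ?c x = curl_part u x"
  proof -
    have o: "L2_inner (\<lambda>x. u x - ?c x) h = 0" if "h \<in> H_curl0" for h
      using H_div0_H_curl0_orthogonal[OF dH that] by simp
    have L: "h \<in> L2" if "h \<in> H_curl0" for h :: "real^'n \<Rightarrow> complex^'n" using that by (simp add: H_curl0_iff)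
    show "curl_part u \<in> H_curl0" "AE x in lebesgue. ?c x = curl_part u x"
      unfolding curl_part_def using orth_proj_AE[OF L H_curl0_diff assms(1) cH o] by blast+
  qed
  have "AE x in lebesgue. u x = div_part u x + curl_part u x"
    using div(2) curl(2) by eventually_elim (simp add: algebra_simps)
  \<comment> \<open>Limits are invariant under changes on null sets, so the sums found for
    \<open>d\<close> and \<open>u - d\<close> hold for the chosen projections.\<close>
  then show ?thesis
    using iteration_convergence[OF assms d] div curl
    by (auto simp: L2_sums_def intro: L2_tendsto_cong_AE)
qed

end
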